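(* Let $b_0>0$ and $\frac12<\alpha<1$, let $A$ be the self-adjoint Jacobi operator in $\ell^2(\mathbb{N}_0)$ with zero diagonal and off-diagonal weights $b_0$, $b_{2k-1}=b_{2k}=k^\alpha$ ($k=1,2,3,\dots$), and let $f$ be its spectral density. Then $f$ is equivalent to a function that is positive and continuous everywhere except possibly at the point $x=0$; that is, there is a continuous function $g:\mathbb{R}\setminus\{0\}\to(0,\infty)$ such that $f(x)=g(x)$ for Lebesgue-almost every $x$.
   Context: The Jacobi matrix is the infinite symmetric tridiagonal matrix with rows and columns indexed by $n=0,1,2,\dots$, zero diagonal entries, and entries $b_n$ in positions $(n,n+1)$ and $(n+1,n)$, where $b_0>0$ and $b_{2k-1}=b_{2k}=k^\alpha$ for $k\ge1$. For $\alpha\in(1/2,1)$ it defines an unbounded self-adjoint operator $A$ in $\ell^2(\mathbb{N}_0)$. Let $e_0=(1,0,0,\dots)$, let $E_A$ be the spectral measure (projection-valued) of $A$, and let $\sigma(B)=\langle E_A(B)e_0,e_0\rangle$ be the scalar spectral measure of $A$ (a probability measure on $\mathbb{R}$). The spectral density $f$ is the density with respect to Lebesgue measure of the absolutely continuous part of $\sigma$ (there may be an atom of $\sigma$ at $x=0$). *)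

theory Defs
  imports "HOL-Analysis.Analysis"
begin

text \<open>
  The complex Hilbert space of square-summable sequences is a carrier set inside
  \<^typ>\<open>nat \<Rightarrow> complex\<close>.  An unbounded operator is given by its domain \<^term>\<open>D\<close> and a function
  \<^term>\<open>T\<close> of which only the values on \<^term>\<open>D\<close> are relevant.
\<close>

definition ell2 :: "(nat \<Rightarrow> complex) set" where
  "ell2 = {x. summable (\<lambda>n. (cmod (x n))\<^sup>2)}"

definition ell2_inner :: "(nat \<Rightarrow> complex) \<Rightarrow> (nat \<Rightarrow> complex) \<Rightarrow> complex" where
  "ell2_inner x y = (\<Sum>n. x n * cnj (y n))"

definition ell2_norm :: "(nat \<Rightarrow> complex) \<Rightarrow> real" where
  "ell2_norm x = sqrt (\<Sum>n. (cmod (x n))\<^sup>2)"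

definition e0 :: "nat \<Rightarrow> complex" where
  "e0 n = (if n = 0 then 1 else 0)"


subsection \<open>The Jacobi operator with zero diagonal\<close>

definition jacobi_op :: "(nat \<Rightarrow> real) \<Rightarrow> (nat \<Rightarrow> complex) \<Rightarrow> nat \<Rightarrow> complex" where
  "jacobi_op b x n =
     (if n = 0 then 0 else of_real (b (n - 1)) * x (n - 1)) + of_real (b n) * x (Suc n)"

text \<open>
  The operator is taken on its maximal domain.  When it is self-adjoint (see
  \<open>jacobi_self_adjoint\<close> below), it coincides with the closure of its restriction
  to the finitely supported sequences.
\<close>

definition jacobi_domain :: "(nat \<Rightarrow> real) \<Rightarrow> (nat \<Rightarrow> complex) set" where
  "jacobi_domain b = {x \<in> ell2. jacobi_op b x \<in> ell2}"


subsection \<open>Spectral measures\<close>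

text \<open>
  Boundedness of an everywhere defined symmetric idempotent is automatic (Hellinger-Toeplitz).
\<close>

definition orthogonal_projection :: "((nat \<Rightarrow> complex) \<Rightarrow> (nat \<Rightarrow> complex)) \<Rightarrow> bool" where
  "orthogonal_projection P \<longleftrightarrow>
     (\<forall>x\<in>ell2. P x \<in> ell2) \<and>
     (\<forall>x\<in>ell2. \<forall>y\<in>ell2. \<forall>c d. P (\<lambda>n. c * x n + d * y n) = (\<lambda>n. c * P x n + d * P y n)) \<and>
     (\<forall>x\<in>ell2. P (P x) = P x) \<and>
     (\<forall>x\<in>ell2. \<forall>y\<in>ell2. ell2_inner (P x) y = ell2_inner x (P y))"

text \<open>Countable additivity is in the strong operator topology.\<close>

definition projection_valued_measure ::
  "(real set \<Rightarrow> (nat \<Rightarrow> complex) \<Rightarrow> (nat \<Rightarrow> complex)) \<Rightarrow> bool" where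
  "projection_valued_measure E \<longleftrightarrow>
     (\<forall>B\<in>sets borel. orthogonal_projection (E B)) \<and>
     (\<forall>x\<in>ell2. E {} x = (\<lambda>n. 0)) \<and>
     (\<forall>x\<in>ell2. E UNIV x = x) \<and>
     (\<forall>B\<in>sets borel. \<forall>C\<in>sets borel. \<forall>x\<in>ell2. E (B \<inter> C) x = E B (E C x)) \<and>
     (\<forall>B :: nat \<Rightarrow> real set. range B \<subseteq> sets borel \<longrightarrow> disjoint_family B \<longrightarrow>
        (\<forall>x\<in>ell2.
           (\<lambda>N. ell2_norm (\<lambda>n. E (\<Union>i. B i) x n - (\<Sum>i<N. E (B i) x n))) \<longlonglongrightarrow> 0))"

text \<open>
  For a projection-valued measure \<^term>\<open>E\<close> and \<^term>\<open>x \<in> ell2\<close> the set function below is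
  real-valued, nonnegative and countably additive on Borel sets, so that it is the
  \<^const>\<open>emeasure\<close> of this measure.
\<close>

definition scalar_spectral_measure ::
  "(real set \<Rightarrow> (nat \<Rightarrow> complex) \<Rightarrow> (nat \<Rightarrow> complex)) \<Rightarrow> (nat \<Rightarrow> complex) \<Rightarrow> real measure" where
  "scalar_spectral_measure E x =
     measure_of UNIV (sets borel) (\<lambda>B. ennreal (Re (ell2_inner (E B x) x)))"

text \<open>
  The identity \<open>T = \<integral> t dE(t)\<close>, including equality of the domains.  The quadratic form
  determines the operator by polarization on the domain.
\<close>

definition is_spectral_measure_of ::
  "(real set \<Rightarrow> (nat \<Rightarrow> complex) \<Rightarrow> (nat \<Rightarrow> complex)) \<Rightarrow>
   (nat \<Rightarrow> complex) set \<Rightarrow> ((nat \<Rightarrow> complex) \<Rightarrow> (nat \<Rightarrow> complex)) \<Rightarrow> bool" where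
  "is_spectral_measure_of E D T \<longleftrightarrow>
     projection_valued_measure E \<and>
     D = {x \<in> ell2. integrable (scalar_spectral_measure E x) (\<lambda>t. t\<^sup>2)} \<and>
     (\<forall>x\<in>D. ell2_inner (T x) x = complex_of_real (LINT t|scalar_spectral_measure E x. t))"


subsection \<open>The density of the absolutely continuous part\<close>

definition lebesgue_singular :: "real measure \<Rightarrow> bool" where
  "lebesgue_singular \<nu> \<longleftrightarrow> (\<exists>N \<in> null_sets lborel. emeasure \<nu> (UNIV - N) = 0)"

text \<open>
  \<^const>\<open>RN_deriv\<close> is not applicable here, as it is the zero function for a measure that is
  not absolutely continuous.
\<close>

definition is_ac_density :: "(real \<Rightarrow> real) \<Rightarrow> real measure \<Rightarrow> bool" where
  "is_ac_density f \<sigma> \<longleftrightarrow>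
     f \<in> borel_measurable borel \<and> (AE t in lborel. 0 \<le> f t) \<and>
     (\<exists>\<nu>. sets \<nu> = sets borel \<and> lebesgue_singular \<nu> \<and>
        (\<forall>B\<in>sets borel. emeasure \<sigma> B = emeasure (density lborel (\<lambda>t. ennreal (f t))) B + emeasure \<nu> B))"


subsection \<open>Self-adjointness of the Jacobi operator (Carleman's criterion)\<close>

definition self_adjoint_on ::
  "(nat \<Rightarrow> complex) set \<Rightarrow> ((nat \<Rightarrow> complex) \<Rightarrow> (nat \<Rightarrow> complex)) \<Rightarrow> bool" where
  "self_adjoint_on D T \<longleftrightarrow>
     D \<subseteq> ell2 \<and> T ` D \<subseteq> ell2 \<and>
     (\<forall>x\<in>ell2. \<forall>\<epsilon>>0. \<exists>y\<in>D. ell2_norm (\<lambda>n. x n - y n) < \<epsilon>) \<and>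
     (\<forall>y\<in>ell2. \<forall>z\<in>ell2.
        (\<forall>x\<in>D. ell2_inner (T x) y = ell2_inner x z) \<longleftrightarrow> y \<in> D \<and> T y = z)"

lemma ell2_summable_norm_mult:
  assumes "x \<in> ell2" "y \<in> ell2"
  shows "summable (\<lambda>n. cmod (x n) * cmod (y n))"
proof (rule summable_comparison_test')
  show "summable (\<lambda>n. (cmod (x n))\<^sup>2 + (cmod (y n))\<^sup>2)"
    using assms unfolding ell2_def mem_Collect_eq by (rule summable_add)
  show "norm (cmod (x n) * cmod (y n)) \<le> (cmod (x n))\<^sup>2 + (cmod (y n))\<^sup>2" if "n \<ge> 0" for n
  proof -
    have "0 \<le> cmod (x n) * cmod (y n)" by simp
    then have "cmod (x n) * cmod (y n) \<le> (cmod (x n))\<^sup>2 + (cmod (y n))\<^sup>2"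
      using sum_squares_bound[of "cmod (x n)" "cmod (y n)"] by linarith
    then show ?thesis by simp
  qed
qed

lemma ell2_summable_inner:
  assumes "x \<in> ell2" "y \<in> ell2"
  shows "summable (\<lambda>n. x n * cnj (y n))"
  by (rule summable_norm_cancel) (simp add: norm_mult ell2_summable_norm_mult assms)

lemma ell2_shift: "x \<in> ell2 \<Longrightarrow> (\<lambda>n. x (Suc n)) \<in> ell2"
  using summable_Suc_iff[of "\<lambda>n. (cmod (x n))\<^sup>2"] by (simp add: ell2_def)

lemma ell2_finite_support:
  assumes "\<And>n. n \<ge> N \<Longrightarrow> x n = 0"
  shows "x \<in> ell2"
proof -
  have "summable (\<lambda>n. (cmod (x n))\<^sup>2)"
    by (rule summable_finite[of "{..<N}"]) (simp_all add: assms)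
  then show ?thesis by (simp add: ell2_def)
qed

lemma jacobi_domain_finite_support:
  assumes "\<And>n. n \<ge> N \<Longrightarrow> x n = 0"
  shows "x \<in> jacobi_domain b"
proof -
  have "jacobi_op b x n = 0" if "n \<ge> Suc N" for n
    using that assms by (simp add: jacobi_op_def)
  then have "jacobi_op b x \<in> ell2" by (rule ell2_finite_support)
  moreover have "x \<in> ell2" using assms by (rule ell2_finite_support)
  ultimately show ?thesis by (simp add: jacobi_domain_def)
qed

lemma jacobi_green:
  "(\<Sum>n<Suc N. jacobi_op b x n * cnj (y n) - x n * cnj (jacobi_op b y n)) =
     of_real (b N) * (x (Suc N) * cnj (y N) - x N * cnj (y (Suc N)))"
proof (induction N)
  case 0
  show ?case by (simp add: jacobi_op_def algebra_simps)
next
  case (Suc N)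
  have "jacobi_op b x (Suc N) * cnj (y (Suc N)) - x (Suc N) * cnj (jacobi_op b y (Suc N)) =
      of_real (b (Suc N)) * (x (Suc (Suc N)) * cnj (y (Suc N)) - x (Suc N) * cnj (y (Suc (Suc N)))) -
      of_real (b N) * (x (Suc N) * cnj (y N) - x N * cnj (y (Suc N)))"
    by (simp add: jacobi_op_def algebra_simps)
  then show ?case
    unfolding sum.lessThan_Suc[of _ "Suc N"] Suc.IH by simp
qed

lemma jacobi_symmetric:
  assumes b: "\<And>n. b n > 0" and carleman: "\<not> summable (\<lambda>n. 1 / b n)"
    and x: "x \<in> jacobi_domain b" and y: "y \<in> jacobi_domain b"
  shows "ell2_inner (jacobi_op b x) y = ell2_inner x (jacobi_op b y)"
proof (rule ccontr)
  define L where "L = ell2_inner (jacobi_op b x) y - ell2_inner x (jacobi_op b y)"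
  define w where "w N = x (Suc N) * cnj (y N) - x N * cnj (y (Suc N))" for N
  assume "ell2_inner (jacobi_op b x) y \<noteq> ell2_inner x (jacobi_op b y)"
  then have L: "cmod L > 0" by (simp add: L_def)
  have mem: "x \<in> ell2" "y \<in> ell2" "jacobi_op b x \<in> ell2" "jacobi_op b y \<in> ell2"
    using x y by (auto simp: jacobi_domain_def)
  have "(\<lambda>n. jacobi_op b x n * cnj (y n) - x n * cnj (jacobi_op b y n)) sums L"
    unfolding L_def ell2_inner_def
    by (intro sums_diff summable_sums ell2_summable_inner mem)
  then have "(\<lambda>N. of_real (b N) * w N) \<longlonglongrightarrow> L"
    unfolding sums_def w_def jacobi_green[symmetric] by (rule LIMSEQ_Suc)
  then have "(\<lambda>N. cmod (of_real (b N) * w N)) \<longlonglongrightarrow> cmod L"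
    by (rule tendsto_norm)
  then have "\<forall>\<^sub>F N in sequentially. cmod (of_real (b N) * w N) > cmod L / 2"
    by (rule order_tendstoD) (use L in simp)
  then obtain N0 where N0: "\<And>N. N \<ge> N0 \<Longrightarrow> cmod L / 2 < b N * cmod (w N)"
    using b by (auto simp: eventually_sequentially norm_mult abs_of_pos)
  have "summable (\<lambda>n. 1 / b n)"
  proof (rule summable_comparison_test')
    show "summable (\<lambda>n. 2 / cmod L *
        (cmod (x (Suc n)) * cmod (y n) + cmod (x n) * cmod (y (Suc n))))"
      by (intro summable_mult summable_add ell2_summable_norm_mult mem ell2_shift)
    show "norm (1 / b n) \<le> 2 / cmod L *
        (cmod (x (Suc n)) * cmod (y n) + cmod (x n) * cmod (y (Suc n)))" if "n \<ge> N0" for n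
    proof -
      have "cmod (w n) \<le> cmod (x (Suc n)) * cmod (y n) + cmod (x n) * cmod (y (Suc n))"
        unfolding w_def by (rule norm_triangle_le_diff) (simp add: norm_mult)
      then have "2 / cmod L * cmod (w n) \<le> 2 / cmod L *
          (cmod (x (Suc n)) * cmod (y n) + cmod (x n) * cmod (y (Suc n)))"
        by (intro mult_left_mono) auto
      moreover have "1 / b n \<le> 2 / cmod L * cmod (w n)"
        using N0[OF that] L b[of n] by (simp add: field_simps)
      ultimately show ?thesis using b[of n] by simp
    qed
  qed
  with carleman show False by simp
qed

theorem jacobi_self_adjoint:
  assumes b: "\<And>n. b n > 0" and carleman: "\<not> summable (\<lambda>n. 1 / b n)"
  shows "self_adjoint_on (jacobi_domain b) (jacobi_op b)"
  unfolding self_adjoint_on_def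
proof (intro conjI ballI allI impI)
  show "jacobi_domain b \<subseteq> ell2" "jacobi_op b ` jacobi_domain b \<subseteq> ell2"
    by (auto simp: jacobi_domain_def)
next
  fix x and \<epsilon> :: real
  assume x: "x \<in> ell2" and \<epsilon>: "\<epsilon> > 0"
  then have s: "summable (\<lambda>n. (cmod (x n))\<^sup>2)" by (simp add: ell2_def)
  obtain N where N: "\<And>n. n \<ge> N \<Longrightarrow> norm (\<Sum>i. (cmod (x (i + n)))\<^sup>2) < \<epsilon>\<^sup>2"
    using suminf_exist_split[OF _ s, of "\<epsilon>\<^sup>2"] \<epsilon> by auto
  define y where "y n = (if n < N then x n else 0)" for n
  have s': "summable (\<lambda>n. (cmod (x n - y n))\<^sup>2)"
    by (rule summable_comparison_test'[OF s, of 0]) (auto simp: y_def)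
  have "(\<Sum>n. (cmod (x n - y n))\<^sup>2) =
      (\<Sum>n. (cmod (x (n + N) - y (n + N)))\<^sup>2) + (\<Sum>n<N. (cmod (x n - y n))\<^sup>2)"
    by (rule suminf_split_initial_segment[OF s'])
  also have "\<dots> = (\<Sum>i. (cmod (x (i + N)))\<^sup>2)"
    by (simp add: y_def)
  also have "\<dots> < \<epsilon>\<^sup>2" using N[of N] by auto
  finally have "ell2_norm (\<lambda>n. x n - y n) < \<epsilon>"
    unfolding ell2_norm_def using \<epsilon> by (simp add: real_less_lsqrt)
  moreover have "y \<in> jacobi_domain b"
    by (rule jacobi_domain_finite_support[of N]) (simp add: y_def)
  ultimately show "\<exists>y\<in>jacobi_domain b. ell2_norm (\<lambda>n. x n - y n) < \<epsilon>" by blast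
next
  fix y z assume y: "y \<in> ell2" and z: "z \<in> ell2"
  show "(\<forall>x\<in>jacobi_domain b. ell2_inner (jacobi_op b x) y = ell2_inner x z) \<longleftrightarrow>
      y \<in> jacobi_domain b \<and> jacobi_op b y = z" (is "?L \<longleftrightarrow> ?R")
  proof
    assume ?R
    then show ?L using jacobi_symmetric[OF b carleman] by blast
  next
    assume L: ?L
    have "jacobi_op b y k = z k" for k
    proof -
      define e where "e n = (if n = k then 1 else 0 :: complex)" for n
      have "e \<in> jacobi_domain b"
        by (rule jacobi_domain_finite_support[of "Suc k"]) (simp add: e_def)
      then have "ell2_inner (jacobi_op b e) y = ell2_inner e z" using L by blast
      moreover have "ell2_inner e z = cnj (z k)"
        unfolding ell2_inner_def e_def by (subst suminf_finite[of "{k}"]) auto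
      moreover have "ell2_inner (jacobi_op b e) y =
          (\<Sum>n<Suc (Suc k). jacobi_op b e n * cnj (y n))"
        unfolding ell2_inner_def
        by (rule suminf_finite) (auto simp: e_def jacobi_op_def)
      moreover have "(\<Sum>n<Suc (Suc k). jacobi_op b e n * cnj (y n)) =
          (\<Sum>n<Suc (Suc k). e n * cnj (jacobi_op b y n))"
        using jacobi_green[of b e y "Suc k"] by (simp add: sum_subtractf e_def)
      moreover have "(\<Sum>n<Suc (Suc k). e n * cnj (jacobi_op b y n)) = cnj (jacobi_op b y k)"
        by (simp add: e_def)
      ultimately show ?thesis by (metis complex_cnj_cancel_iff)
    qed
    then have "jacobi_op b y = z" by blast
    then show ?R using y z by (simp add: jacobi_domain_def)
  qed
qed

corollary jacobi_self_adjoint_powr: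
  assumes "\<alpha> \<le> 1" and "b 0 > 0"
    and odd_weights: "\<And>k. k \<ge> 1 \<Longrightarrow> b (2 * k - 1) = real k powr \<alpha>"
    and even_weights: "\<And>k. k \<ge> 1 \<Longrightarrow> b (2 * k) = real k powr \<alpha>"
  shows "self_adjoint_on (jacobi_domain b) (jacobi_op b)"
proof (rule jacobi_self_adjoint)
  show pos: "b n > 0" for n
  proof (cases "n = 0")
    case False
    show ?thesis
    proof (cases "even n")
      case True
      then obtain k where "n = 2 * k" by (elim evenE)
      with False show ?thesis using even_weights[of k] by simp
    next
      case False
      then obtain k where "n = 2 * k + 1" by (elim oddE)
      then show ?thesis using odd_weights[of "Suc k"] by simp
    qed
  qed (use \<open>b 0 > 0\<close> in simp)
  show "\<not> summable (\<lambda>n. 1 / b n)"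
  proof
    assume "summable (\<lambda>n. 1 / b n)"
    then have "summable ((\<lambda>n. 1 / b n) \<circ> (\<lambda>k. 2 * k))"
      using pos by (intro summable_reindex) (auto simp: inj_def less_imp_le)
    then have "summable (\<lambda>k. real k powr (- \<alpha>))"
      by (rule summable_comparison_test'[where N = 1])
        (simp add: even_weights powr_minus_divide)
    with \<open>\<alpha> \<le> 1\<close> show False by (simp add: summable_real_powr_iff)
  qed
qed

end

theory Submission
  imports Defs "HOL-Complex_Analysis.Cauchy_Integral_Formula"
begin

text \<open>
  Let \<open>p\<^sub>n\<close> be the orthonormal polynomials of the Jacobi matrix, and put
  \<open>U k = (-1)^k * k powr \<alpha> * p\<^sub>2\<^sub>k\<close> and \<open>v k = (-1)^k * p\<^sub>2\<^sub>k\<^sub>-\<^sub>1\<close>.  Since the weights come in equal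
  pairs, two steps of the three-term recurrence are one step of
  \<open>v (k+1) = v k - x * k powr (-2 * \<alpha>) * U k\<close>, \<open>U (k+1) = U k + x * v (k+1)\<close>.
  This is a rotation through an angle of about \<open>x * k powr (-\<alpha>)\<close>, whose speed changes slowly.  Its
  amplitude \<open>A k x = k powr \<alpha> * (p\<^sub>2\<^sub>k\<^sub>-\<^sub>1\<^sup>2 + p\<^sub>2\<^sub>k\<^sup>2)\<close> is therefore an adiabatic invariant: a corrected
  energy \<open>W k x\<close>, asymptotically equal to \<open>A k x\<close>, changes in each step by a summable relative
  amount (\<open>energy_step\<close>).  So \<open>ln (A k x)\<close> converges locally uniformly in \<open>x \<noteq> 0\<close>
  (\<open>uniformly_convergent_ln_amplitude\<close>), and \<open>A k x\<close> has a positive continuous limit \<open>A x\<close>.  The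
  spectral density turns out to be \<open>1 / (\<pi> * A x)\<close>.

  To see this, cut the matrix off at site \<open>N\<close> by the outgoing boundary condition
  \<open>w\<^sub>N\<^sub>+\<^sub>1 = - \<i> * w\<^sub>N\<close>.  The Weyl function of the truncated problem is holomorphic up to the real line,
  where its imaginary part is exactly \<open>1 / (b\<^sub>N * (p\<^sub>N\<^sup>2 + p\<^sub>N\<^sub>+\<^sub>1\<^sup>2))\<close> (\<open>Im_outgoing_real\<close>).  By the
  Poisson formula its imaginary part in the upper half-plane is the Poisson integral of that
  function (\<open>poisson_amplitude\<close>).  On the other hand \<open>\<Sum> 1 / b\<^sub>n = \<infinity>\<close> forces the Weyl discs to shrink
  to points, so that the truncated Weyl functions converge to the Stieltjes transform of every
  measure for which the \<open>p\<^sub>n\<close> are orthonormal (\<open>outgoing_tendsto_stieltjes\<close>).  The measure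
  \<open>\<sigma> = \<langle>E(\<cdot>) e\<^sub>0, e\<^sub>0\<rangle>\<close> is such a measure, because \<open>Re \<langle>E(B) e\<^sub>i, e\<^sub>j\<rangle>\<close> is the integral of \<open>p\<^sub>i p\<^sub>j\<close> over
  \<open>B\<close> with respect to \<open>\<sigma>\<close> (\<open>rip_E_unit_seq\<close>, \<open>orthonormal\<close>).

  Hence the Poisson integrals of \<open>1 / (\<pi> * A k x)\<close> converge to those of \<open>\<sigma>\<close>.  Together with the
  locally uniform convergence of these functions away from \<open>0\<close>, this identifies \<open>\<sigma>\<close> on every
  compact interval that avoids \<open>0\<close> (\<open>stieltjes_inversion_interval\<close>, \<open>density_on_interval\<close>), and the
  uniqueness of the Lebesgue decomposition transfers the result to \<open>f\<close>
  (\<open>ac_density_eq_on_interval\<close>).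
\<close>

section \<open>Solutions of the three-term recurrence\<close>

text \<open>
  The coefficients are real but the field is arbitrary, so that one definition serves the real
  line and the upper half-plane.
\<close>

fun jacobi_solution :: "(nat \<Rightarrow> real) \<Rightarrow> 'a \<Rightarrow> 'a \<Rightarrow> 'a \<Rightarrow> nat \<Rightarrow> 'a::real_normed_field" where
  "jacobi_solution b z u v 0 = u"
| "jacobi_solution b z u v (Suc 0) = v"
| "jacobi_solution b z u v (Suc (Suc n)) =
     (z * jacobi_solution b z u v (Suc n) - of_real (b n) * jacobi_solution b z u v n) /
     of_real (b (Suc n))"

definition orthopoly :: "(nat \<Rightarrow> real) \<Rightarrow> 'a \<Rightarrow> nat \<Rightarrow> 'a::real_normed_field" where
  "orthopoly b z = jacobi_solution b z 1 (z / of_real (b 0))"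

text \<open>
  The polynomials of the second kind, normalized so that \<open>secondpoly b z n + m * orthopoly b z n\<close>
  solves the recurrence with an inhomogeneity \<open>1\<close> at site \<open>0\<close>.
\<close>

definition secondpoly :: "(nat \<Rightarrow> real) \<Rightarrow> 'a \<Rightarrow> nat \<Rightarrow> 'a::real_normed_field" where
  "secondpoly b z = jacobi_solution b z 0 (1 / of_real (b 0))"

lemma orthopoly_0 [simp]: "orthopoly b z 0 = 1"
  and orthopoly_1 [simp]: "orthopoly b z (Suc 0) = z / of_real (b 0)"
  and secondpoly_0 [simp]: "secondpoly b z 0 = 0"
  and secondpoly_1 [simp]: "secondpoly b z (Suc 0) = 1 / of_real (b 0)"
  by (simp_all add: orthopoly_def secondpoly_def)

lemma orthopoly_rec:
  fixes z :: "'a::real_normed_field"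
  assumes "b (Suc n) \<noteq> 0"
  shows "of_real (b (Suc n)) * orthopoly b z (Suc (Suc n)) =
    z * orthopoly b z (Suc n) - of_real (b n) * orthopoly b z n"
  using assms by (simp add: orthopoly_def)

lemma secondpoly_rec:
  fixes z :: "'a::real_normed_field"
  assumes "b (Suc n) \<noteq> 0"
  shows "of_real (b (Suc n)) * secondpoly b z (Suc (Suc n)) =
    z * secondpoly b z (Suc n) - of_real (b n) * secondpoly b z n"
  using assms by (simp add: secondpoly_def)

lemma jacobi_solution_of_real:
  "jacobi_solution b (of_real x) (of_real u) (of_real v) n =
    (of_real (jacobi_solution b x u v n) :: 'a::real_normed_field)"
  by (induction b x u v n rule: jacobi_solution.induct) simp_all

lemma orthopoly_of_real:
  "orthopoly b (of_real x :: 'a::real_normed_field) n = of_real (orthopoly b x n)"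
  using jacobi_solution_of_real[of b x 1 "x / b 0" n] by (simp add: orthopoly_def)

lemma continuous_on_jacobi_solution [continuous_intros]:
  fixes u v :: "'a::real_normed_field \<Rightarrow> 'a"
  assumes "\<And>n. b n \<noteq> 0" "continuous_on S u" "continuous_on S v"
  shows "continuous_on S (\<lambda>z. jacobi_solution b z (u z) (v z) n)"
proof (induction n rule: induct_nat_012)
  case (ge2 n)
  then show ?case
    using assms by (auto intro!: continuous_intros)
qed (use assms in simp_all)

lemma continuous_on_orthopoly [continuous_intros]:
  assumes "\<And>n. b n \<noteq> 0"
  shows "continuous_on S (\<lambda>z::'a::real_normed_field. orthopoly b z n)"
  unfolding orthopoly_def using assms by (intro continuous_intros) auto

lemma wronskian:
  fixes z :: "'a::real_normed_field"
  assumes b: "\<And>n. b n \<noteq> 0"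
  shows "of_real (b n) * (orthopoly b z n * secondpoly b z (Suc n) -
    orthopoly b z (Suc n) * secondpoly b z n) = 1"
proof (induction n)
  case 0
  show ?case using b[of 0] by simp
next
  case (Suc n)
  let ?p = "orthopoly b z" and ?q = "secondpoly b z"
  have P: "of_real (b (Suc n)) * ?p (Suc (Suc n)) = z * ?p (Suc n) - of_real (b n) * ?p n"
    and Q: "of_real (b (Suc n)) * ?q (Suc (Suc n)) = z * ?q (Suc n) - of_real (b n) * ?q n"
    by (rule orthopoly_rec secondpoly_rec, rule b)+
  have "of_real (b (Suc n)) * (?p (Suc n) * ?q (Suc (Suc n)) - ?p (Suc (Suc n)) * ?q (Suc n)) =
     ?p (Suc n) * (of_real (b (Suc n)) * ?q (Suc (Suc n))) -
     (of_real (b (Suc n)) * ?p (Suc (Suc n))) * ?q (Suc n)"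
    by (simp only: algebra_simps)
  also have "\<dots> = of_real (b n) * (?p n * ?q (Suc n) - ?p (Suc n) * ?q n)"
    unfolding P Q by (simp add: algebra_simps)
  finally show ?case using Suc.IH by simp
qed

lemma orthopoly_not_both_zero:
  assumes b: "\<And>n. b n \<noteq> 0"
  shows "orthopoly b z n \<noteq> 0 \<or> orthopoly b z (Suc n) \<noteq> 0"
  using wronskian[of b n z] b by auto


text \<open>
  All that is used about the spectral measure when its Stieltjes transform is studied.
\<close>

definition orthonormal_for :: "(nat \<Rightarrow> real) \<Rightarrow> real measure \<Rightarrow> bool" where
  "orthonormal_for b \<mu> \<longleftrightarrow> (\<forall>i j. integrable \<mu> (\<lambda>t. orthopoly b t i * orthopoly b t j) \<and>
     (LINT t|\<mu>. orthopoly b t i * orthopoly b t j) = (if i = j then 1 else 0))"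

section \<open>Adiabatic invariance of the amplitude\<close>

lemma abs_ln_one_plus_le:
  fixes u :: real
  assumes "\<bar>u\<bar> \<le> 1 / 2"
  shows "\<bar>ln (1 + u)\<bar> \<le> 2 * \<bar>u\<bar>"
proof -
  have "\<bar>ln (1 + u) - u\<bar> \<le> 2 * u\<^sup>2"
    using abs_ln_one_plus_x_minus_x_bound[OF assms] .
  moreover have "2 * u\<^sup>2 \<le> \<bar>u\<bar>"
  proof -
    have "u\<^sup>2 = \<bar>u\<bar> * \<bar>u\<bar>" by (simp add: power2_eq_square)
    also have "\<dots> \<le> (1 / 2) * \<bar>u\<bar>" using assms by (intro mult_right_mono) auto
    finally show ?thesis by simp
  qed
  ultimately show ?thesis by linarith
qed

lemma abs_ln_diff_le:
  fixes a c e :: real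
  assumes "a > 0" "\<bar>c - a\<bar> \<le> e * a" "e \<le> 1 / 2"
  shows "c > 0" "\<bar>ln c - ln a\<bar> \<le> 2 * e"
proof -
  have "\<bar>c - a\<bar> \<le> a / 2" using assms mult_right_mono[of e "1/2" a] by linarith
  with \<open>a > 0\<close> show c: "c > 0" by linarith
  have "\<bar>(c - a) / a\<bar> \<le> e" using assms by (simp add: field_simps)
  then have "\<bar>ln (1 + (c - a) / a)\<bar> \<le> 2 * e"
    using abs_ln_one_plus_le[of "(c - a) / a"] assms(3) by linarith
  moreover have "1 + (c - a) / a = c / a" using \<open>a > 0\<close> by (simp add: field_simps)
  ultimately show "\<bar>ln c - ln a\<bar> \<le> 2 * e" using c \<open>a > 0\<close> by (simp add: ln_div)
qed

text \<open>
  The principle behind adiabatic invariance: \<open>W\<close> need only be comparable with \<open>A\<close>, but its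
  relative variation is summable, so that the increments of \<open>ln W\<close> obey the Weierstrass M-test;
  the logarithms of \<open>A\<close> and \<open>W\<close> have a difference that tends to \<open>0\<close>.
\<close>

lemma uniformly_convergent_ln_of_small_variation:
  fixes A W :: "nat \<Rightarrow> 'a \<Rightarrow> real" and \<eta> \<epsilon> :: "nat \<Rightarrow> real"
  assumes A: "\<And>k x. k \<ge> k0 \<Longrightarrow> x \<in> K \<Longrightarrow> A k x > 0"
    and \<eta>: "\<eta> \<longlonglongrightarrow> 0" and \<epsilon>: "summable \<epsilon>"
    and W: "\<And>k x. k \<ge> k0 \<Longrightarrow> x \<in> K \<Longrightarrow> \<bar>W k x - A k x\<bar> \<le> \<eta> k * A k x"
    and step: "\<And>k x. k \<ge> k0 \<Longrightarrow> x \<in> K \<Longrightarrow> \<bar>W (Suc k) x - W k x\<bar> \<le> \<epsilon> k * A k x"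
  shows "uniformly_convergent_on K (\<lambda>k x. ln (A k x))"
proof -
  have "\<epsilon> \<longlonglongrightarrow> 0" using \<epsilon> by (rule summable_LIMSEQ_zero)
  then have "\<forall>\<^sub>F k in sequentially. \<eta> k < 1 / 2 \<and> \<epsilon> k < 1 / 4 \<and> k \<ge> k0"
    using \<eta> by (intro eventually_conj order_tendstoD eventually_ge_at_top) auto
  then obtain k1 where k1: "\<And>k. k \<ge> k1 \<Longrightarrow> \<eta> k < 1 / 2 \<and> \<epsilon> k < 1 / 4 \<and> k \<ge> k0"
    by (auto simp: eventually_sequentially)
  have Wpos: "W k x > 0" and lnWA: "\<bar>ln (W k x) - ln (A k x)\<bar> \<le> 2 * \<eta> k" 
    and AW: "A k x \<le> 2 * W k x" if "k \<ge> k1" "x \<in> K" for k x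
  proof -
    have k: "\<eta> k \<le> 1 / 2" "k \<ge> k0" using k1[OF that(1)] by auto
    note * = abs_ln_diff_le[OF A[OF k(2) that(2)] W[OF k(2) that(2)] k(1)]
    show "W k x > 0" "\<bar>ln (W k x) - ln (A k x)\<bar> \<le> 2 * \<eta> k" by (rule *)+
    have "\<eta> k * A k x \<le> 1 / 2 * A k x" using k A[OF k(2) that(2)] by (intro mult_right_mono) auto
    then show "A k x \<le> 2 * W k x" using W[OF k(2) that(2)] by linarith
  qed
  have eps: "\<bar>ln (W (Suc k) x) - ln (W k x)\<bar> \<le> 4 * \<epsilon> k" if "k \<ge> k1" "x \<in> K" for k x
  proof -
    have k: "\<epsilon> k \<le> 1 / 4" "k \<ge> k0" using k1[OF that(1)] by auto
    have "0 \<le> \<epsilon> k * A k x" using step[OF k(2) that(2)] by linarith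
    then have "\<epsilon> k \<ge> 0" using A[OF k(2) that(2)] by (simp add: zero_le_mult_iff)
    then have "\<epsilon> k * A k x \<le> \<epsilon> k * (2 * W k x)" using AW[OF that] by (intro mult_left_mono) auto
    then have "\<bar>W (Suc k) x - W k x\<bar> \<le> (2 * \<epsilon> k) * W k x" using step[OF k(2) that(2)] by linarith
    from abs_ln_diff_le(2)[OF Wpos[OF that] this] k show ?thesis by simp
  qed
  define f where "f i x = ln (W (Suc (i + k1)) x) - ln (W (i + k1) x)" for i x
  have "uniformly_convergent_on K (\<lambda>n x. \<Sum>i<n. f i x)"
  proof (rule Weierstrass_m_test')
    show "norm (f n x) \<le> 4 * \<epsilon> (n + k1)" if "x \<in> K" for n x
      unfolding f_def using eps[of "n + k1" x] that by simp
    show "summable (\<lambda>n. 4 * \<epsilon> (n + k1))"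
      using \<epsilon> by (intro summable_mult) (simp add: summable_iff_shift)
  qed
  moreover have "(\<Sum>i<n. f i x) = ln (W (n + k1) x) - ln (W k1 x)" for n x
    unfolding f_def using sum_lessThan_telescope[of "\<lambda>i. ln (W (i + k1) x)" n] by simp
  ultimately obtain l where l: "uniform_limit K (\<lambda>n x. ln (W (n + k1) x) - ln (W k1 x)) l sequentially"
    by (auto simp: uniformly_convergent_on_def)
  have l2: "uniform_limit K (\<lambda>n x. ln (A (n + k1) x) - ln (W (n + k1) x)) (\<lambda>_. 0) sequentially"
  proof (rule uniform_limitI)
    fix e :: real assume "e > 0"
    have "(\<lambda>n. 2 * \<eta> (n + k1)) \<longlonglongrightarrow> 2 * 0"
      by (intro tendsto_intros LIMSEQ_ignore_initial_segment \<eta>)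
    then have "\<forall>\<^sub>F n in sequentially. 2 * \<eta> (n + k1) < e"
      using \<open>e > 0\<close> by (intro order_tendstoD) auto
    then show "\<forall>\<^sub>F n in sequentially. \<forall>x\<in>K. dist (ln (A (n + k1) x) - ln (W (n + k1) x)) 0 < e"
    proof eventually_elim
      case (elim n)
      then show ?case using lnWA[of "n + k1"] by (force simp: dist_real_def abs_minus_commute)
    qed
  qed
  have l3: "uniform_limit K (\<lambda>n x. ln (W k1 x)) (\<lambda>x. ln (W k1 x)) sequentially"
    by (rule uniform_limit_const)
  have "uniform_limit K (\<lambda>n x. ln (A (n + k1) x)) (\<lambda>x. l x + 0 + ln (W k1 x)) sequentially"
    using uniform_limit_add[OF uniform_limit_add[OF l l2] l3] by simp
  then have "uniform_limit K (\<lambda>n x. ln (A n x)) (\<lambda>x. l x + 0 + ln (W k1 x)) sequentially"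
    using eventually_sequentially_seg[of "\<lambda>n. \<forall>x\<in>K. dist (ln (A n x)) (l x + 0 + ln (W k1 x)) < e" k1 for e]
    unfolding uniform_limit_iff by simp
  then show ?thesis unfolding uniformly_convergent_on_def by blast
qed

text \<open>
  The invariant quadratic form of the recurrence with constant weight \<open>\<beta>\<close>, in the normalization in
  which it approximates the amplitude.
\<close>

abbreviation energy :: "real \<Rightarrow> real \<Rightarrow> real \<Rightarrow> real \<Rightarrow> real" where
  "energy x \<beta> U v \<equiv> \<beta> * (v\<^sup>2 + U\<^sup>2 / \<beta>\<^sup>2 - x * U * v / \<beta>\<^sup>2)"

text \<open>
  One step of the recurrence, with \<open>\<beta>\<close>, \<open>\<beta>'\<close> the old and new weight, \<open>\<delta> = \<beta>' - \<beta>\<close> the old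
  increment and \<open>\<delta>'\<close> the new one. For a constant weight the energy is conserved exactly. A slow
  change of the weight leaves the oscillating term \<open>\<delta> * (v\<^sup>2 - U\<^sup>2 / \<beta>\<^sup>2)\<close>, which is of order \<open>1 /
  k\<close> relative to the amplitude and not absolutely summable. But \<open>x * (v\<^sup>2 - U\<^sup>2 / \<beta>\<^sup>2)\<close> is to
  leading order the increment of \<open>U * v\<close>, so the term is removed, as in a summation by parts, by
  subtracting \<open>\<delta> / x * U * v\<close> from the energy. What remains is of the order \<open>\<delta> / \<beta>\<^sup>2 + \<bar>\<delta>' - \<delta>\<bar>\<close>.
\<close>

lemma energy_step:
  fixes x U v \<beta> \<beta>' \<delta>' R r D :: real
  assumes "\<beta> \<ge> 1" "\<beta>' \<ge> \<beta>" "\<beta>' - \<beta> \<le> D" "r > 0" "r \<le> \<bar>x\<bar>" "\<bar>x\<bar> \<le> R"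
  defines "v' \<equiv> v - x * U / \<beta>\<^sup>2"
  defines "U' \<equiv> U + x * v'"
  shows "\<bar>(energy x \<beta>' U' v' - \<delta>' / x * (U' * v')) -
          (energy x \<beta> U v - (\<beta>' - \<beta>) / x * (U * v))\<bar>
     \<le> ((D + 2 * R + 3 * R\<^sup>2) * ((\<beta>' - \<beta>) / \<beta>\<^sup>2) + (1 + 3 * R + 2 * R^3) / r * \<bar>\<delta>' - (\<beta>' - \<beta>)\<bar>)
        * (\<beta> * v\<^sup>2 + U\<^sup>2 / \<beta>)"
proof -
  define A where "A = \<beta> * v\<^sup>2 + U\<^sup>2 / \<beta>"
  define \<delta> where "\<delta> = \<beta>' - \<beta>"
  have \<beta>': "\<beta>' = \<beta> + \<delta>" by (simp add: \<delta>_def)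
  have pos: "\<beta> > 0" "\<beta>' > 0" "\<delta> \<ge> 0" "x \<noteq> 0" "R \<ge> 0" "D \<ge> 0" using assms(1-6) by (auto simp: \<delta>_def)
  have ineq: "\<beta> \<ge> 1" "\<beta>' \<ge> \<beta>" "\<delta> \<le> D" "r > 0" "r \<le> \<bar>x\<bar>" "\<bar>x\<bar> \<le> R"
    using assms(1-6) by (auto simp: \<delta>_def)
  define P where "P = x * U * v / \<beta>\<^sup>2 + \<delta> * U\<^sup>2 / (\<beta>\<^sup>2 * \<beta>') - (\<beta> + \<beta>') / (\<beta>\<^sup>2 * \<beta>') * (x * (U * v')) - x\<^sup>2 * U\<^sup>2 / \<beta>^4"
  \<comment> \<open>The exact remainder; \<open>P\<close> collects the terms that carry a factor \<open>1 / \<beta>\<^sup>2\<close>.\<close>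
  have id: "(energy x \<beta>' U' v' - \<delta>' / x * (U' * v')) -
          (energy x \<beta> U v - (\<beta>' - \<beta>) / x * (U * v)) =
     \<delta> * P - (\<delta>' - \<delta>) / x * (U' * v')"
  proof -
    have v: "v = v' + x * U / \<beta>\<^sup>2" by (simp add: v'_def)
    have bp: "energy x \<beta>' U' v' = \<beta>' * v'\<^sup>2 + U * U' / \<beta>'"
      using pos unfolding U'_def by (simp add: field_simps power2_eq_square)
    have b: "energy x \<beta> U v = \<beta> * v'\<^sup>2 + U * U' / \<beta>"
      using pos unfolding U'_def v by (simp add: field_simps power2_eq_square)
    have Z: "U' * v' = U * v + x * v'\<^sup>2 - x * U\<^sup>2 / \<beta>\<^sup>2"
      unfolding U'_def v by (simp add: algebra_simps power2_eq_square)
    have L: "(energy x \<beta>' U' v' - \<delta>' / x * (U' * v')) -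
          (energy x \<beta> U v - (\<beta>' - \<beta>) / x * (U * v))
       = \<delta> * v'\<^sup>2 + U * U' / \<beta>' - U * U' / \<beta> - (\<delta>' - \<delta>) / x * (U' * v') - \<delta> / x * (U' * v' - U * v)"
      unfolding bp b \<delta>_def using pos by (simp add: field_simps)
    have P: "P = U\<^sup>2 / \<beta>\<^sup>2 - (U\<^sup>2 + x * (U * v')) / (\<beta> * \<beta>')"
    proof -
      have "x * U * v / \<beta>\<^sup>2 = x * (U * v') / \<beta>\<^sup>2 + x\<^sup>2 * U\<^sup>2 / \<beta>^4"
        unfolding v using pos by (simp add: field_simps power2_eq_square power4_eq_xxxx)
      then have "P = x * (U * v') / \<beta>\<^sup>2 + \<delta> * U\<^sup>2 / (\<beta>\<^sup>2 * \<beta>') - (\<beta> + \<beta>') / (\<beta>\<^sup>2 * \<beta>') * (x * (U * v'))"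
        by (simp add: P_def)
      also have "\<dots> = U\<^sup>2 / \<beta>\<^sup>2 - (U\<^sup>2 + x * (U * v')) / (\<beta> * \<beta>')"
        unfolding \<delta>_def using pos by (simp add: field_simps power2_eq_square)
      finally show ?thesis .
    qed
    have "\<delta> / x * (U' * v' - U * v) = \<delta> * v'\<^sup>2 - \<delta> * U\<^sup>2 / \<beta>\<^sup>2"
      unfolding Z using pos by (simp add: field_simps power2_eq_square)
    moreover have "U * U' / \<beta>' - U * U' / \<beta> = - \<delta> * (U\<^sup>2 + x * (U * v')) / (\<beta> * \<beta>')"
      unfolding \<beta>' U'_def using pos \<beta>' by (simp add: field_simps power2_eq_square)
    moreover from P have "\<delta> * P = \<delta> * U\<^sup>2 / \<beta>\<^sup>2 + - \<delta> * (U\<^sup>2 + x * (U * v')) / (\<beta> * \<beta>')"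
      by (simp add: right_diff_distrib)
    ultimately show ?thesis unfolding L by linarith
  qed
  have A0: "A \<ge> 0" using pos by (simp add: A_def)
  have Usq: "U\<^sup>2 \<le> \<beta> * A" and vsq: "v\<^sup>2 \<le> A"
  proof -
    have "\<beta> * A = (\<beta> * v)\<^sup>2 + U\<^sup>2" using pos by (simp add: A_def field_simps power2_eq_square)
    then show "U\<^sup>2 \<le> \<beta> * A" by simp
    have "1 * v\<^sup>2 \<le> \<beta> * v\<^sup>2" using ineq by (intro mult_right_mono) auto
    moreover have "0 \<le> U\<^sup>2 / \<beta>" using pos by simp
    ultimately show "v\<^sup>2 \<le> A" unfolding A_def by linarith
  qed
  have Uv: "\<bar>U * v\<bar> \<le> A / 2"
  proof -
    have "2 * \<bar>\<beta> * v\<bar> * \<bar>U\<bar> \<le> \<bar>\<beta> * v\<bar>\<^sup>2 + \<bar>U\<bar>\<^sup>2" by (rule sum_squares_bound)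
    also have "\<dots> = \<beta> * A" using pos by (simp add: A_def field_simps power2_eq_square)
    finally have "\<beta> * (2 * \<bar>U * v\<bar>) \<le> \<beta> * A" using pos by (simp add: abs_mult mult_ac)
    then show ?thesis using pos by simp
  qed
  have xsq: "x\<^sup>2 \<le> R\<^sup>2" using ineq abs_le_square_iff by force
  have Ub: "U\<^sup>2 / \<beta>\<^sup>2 \<le> A" "U\<^sup>2 / \<beta>^4 \<le> A / \<beta>\<^sup>2" 
  proof -
    have "U\<^sup>2 \<le> \<beta>\<^sup>2 * A" using Usq A0 ineq mult_right_mono[of \<beta> "\<beta>\<^sup>2" A] self_le_power[of \<beta> 2] by linarith
    then show 1: "U\<^sup>2 / \<beta>\<^sup>2 \<le> A" using pos by (simp add: field_simps)
    have "U\<^sup>2 / \<beta>^4 = U\<^sup>2 / \<beta>\<^sup>2 / \<beta>\<^sup>2" by simp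
    also have "\<dots> \<le> A / \<beta>\<^sup>2" using 1 pos by (intro divide_right_mono) auto
    finally show "U\<^sup>2 / \<beta>^4 \<le> A / \<beta>\<^sup>2" .
  qed
  have Uv': "\<bar>U * v'\<bar> \<le> A * (1 / 2 + R)"
  proof -
    have "U * v' = U * v - x * (U\<^sup>2 / \<beta>\<^sup>2)" by (simp add: v'_def algebra_simps power2_eq_square)
    moreover have "\<bar>x * (U\<^sup>2 / \<beta>\<^sup>2)\<bar> \<le> R * A"
      unfolding abs_mult using Ub ineq by (intro mult_mono) auto
    ultimately have "\<bar>U * v'\<bar> \<le> A / 2 + R * A" using Uv by linarith
    then show ?thesis by (simp add: algebra_simps)
  qed
  have v'sq: "v'\<^sup>2 \<le> A * (2 + 2 * R\<^sup>2)"
  proof -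
    have "v'\<^sup>2 \<le> 2 * v\<^sup>2 + 2 * (x * U / \<beta>\<^sup>2)\<^sup>2"
      unfolding v'_def using zero_le_power2[of "v + x * U / \<beta>\<^sup>2"] by (simp add: power2_sum power2_diff)
    also have "(x * U / \<beta>\<^sup>2)\<^sup>2 = x\<^sup>2 * (U\<^sup>2 / \<beta>^4)" by (simp add: power_mult_distrib power_divide)
    also have "\<dots> \<le> R\<^sup>2 * A"
    proof (intro mult_mono xsq)
      have "A / \<beta>\<^sup>2 \<le> A / 1" using A0 ineq by (intro divide_left_mono) auto
      then show "U\<^sup>2 / \<beta>^4 \<le> A" using Ub by simp
    qed auto
    finally show ?thesis using vsq by (simp add: algebra_simps)
  qed
  have U'v': "\<bar>U' * v'\<bar> \<le> A * (1 + 3 * R + 2 * R^3)"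
  proof -
    have "U' * v' = U * v' + x * v'\<^sup>2" by (simp add: U'_def algebra_simps power2_eq_square)
    moreover have "\<bar>x * v'\<^sup>2\<bar> \<le> R * (A * (2 + 2 * R\<^sup>2))"
      unfolding abs_mult using v'sq ineq by (intro mult_mono) auto
    moreover have "A * (1 / 2 + R) + R * (A * (2 + 2 * R\<^sup>2)) \<le> A * (1 + 3 * R + 2 * R^3)"
      using A0 by (simp add: algebra_simps power2_eq_square power3_eq_cube)
    ultimately show ?thesis using Uv' by linarith
  qed
  have Pb: "\<bar>P\<bar> \<le> (D + 2 * R + 3 * R\<^sup>2) * (A / \<beta>\<^sup>2)"
  proof -
    have 1: "\<bar>x * U * v / \<beta>\<^sup>2\<bar> \<le> R / 2 * (A / \<beta>\<^sup>2)"
    proof -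
      have "\<bar>x * (U * v)\<bar> \<le> R * (A / 2)" unfolding abs_mult[of x] using Uv ineq by (intro mult_mono) auto
      then show ?thesis using pos by (simp add: abs_mult field_simps)
    qed
    have 2: "\<bar>\<delta> * U\<^sup>2 / (\<beta>\<^sup>2 * \<beta>')\<bar> \<le> D * (A / \<beta>\<^sup>2)"
    proof -
      have "U\<^sup>2 \<le> \<beta>' * A" using Usq ineq A0 mult_right_mono[of \<beta> \<beta>' A] by linarith
      then have "\<delta> * U\<^sup>2 \<le> D * (\<beta>' * A)" using ineq pos A0 by (intro mult_mono) auto
      then show ?thesis using pos by (simp add: field_simps)
    qed
    have 3: "\<bar>(\<beta> + \<beta>') / (\<beta>\<^sup>2 * \<beta>') * (x * (U * v'))\<bar> \<le> (R + 2 * R\<^sup>2) * (A / \<beta>\<^sup>2)"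
    proof -
      have "\<bar>x * (U * v')\<bar> \<le> R * (A * (1 / 2 + R))"
        unfolding abs_mult[of x] using Uv' ineq by (intro mult_mono) auto
      moreover have "(\<beta> + \<beta>') / (\<beta>\<^sup>2 * \<beta>') \<le> 2 / \<beta>\<^sup>2"
        using ineq pos by (simp add: field_simps)
      ultimately have "\<bar>(\<beta> + \<beta>') / (\<beta>\<^sup>2 * \<beta>')\<bar> * \<bar>x * (U * v')\<bar> \<le> 2 / \<beta>\<^sup>2 * (R * (A * (1 / 2 + R)))"
        using pos A0 by (intro mult_mono) auto
      also have "\<dots> = (R + 2 * R\<^sup>2) * (A / \<beta>\<^sup>2)" using pos by (simp add: field_simps power2_eq_square)
      finally show ?thesis by (simp add: abs_mult)
    qed
    have 4: "\<bar>x\<^sup>2 * U\<^sup>2 / \<beta>^4\<bar> \<le> R\<^sup>2 * (A / \<beta>\<^sup>2)"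
    proof -
      have "x\<^sup>2 * (U\<^sup>2 / \<beta>^4) \<le> R\<^sup>2 * (A / \<beta>\<^sup>2)" using xsq Ub pos by (intro mult_mono) auto
      then show ?thesis using pos by simp
    qed
    have "\<bar>P\<bar> \<le> R / 2 * (A / \<beta>\<^sup>2) + D * (A / \<beta>\<^sup>2) + (R + 2 * R\<^sup>2) * (A / \<beta>\<^sup>2) + R\<^sup>2 * (A / \<beta>\<^sup>2)"
      unfolding P_def using 1 2 3 4 by linarith
    also have "\<dots> = (D + 3 / 2 * R + 3 * R\<^sup>2) * (A / \<beta>\<^sup>2)" by (simp add: algebra_simps)
    also have "\<dots> \<le> (D + 2 * R + 3 * R\<^sup>2) * (A / \<beta>\<^sup>2)"
      using pos A0 by (intro mult_right_mono) auto
    finally show ?thesis .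
  qed
  have d1: "\<bar>\<delta> * P\<bar> \<le> \<delta> * ((D + 2 * R + 3 * R\<^sup>2) * (A / \<beta>\<^sup>2))"
    using mult_left_mono[OF Pb \<open>\<delta> \<ge> 0\<close>] \<open>\<delta> \<ge> 0\<close> by (simp only: abs_mult abs_of_nonneg)
  have d2: "\<bar>(\<delta>' - \<delta>) / x * (U' * v')\<bar> \<le> \<bar>\<delta>' - \<delta>\<bar> / r * (A * (1 + 3 * R + 2 * R^3))"
  proof -
    have "\<bar>(\<delta>' - \<delta>) / x\<bar> \<le> \<bar>\<delta>' - \<delta>\<bar> / r"
      unfolding abs_divide using ineq(4,5) by (intro divide_left_mono) auto
    then show ?thesis
      unfolding abs_mult[of "(\<delta>' - \<delta>) / x"] by (rule mult_mono[OF _ U'v']) (use ineq(4) in auto)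
  qed
  have eq: "\<delta> * ((D + 2 * R + 3 * R\<^sup>2) * (A / \<beta>\<^sup>2)) + \<bar>\<delta>' - \<delta>\<bar> / r * (A * (1 + 3 * R + 2 * R^3)) =
     ((D + 2 * R + 3 * R\<^sup>2) * (\<delta> / \<beta>\<^sup>2) + (1 + 3 * R + 2 * R^3) / r * \<bar>\<delta>' - \<delta>\<bar>) * A"
    by (simp add: algebra_simps add_divide_distrib)
  show ?thesis
    unfolding id A_def[symmetric] unfolding \<delta>_def[symmetric]
    using order_trans[OF abs_triangle_ineq4 add_mono[OF d1 d2], unfolded eq] .
qed


text \<open>
  The product of the weight and the squared length of the vector of two consecutive polynomials;
  its reciprocal, divided by \<open>\<pi>\<close>, approximates the spectral density.
\<close>

definition amplitude :: "(nat \<Rightarrow> real) \<Rightarrow> nat \<Rightarrow> real \<Rightarrow> real" where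
  "amplitude b n x = b n * ((orthopoly b x n)\<^sup>2 + (orthopoly b x (Suc n))\<^sup>2)"

lemma amplitude_pos:
  assumes "\<And>n. b n > 0"
  shows "amplitude b n x > 0"
proof -
  have "b n \<noteq> 0" for n using assms[of n] by simp
  then have "orthopoly b x n \<noteq> 0 \<or> orthopoly b x (Suc n) \<noteq> 0" by (rule orthopoly_not_both_zero)
  then have "(orthopoly b x n)\<^sup>2 + (orthopoly b x (Suc n))\<^sup>2 > 0"
    by (auto simp: sum_power2_gt_zero_iff)
  then show ?thesis using assms by (simp add: amplitude_def)
qed

lemma continuous_on_amplitude [continuous_intros]:
  assumes "\<And>n. b n > 0"
  shows "continuous_on S (amplitude b n)"
proof -
  have "b n \<noteq> 0" for n using assms[of n] by simp
  then show ?thesis unfolding amplitude_def by (intro continuous_intros)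
qed

text \<open>
  Both parts of the error in \<open>energy_step\<close> are summable for concave weights, since they telescope:
  \<open>\<delta> / \<beta>\<^sup>2\<close> is comparable to the decrease of \<open>1 / \<beta>\<close>, and \<open>\<bar>\<delta>' - \<delta>\<bar>\<close> is the decrease of \<open>\<delta>\<close>. The
  estimates are uniform in \<open>x\<close> as long as \<open>x\<close> stays bounded and away from \<open>0\<close>.
\<close>

lemma uniformly_convergent_ln_amplitude:
  fixes b \<beta> :: "nat \<Rightarrow> real"
  assumes b: "\<And>n. b n > 0"
    and odd: "\<And>k. k \<ge> 1 \<Longrightarrow> b (2 * k - 1) = \<beta> k"
    and even: "\<And>k. k \<ge> 1 \<Longrightarrow> b (2 * k) = \<beta> k"
    and ge1: "\<And>k. k \<ge> 1 \<Longrightarrow> \<beta> k \<ge> 1"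
    and mono: "\<And>k. k \<ge> 1 \<Longrightarrow> \<beta> k \<le> \<beta> (Suc k)"
    and concave: "\<And>k. k \<ge> 1 \<Longrightarrow> \<beta> (Suc (Suc k)) - \<beta> (Suc k) \<le> \<beta> (Suc k) - \<beta> k"
    and \<beta>_lim: "filterlim \<beta> at_top sequentially"
    and \<delta>_lim: "(\<lambda>k. \<beta> (Suc k) - \<beta> k) \<longlonglongrightarrow> 0"
    and K: "compact K" "0 \<notin> K"
  shows "uniformly_convergent_on K (\<lambda>k x. ln (amplitude b (2 * k - 1) x))"
proof -
  obtain R where R: "\<And>x. x \<in> K \<Longrightarrow> \<bar>x\<bar> \<le> R" 
    using compact_imp_bounded[OF K(1)] by (auto simp: bounded_iff)
  obtain r where r: "r > 0" "\<And>x. x \<in> K \<Longrightarrow> r \<le> \<bar>x\<bar>"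
  proof -
    have "open (- K)" "0 \<in> - K" using K compact_imp_closed by auto
    then obtain e where e: "e > 0" "ball 0 e \<subseteq> - K" by (auto simp: open_contains_ball)
    have "e \<le> \<bar>x\<bar>" if "x \<in> K" for x
      using e(2) that by (force simp: subset_iff)
    with e(1) show ?thesis using that by blast
  qed
  define \<delta> where "\<delta> k = \<beta> (Suc k) - \<beta> k" for k
  define D where "D = \<delta> 1"
  have \<delta>0: "\<delta> k \<ge> 0" if "k \<ge> 1" for k using mono[OF that] by (simp add: \<delta>_def)
  have \<delta>dec: "\<delta> (Suc k) \<le> \<delta> k" if "k \<ge> 1" for k using concave[OF that] by (simp add: \<delta>_def)
  have \<delta>D: "\<delta> k \<le> D" if "k \<ge> 1" for k
    using that by (induction k rule: dec_induct) (use \<delta>dec in \<open>force simp: D_def\<close>)+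
  have \<delta>_lim': "\<delta> \<longlonglongrightarrow> 0" using \<delta>_lim by (simp add: \<delta>_def[abs_def])
  have inv_lim: "(\<lambda>k. 1 / \<beta> k) \<longlonglongrightarrow> 0"
    using tendsto_divide_0[OF tendsto_const filterlim_at_top_imp_at_infinity[OF \<beta>_lim]] .
  define U where "U k x = (-1)^k * \<beta> k * orthopoly b x (2 * k)" for k and x :: real
  define v where "v k x = (-1)^k * orthopoly b x (2 * k - 1)" for k and x :: real
  define A where "A k x = \<beta> k * (v k x)\<^sup>2 + (U k x)\<^sup>2 / \<beta> k" for k x
  define W where "W k x = energy x (\<beta> k) (U k x) (v k x)
    - \<delta> k / x * (U k x * v k x)" for k x
  have \<beta>pos: "\<beta> k > 0" if "k \<ge> 1" for k using ge1[OF that] by linarith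
  have A_eq: "A k x = amplitude b (2 * k - 1) x" if "k \<ge> 1" for k x
  proof -
    have "Suc (2 * k - 1) = 2 * k" using that by simp
    moreover have "((-1)^k :: real)\<^sup>2 = 1" by (simp add: power_mult[symmetric])
    ultimately show ?thesis
      unfolding A_def amplitude_def U_def v_def power_mult_distrib using odd[OF that] \<beta>pos[OF that]
      by (simp add: field_simps power2_eq_square)
  qed
  \<comment> \<open>The signs and the factor in \<open>U\<close> turn two steps of the recurrence into one step of a slow rotation.\<close>
  have v_rec: "v (Suc k) x = v k x - x * U k x / (\<beta> k)\<^sup>2"
    and U_rec: "U (Suc k) x = U k x + x * v (Suc k) x" if k: "k \<ge> 1" for k x
  proof -
    obtain j where j: "k = Suc j" using k by (cases k) auto
    have b0: "b n \<noteq> 0" for n using b[of n] by simp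
    have w: "b (Suc (2 * j)) = \<beta> k" "b (Suc (Suc (2 * j))) = \<beta> k" "b (Suc (Suc (Suc (2 * j)))) = \<beta> (Suc k)"
      using odd[of k] even[of k] odd[of "Suc k"] by (auto simp: j)
    have 1: "\<beta> k * orthopoly b x (Suc (Suc (Suc (2 * j)))) =
       x * orthopoly b x (Suc (Suc (2 * j))) - \<beta> k * orthopoly b x (Suc (2 * j))"
      using orthopoly_rec[where b = b and n = "Suc (2 * j)" and z = x, OF b0] unfolding w by simp
    have 2: "\<beta> (Suc k) * orthopoly b x (Suc (Suc (Suc (Suc (2 * j))))) =
       x * orthopoly b x (Suc (Suc (Suc (2 * j)))) - \<beta> k * orthopoly b x (Suc (Suc (2 * j)))"
      using orthopoly_rec[where b = b and n = "Suc (Suc (2 * j))" and z = x, OF b0] unfolding w by simp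
    have idx: "2 * k - 1 = Suc (2 * j)" "2 * k = Suc (Suc (2 * j))"
      "2 * Suc k - 1 = Suc (Suc (Suc (2 * j)))" "2 * Suc k = Suc (Suc (Suc (Suc (2 * j))))"
      by (auto simp: j)
    have 3: "orthopoly b x (Suc (Suc (Suc (2 * j)))) =
        x * orthopoly b x (Suc (Suc (2 * j))) / \<beta> k - orthopoly b x (Suc (2 * j))"
      using 1 \<beta>pos[OF k] by (simp add: field_simps)
    have "v (Suc k) x = - ((-1)^k) * orthopoly b x (Suc (Suc (Suc (2 * j))))"
      unfolding v_def idx by simp
    also have "\<dots> = - ((-1)^k) * (x * orthopoly b x (Suc (Suc (2 * j))) / \<beta> k - orthopoly b x (Suc (2 * j)))"
      by (simp only: 3)
    also have "\<dots> = v k x - x * U k x / (\<beta> k)\<^sup>2"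
      unfolding v_def U_def idx using \<beta>pos[OF k] by (simp add: field_simps power2_eq_square)
    finally show "v (Suc k) x = v k x - x * U k x / (\<beta> k)\<^sup>2" .
    have "U (Suc k) x = - ((-1)^k) * (\<beta> (Suc k) * orthopoly b x (Suc (Suc (Suc (Suc (2 * j))))))"
      unfolding U_def idx by simp
    also have "\<dots> = U k x + x * v (Suc k) x"
      unfolding 2 unfolding U_def v_def idx by (simp add: algebra_simps)
    finally show "U (Suc k) x = U k x + x * v (Suc k) x" .
  qed
  define C1 where "C1 = D + 2 * R + 3 * R\<^sup>2"
  define C2 where "C2 = (1 + 3 * R + 2 * R^3) / r"
  define \<epsilon> where "\<epsilon> k = C1 * (\<delta> k / (\<beta> k)\<^sup>2) + C2 * \<bar>\<delta> (Suc k) - \<delta> k\<bar>" for k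
  define \<eta> where "\<eta> k = R / 2 * (1 / \<beta> k) + \<delta> k / (2 * r)" for k
  have "uniformly_convergent_on K (\<lambda>k x. ln (A (k + 1) x))"
  proof (rule uniformly_convergent_ln_of_small_variation[where ?k0.0 = 0])
    fix k :: nat and x assume x: "x \<in> K"
    show "A (k + 1) x > 0" using A_eq amplitude_pos[OF b] by simp
  next
    have "\<eta> \<longlonglongrightarrow> R / 2 * 0 + 0 / (2 * r)"
      unfolding \<eta>_def using r by (intro tendsto_intros inv_lim \<delta>_lim') auto
    then show "(\<lambda>k. \<eta> (k + 1)) \<longlonglongrightarrow> 0" by (intro LIMSEQ_ignore_initial_segment) simp
  next
    have "summable (\<lambda>k. \<delta> k / (\<beta> k)\<^sup>2)"
    proof (rule summable_comparison_test')
      show "summable (\<lambda>k. (1 + D) * (1 / \<beta> k - 1 / \<beta> (Suc k)))"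
        by (intro summable_mult telescope_summable'[OF inv_lim])
      fix k :: nat assume k: "k \<ge> 1"
      have p: "\<beta> k > 0" "\<beta> (Suc k) > 0" using \<beta>pos k by auto
      have "\<beta> (Suc k) \<le> \<beta> k + D" using \<delta>D[OF k] by (simp add: \<delta>_def)
      also have "\<dots> \<le> (1 + D) * \<beta> k"
        using mult_left_mono[OF ge1[OF k], of D] \<delta>0[of 1] by (simp add: D_def algebra_simps)
      finally have "\<delta> k * \<beta> (Suc k) \<le> \<delta> k * ((1 + D) * \<beta> k)" using \<delta>0[OF k] by (rule mult_left_mono)
      then have "\<delta> k / (\<beta> k)\<^sup>2 \<le> (1 + D) * (\<delta> k / (\<beta> k * \<beta> (Suc k)))"
        using p by (simp add: field_simps power2_eq_square)
      also have "\<delta> k / (\<beta> k * \<beta> (Suc k)) = 1 / \<beta> k - 1 / \<beta> (Suc k)"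
        using p by (simp add: \<delta>_def field_simps)
      finally show "norm (\<delta> k / (\<beta> k)\<^sup>2) \<le> (1 + D) * (1 / \<beta> k - 1 / \<beta> (Suc k))"
        using \<delta>0[OF k] by simp
    qed
    moreover have "summable (\<lambda>k. \<bar>\<delta> (Suc k) - \<delta> k\<bar>)"
    proof (rule summable_comparison_test')
      show "summable (\<lambda>k. \<delta> k - \<delta> (Suc k))" by (rule telescope_summable'[OF \<delta>_lim'])
      show "norm \<bar>\<delta> (Suc k) - \<delta> k\<bar> \<le> \<delta> k - \<delta> (Suc k)" if "k \<ge> 1" for k
        using \<delta>dec[OF that] by simp
    qed
    ultimately have "summable \<epsilon>" unfolding \<epsilon>_def by (intro summable_add summable_mult)
    then show "summable (\<lambda>k. \<epsilon> (k + 1))" by (simp only: summable_iff_shift)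
  next
    fix k' :: nat and x assume x: "x \<in> K"
    define k where "k = k' + 1"
    have k: "k \<ge> 1" by (simp add: k_def)
    have x0: "x \<noteq> 0" using r x by force
    have Ap: "A k x > 0" using A_eq[OF k] amplitude_pos[OF b] by simp
    have Uv: "\<bar>U k x * v k x\<bar> \<le> A k x / 2"
    proof -
      have "2 * \<bar>\<beta> k * v k x\<bar> * \<bar>U k x\<bar> \<le> \<bar>\<beta> k * v k x\<bar>\<^sup>2 + \<bar>U k x\<bar>\<^sup>2" by (rule sum_squares_bound)
      also have "\<dots> = \<beta> k * A k x" using \<beta>pos[OF k] by (simp add: A_def field_simps power2_eq_square)
      finally have "\<beta> k * (2 * \<bar>U k x * v k x\<bar>) \<le> \<beta> k * A k x" using \<beta>pos[OF k] by (simp add: abs_mult mult_ac)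
      then show ?thesis using \<beta>pos[OF k] by simp
    qed
    have "W k x - A k x = - (x * (U k x * v k x) / \<beta> k) - \<delta> k / x * (U k x * v k x)"
      using \<beta>pos[OF k] by (simp add: W_def A_def field_simps power2_eq_square)
    also have "\<bar>\<dots>\<bar> \<le> \<bar>x * (U k x * v k x) / \<beta> k\<bar> + \<bar>\<delta> k / x * (U k x * v k x)\<bar>" 
      using abs_triangle_ineq4[of "- (x * (U k x * v k x) / \<beta> k)" "\<delta> k / x * (U k x * v k x)"]
      unfolding abs_minus_cancel .
    also have "\<bar>x * (U k x * v k x) / \<beta> k\<bar> \<le> R * (A k x / 2) / \<beta> k"
      unfolding abs_divide abs_mult[of x] using Uv R[OF x] \<beta>pos[OF k]
      by (intro frac_le mult_mono) auto
    also have "\<bar>\<delta> k / x * (U k x * v k x)\<bar> \<le> \<delta> k / r * (A k x / 2)"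
      unfolding abs_mult[of "\<delta> k / x"] abs_divide using Uv r x \<delta>0[OF k]
      by (intro mult_mono frac_le) auto
    also have "R * (A k x / 2) / \<beta> k + \<delta> k / r * (A k x / 2) = \<eta> k * A k x"
      using r \<beta>pos[OF k] by (simp add: \<eta>_def field_simps)
    finally show "\<bar>W (k' + 1) x - A (k' + 1) x\<bar> \<le> \<eta> (k' + 1) * A (k' + 1) x"
      by (simp add: k_def)
    show "\<bar>W (Suc k' + 1) x - W (k' + 1) x\<bar> \<le> \<epsilon> (k' + 1) * A (k' + 1) x"
      using energy_step[OF ge1[OF k] mono[OF k] \<delta>D[OF k, unfolded \<delta>_def] r(1) r(2)[OF x] R[OF x],
          of "v k x" "U k x" "\<delta> (Suc k)", folded v_rec[OF k], folded U_rec[OF k], folded \<delta>_def,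
          folded W_def, folded A_def, folded C1_def C2_def, folded \<epsilon>_def]
      by (simp add: k_def)
  qed
  then have "uniformly_convergent_on K (\<lambda>k x. ln (amplitude b (2 * (k + 1) - 1) x))"
    by (subst (asm) A_eq) simp_all
  then show ?thesis
    unfolding uniformly_convergent_on_def uniform_limit_iff
    using eventually_sequentially_seg[of "\<lambda>n. \<forall>x\<in>K. dist (ln (amplitude b (2 * n - 1) x)) (l x) < e" 1 for l e]
    by simp
qed

section \<open>Square-summable sequences\<close>

text \<open>
  The real inner product is all that is needed: it determines the scalar spectral measures by
  polarization, and the polynomials are real.
\<close>

abbreviation rip :: "(nat \<Rightarrow> complex) \<Rightarrow> (nat \<Rightarrow> complex) \<Rightarrow> real" where
  "rip x y \<equiv> Re (ell2_inner x y)"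

lemma ell2_lincomb:
  assumes "x \<in> ell2" "y \<in> ell2"
  shows "(\<lambda>n. c * x n + d * y n) \<in> ell2"
  unfolding ell2_def mem_Collect_eq
proof (rule summable_comparison_test')
  show "summable (\<lambda>n. 2 * (cmod c)\<^sup>2 * (cmod (x n))\<^sup>2 + 2 * (cmod d)\<^sup>2 * (cmod (y n))\<^sup>2)"
    using assms unfolding ell2_def mem_Collect_eq by (intro summable_add summable_mult)
  fix n
  have "cmod (c * x n + d * y n) \<le> cmod c * cmod (x n) + cmod d * cmod (y n)"
    by (metis norm_mult norm_triangle_ineq)
  then have "(cmod (c * x n + d * y n))\<^sup>2 \<le> (cmod c * cmod (x n) + cmod d * cmod (y n))\<^sup>2"
    by (intro power_mono) auto
  also have "\<dots> \<le> 2 * (cmod c * cmod (x n))\<^sup>2 + 2 * (cmod d * cmod (y n))\<^sup>2"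
    using zero_le_power2[of "cmod c * cmod (x n) - cmod d * cmod (y n)"]
    by (simp add: power2_sum power2_diff)
  finally show "norm ((cmod (c * x n + d * y n))\<^sup>2) \<le>
      2 * (cmod c)\<^sup>2 * (cmod (x n))\<^sup>2 + 2 * (cmod d)\<^sup>2 * (cmod (y n))\<^sup>2"
    by (simp add: power_mult_distrib)
qed

lemma ell2_add: "x \<in> ell2 \<Longrightarrow> y \<in> ell2 \<Longrightarrow> (\<lambda>n. x n + y n) \<in> ell2"
  using ell2_lincomb[of x y 1 1] by simp

lemma ell2_diff: "x \<in> ell2 \<Longrightarrow> y \<in> ell2 \<Longrightarrow> (\<lambda>n. x n - y n) \<in> ell2"
  using ell2_lincomb[of x y 1 "-1"] by simp

lemma rip_commute:
  assumes "x \<in> ell2" "y \<in> ell2"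
  shows "rip x y = rip y x"
proof -
  have "(\<lambda>n. cnj (x n * cnj (y n))) sums cnj (ell2_inner x y)"
    unfolding ell2_inner_def sums_cnj by (intro summable_sums ell2_summable_inner assms)
  then have "cnj (ell2_inner x y) = ell2_inner y x"
    unfolding ell2_inner_def by (simp add: sums_iff mult.commute)
  then have "rip y x = Re (cnj (ell2_inner x y))" by simp
  then show ?thesis by simp
qed

lemma rip_add_left:
  assumes "x \<in> ell2" "y \<in> ell2" "z \<in> ell2"
  shows "rip (\<lambda>n. x n + y n) z = rip x z + rip y z"
proof -
  have "(\<lambda>n. x n * cnj (z n) + y n * cnj (z n)) sums (ell2_inner x z + ell2_inner y z)"
    unfolding ell2_inner_def by (intro sums_add summable_sums ell2_summable_inner assms)
  then have "ell2_inner (\<lambda>n. x n + y n) z = ell2_inner x z + ell2_inner y z"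
    unfolding ell2_inner_def by (simp add: sums_iff algebra_simps)
  then show ?thesis by simp
qed

lemma rip_diff_left:
  assumes "x \<in> ell2" "y \<in> ell2" "z \<in> ell2"
  shows "rip (\<lambda>n. x n - y n) z = rip x z - rip y z"
proof -
  have "(\<lambda>n. x n * cnj (z n) - y n * cnj (z n)) sums (ell2_inner x z - ell2_inner y z)"
    unfolding ell2_inner_def by (intro sums_diff summable_sums ell2_summable_inner assms)
  then have "ell2_inner (\<lambda>n. x n - y n) z = ell2_inner x z - ell2_inner y z"
    unfolding ell2_inner_def by (simp add: sums_iff algebra_simps)
  then show ?thesis by simp
qed

lemma rip_add_right:
  assumes "x \<in> ell2" "y \<in> ell2" "z \<in> ell2"
  shows "rip z (\<lambda>n. x n + y n) = rip z x + rip z y"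
  using assms rip_add_left[of x y z] rip_commute ell2_add by metis

lemma rip_diff_right:
  assumes "x \<in> ell2" "y \<in> ell2" "z \<in> ell2"
  shows "rip z (\<lambda>n. x n - y n) = rip z x - rip z y"
  using assms rip_diff_left[of x y z] rip_commute ell2_diff by metis

lemma rip_scale_right:
  assumes "x \<in> ell2" "z \<in> ell2"
  shows "rip z (\<lambda>n. of_real c * x n) = c * rip z x"
proof -
  have "(\<lambda>n. of_real c * (z n * cnj (x n))) sums (of_real c * ell2_inner z x)"
    unfolding ell2_inner_def by (intro sums_mult summable_sums ell2_summable_inner assms)
  then have "ell2_inner z (\<lambda>n. of_real c * x n) = of_real c * ell2_inner z x"
    unfolding ell2_inner_def by (simp add: sums_iff mult_ac)
  then show ?thesis by simp
qed

lemma rip_self_nonneg: "x \<in> ell2 \<Longrightarrow> rip x x \<ge> 0"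
proof -
  assume x: "x \<in> ell2"
  have "(\<lambda>n. Re (x n * cnj (x n))) sums rip x x"
    unfolding ell2_inner_def by (intro sums_Re summable_sums ell2_summable_inner x)
  then show ?thesis
    by (rule sums_le[OF _ sums_zero, rotated]) (simp add: complex_mult_cnj)
qed

lemma abs_rip_le:
  assumes "x \<in> ell2" "y \<in> ell2"
  shows "\<bar>rip x y\<bar> \<le> ell2_norm x * ell2_norm y"
proof -
  have sx: "summable (\<lambda>n. (cmod (x n))\<^sup>2)" and sy: "summable (\<lambda>n. (cmod (y n))\<^sup>2)"
    using assms by (auto simp: ell2_def)
  have s: "summable (\<lambda>n. cmod (x n) * cmod (y n))" by (rule ell2_summable_norm_mult[OF assms])
  have "\<bar>rip x y\<bar> \<le> cmod (ell2_inner x y)" by (rule abs_Re_le_cmod)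
  also have "\<dots> \<le> (\<Sum>n. cmod (x n * cnj (y n)))"
    unfolding ell2_inner_def by (rule summable_norm) (simp add: norm_mult s)
  also have "\<dots> = (\<Sum>n. cmod (x n) * cmod (y n))" by (simp add: norm_mult)
  also have "\<dots> \<le> ell2_norm x * ell2_norm y"
  proof (rule suminf_le_const[OF s])
    fix N
    have "(\<Sum>n<N. cmod (x n) * cmod (y n))\<^sup>2 \<le> (\<Sum>n<N. (cmod (x n))\<^sup>2) * (\<Sum>n<N. (cmod (y n))\<^sup>2)"
      by (rule Cauchy_Schwarz_ineq_sum)
    also have "\<dots> \<le> (\<Sum>n. (cmod (x n))\<^sup>2) * (\<Sum>n. (cmod (y n))\<^sup>2)"
      by (intro mult_mono sum_le_suminf sx sy suminf_nonneg sum_nonneg) auto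
    also have "\<dots> = (ell2_norm x * ell2_norm y)\<^sup>2"
      unfolding ell2_norm_def power_mult_distrib
      by (simp add: suminf_nonneg sx sy)
    finally show "(\<Sum>n<N. cmod (x n) * cmod (y n)) \<le> ell2_norm x * ell2_norm y"
      by (rule power2_le_imp_le) (simp add: ell2_norm_def suminf_nonneg sx sy)
  qed
  finally show ?thesis .
qed

definition unit_seq :: "nat \<Rightarrow> nat \<Rightarrow> complex" where
  "unit_seq j n = (if n = j then 1 else 0)"

lemma unit_seq_0: "unit_seq 0 = e0"
  by (auto simp: unit_seq_def e0_def)

lemma unit_seq_ell2 [simp]: "unit_seq j \<in> ell2"
  by (rule ell2_finite_support[of "Suc j"]) (simp add: unit_seq_def)

lemma unit_seq_domain [simp]: "unit_seq j \<in> jacobi_domain b"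
  by (rule jacobi_domain_finite_support[of "Suc j"]) (simp add: unit_seq_def)

lemma rip_unit_seq: "rip (unit_seq i) (unit_seq j) = (if i = j then 1 else 0)"
proof -
  have "ell2_inner (unit_seq i) (unit_seq j) = (\<Sum>n\<in>{i}. unit_seq i n * cnj (unit_seq j n))"
    unfolding ell2_inner_def by (rule suminf_finite) (auto simp: unit_seq_def)
  then show ?thesis by (simp add: unit_seq_def)
qed

section \<open>Scalar spectral measures\<close>

locale pvm =
  fixes E :: "real set \<Rightarrow> (nat \<Rightarrow> complex) \<Rightarrow> (nat \<Rightarrow> complex)"
  assumes pvm: "projection_valued_measure E"
begin

abbreviation \<sigma> where "\<sigma> x \<equiv> scalar_spectral_measure E x"

lemma E_ell2: "B \<in> sets borel \<Longrightarrow> x \<in> ell2 \<Longrightarrow> E B x \<in> ell2"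
  and E_sym: "B \<in> sets borel \<Longrightarrow> x \<in> ell2 \<Longrightarrow> y \<in> ell2 \<Longrightarrow> rip (E B x) y = rip x (E B y)"
  and E_idem: "B \<in> sets borel \<Longrightarrow> x \<in> ell2 \<Longrightarrow> E B (E B x) = E B x"
  and E_empty: "x \<in> ell2 \<Longrightarrow> E {} x = (\<lambda>n. 0)"
  and E_UNIV: "x \<in> ell2 \<Longrightarrow> E UNIV x = x"
  and E_Int: "B \<in> sets borel \<Longrightarrow> C \<in> sets borel \<Longrightarrow> x \<in> ell2 \<Longrightarrow> E (B \<inter> C) x = E B (E C x)"
  using pvm unfolding projection_valued_measure_def orthogonal_projection_def by auto

lemma E_lincomb:
  assumes "B \<in> sets borel" "x \<in> ell2" "y \<in> ell2"
  shows "E B (\<lambda>n. c * x n + d * y n) = (\<lambda>n. c * E B x n + d * E B y n)"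
proof -
  have "orthogonal_projection (E B)" using pvm assms(1) by (simp add: projection_valued_measure_def)
  then show ?thesis using assms(2,3) unfolding orthogonal_projection_def by simp
qed

lemma E_add: "B \<in> sets borel \<Longrightarrow> x \<in> ell2 \<Longrightarrow> y \<in> ell2 \<Longrightarrow> E B (\<lambda>n. x n + y n) = (\<lambda>n. E B x n + E B y n)"
  using E_lincomb[of B x y 1 1] by simp

lemma E_diff: "B \<in> sets borel \<Longrightarrow> x \<in> ell2 \<Longrightarrow> y \<in> ell2 \<Longrightarrow> E B (\<lambda>n. x n - y n) = (\<lambda>n. E B x n - E B y n)"
  using E_lincomb[of B x y 1 "-1"] by simp

lemma rip_E_nonneg: "B \<in> sets borel \<Longrightarrow> x \<in> ell2 \<Longrightarrow> rip (E B x) x \<ge> 0"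
  using E_sym[of B "E B x" x] E_idem[of B x] rip_self_nonneg[of "E B x"] E_ell2[of B x]
  by (simp add: rip_commute)

lemma space_\<sigma> [simp]: "space (\<sigma> x) = UNIV" and sets_\<sigma> [simp, measurable_cong]: "sets (\<sigma> x) = sets borel"
  unfolding scalar_spectral_measure_def
  by (simp_all add: sets.sigma_sets_eq[of "borel :: real measure", simplified])

text \<open>
  Strong countable additivity implies weak countable additivity by the Cauchy-Schwarz inequality.
\<close>

lemma rip_E_sums:
  assumes B: "range B \<subseteq> sets borel" "disjoint_family B" and x: "x \<in> ell2" "y \<in> ell2"
  shows "(\<lambda>i. rip (E (B i) x) y) sums rip (E (\<Union>i. B i) x) y"
proof -
  have Bi: "B i \<in> sets borel" for i using B by auto
  have BU: "(\<Union>i. B i) \<in> sets borel" using Bi by auto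
  define s where "s N = (\<lambda>n. \<Sum>i<N. E (B i) x n)" for N
  have s: "s N \<in> ell2" and rs: "rip (s N) y = (\<Sum>i<N. rip (E (B i) x) y)" for N
  proof (induction N)
    case 0
    { case 1 show ?case by (rule ell2_finite_support[of 0]) (simp add: s_def)
    next case 2 show ?case by (simp add: s_def ell2_inner_def) }
  next
    case (Suc N)
    have eq: "s (Suc N) = (\<lambda>n. s N n + E (B N) x n)" by (simp add: s_def)
    { case 1 show ?case unfolding eq using Suc E_ell2[OF Bi] x by (intro ell2_add) auto
    next case 2 show ?case unfolding eq using Suc E_ell2[OF Bi] x by (subst rip_add_left) auto }
  qed
  have lim: "(\<lambda>N. ell2_norm (\<lambda>n. E (\<Union>i. B i) x n - s N n)) \<longlonglongrightarrow> 0"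
    using pvm B x unfolding projection_valued_measure_def s_def by blast
  have "(\<lambda>N. rip (E (\<Union>i. B i) x) y - rip (s N) y) \<longlonglongrightarrow> 0"
  proof (rule Lim_null_comparison)
    show "\<forall>\<^sub>F N in sequentially. norm (rip (E (\<Union>i. B i) x) y - rip (s N) y) \<le>
        ell2_norm (\<lambda>n. E (\<Union>i. B i) x n - s N n) * ell2_norm y"
      using abs_rip_le[of "\<lambda>n. E (\<Union>i. B i) x n - s N n" y for N] E_ell2[OF BU x(1)] s x
      by (intro always_eventually allI) (auto simp: rip_diff_left ell2_diff)
    show "(\<lambda>N. ell2_norm (\<lambda>n. E (\<Union>i. B i) x n - s N n) * ell2_norm y) \<longlonglongrightarrow> 0"
      using tendsto_mult_right[OF lim, of "ell2_norm y"] by simp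
  qed
  then have "(\<lambda>N. rip (s N) y) \<longlonglongrightarrow> rip (E (\<Union>i. B i) x) y"
    using tendsto_diff[OF tendsto_const, of _ _ sequentially "rip (E (\<Union>i. B i) x) y"] by fastforce
  then show ?thesis unfolding sums_def rs .
qed

lemma emeasure_\<sigma>:
  assumes "x \<in> ell2" "B \<in> sets borel"
  shows "emeasure (\<sigma> x) B = ennreal (rip (E B x) x)"
  unfolding scalar_spectral_measure_def
proof (rule emeasure_measure_of_sigma)
  show "sigma_algebra UNIV (sets borel :: real set set)"
    using sets.sigma_algebra_axioms[of "borel :: real measure"] by simp
  show "positive (sets borel) (\<lambda>B. ennreal (rip (E B x) x))"
    using assms by (simp add: positive_def E_empty ell2_inner_def)
  show "countably_additive (sets borel) (\<lambda>B. ennreal (rip (E B x) x))"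
  proof (rule countably_additiveI)
    fix A :: "nat \<Rightarrow> real set"
    assume A: "range A \<subseteq> sets borel" "disjoint_family A"
    have "(\<lambda>i. rip (E (A i) x) x) sums rip (E (\<Union>i. A i) x) x"
      by (rule rip_E_sums[OF A assms(1) assms(1)])
    moreover have "rip (E (A i) x) x \<ge> 0" for i using A assms by (intro rip_E_nonneg) auto
    ultimately show "(\<Sum>i. ennreal (rip (E (A i) x) x)) = ennreal (rip (E (\<Union> (range A)) x) x)"
      by (intro suminf_ennreal_eq) auto
  qed
qed (use assms in auto)

lemma measure_\<sigma>: "x \<in> ell2 \<Longrightarrow> B \<in> sets borel \<Longrightarrow> measure (\<sigma> x) B = rip (E B x) x"
  by (simp add: measure_def emeasure_\<sigma> rip_E_nonneg)

lemma finite_measure_\<sigma>: "x \<in> ell2 \<Longrightarrow> finite_measure (\<sigma> x)"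
  by (rule finite_measureI) (simp add: emeasure_\<sigma>)

lemma measure_\<sigma>_polar:
  assumes "x \<in> ell2" "y \<in> ell2" "B \<in> sets borel"
  shows "measure (\<sigma> (\<lambda>n. x n + y n)) B - measure (\<sigma> (\<lambda>n. x n - y n)) B = 4 * rip (E B x) y"
proof -
  have "rip (E B y) x = rip (E B x) y"
    using assms E_sym[of B y x] rip_commute[of y "E B x"] E_ell2 by simp
  then show ?thesis
    using assms by (simp add: measure_\<sigma> ell2_add ell2_diff E_add E_diff rip_add_left rip_add_right
        rip_diff_left rip_diff_right E_ell2)
qed

text \<open>
  The scalar spectral measure of a vector in the range of \<open>E B\<close> lives on \<open>B\<close>; this is how spectral
  cut-offs turn into cut-offs of integrals.
\<close>

lemma \<sigma>_E:
  assumes "x \<in> ell2" "B \<in> sets borel"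
  shows "\<sigma> (E B x) = density (\<sigma> x) (indicator B)"
proof (rule measure_eqI)
  fix C assume "C \<in> sets (\<sigma> (E B x))"
  then have C: "C \<in> sets borel" by simp
  have "rip (E C (E B x)) (E B x) = rip (E (B \<inter> C) x) x"
  proof -
    have "rip (E C (E B x)) (E B x) = rip (E B (E C (E B x))) x"
      using assms C by (intro E_sym[symmetric] E_ell2)
    also have "E B (E C (E B x)) = E (B \<inter> C) x"
      using assms C by (simp add: E_Int[symmetric] Int_ac)
    finally show ?thesis .
  qed
  then show "emeasure (\<sigma> (E B x)) C = emeasure (density (\<sigma> x) (indicator B)) C"
    using assms C by (subst emeasure_restricted) (auto simp: emeasure_\<sigma> E_ell2)
qed simp

lemma integral_\<sigma>_E:
  fixes g :: "real \<Rightarrow> real"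
  assumes "x \<in> ell2" "B \<in> sets borel" "g \<in> borel_measurable borel"
  shows "(LINT t|\<sigma> (E B x). g t) = (LINT t|\<sigma> x. indicator B t * g t)"
    and "integrable (\<sigma> (E B x)) g \<longleftrightarrow> integrable (\<sigma> x) (\<lambda>t. indicator B t * g t)"
proof -
  have *: "\<sigma> (E B x) = density (\<sigma> x) (\<lambda>t. ennreal (indicator B t))"
    using \<sigma>_E[OF assms(1,2)] by (simp add: ennreal_indicator)
  show "(LINT t|\<sigma> (E B x). g t) = (LINT t|\<sigma> x. indicator B t * g t)"
    unfolding * using assms by (subst integral_density) auto
  show "integrable (\<sigma> (E B x)) g \<longleftrightarrow> integrable (\<sigma> x) (\<lambda>t. indicator B t * g t)"
    unfolding * using assms by (subst integrable_density) auto
qed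

end

section \<open>Spectral representation of the Jacobi operator\<close>

text \<open>
  A set function identity between two measures and a signed density extends to the integral of the
  identity function, by approximating it with the step functions \<open>\<lfloor>n * t\<rfloor> / n\<close>. On a bounded set
  these take finitely many values.
\<close>

lemma integral_signed_identity:
  fixes M N \<rho> :: "real measure" and h :: "real \<Rightarrow> real"
  assumes M: "finite_measure M" "sets M = sets borel"
    and N: "finite_measure N" "sets N = sets borel"
    and \<rho>: "sets \<rho> = sets borel" "integrable \<rho> (\<lambda>t. indicator B t * h t)"
    and B: "B \<in> sets borel" "B \<subseteq> {-R..R}"
    and h: "h \<in> borel_measurable borel"
    and eq: "\<And>C. C \<in> sets borel \<Longrightarrow> C \<subseteq> B \<Longrightarrow>
      measure M C - measure N C = (LINT t|\<rho>. indicator C t * h t)"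
  shows "(LINT t|M. indicator B t * t) - (LINT t|N. indicator B t * t) =
         (LINT t|\<rho>. indicator B t * (t * h t))"
proof -
  interpret M: finite_measure M by (rule M)
  interpret N: finite_measure N by (rule N)
  note [measurable_cong] = M(2) N(2) \<rho>(1)
  note [measurable] = B(1) h
  define R' where "R' = max R 0"
  have R': "B \<subseteq> {-R'..R'}" "R' \<ge> 0" using B(2) by (auto simp: R'_def subset_iff)
  define \<phi> where "\<phi> n t = real_of_int \<lfloor>real (Suc n) * t\<rfloor> / real (Suc n)" for n and t :: real
  have \<phi>_meas [measurable]: "\<phi> n \<in> borel_measurable borel" for n
    unfolding \<phi>_def by measurable
  have \<phi>_le: "\<bar>\<phi> n t - t\<bar> \<le> 1 / real (Suc n)" for n t
  proof -
    have "\<bar>real_of_int \<lfloor>real (Suc n) * t\<rfloor> - real (Suc n) * t\<bar> \<le> 1" by linarith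
    then have "\<bar>real_of_int \<lfloor>real (Suc n) * t\<rfloor> - real (Suc n) * t\<bar> / real (Suc n) \<le> 1 / real (Suc n)"
      by (rule divide_right_mono) simp
    moreover have "\<phi> n t - t = (real_of_int \<lfloor>real (Suc n) * t\<rfloor> - real (Suc n) * t) / real (Suc n)"
      by (simp add: \<phi>_def field_simps)
    ultimately show ?thesis by (simp add: abs_divide)
  qed
  have \<phi>_lim: "(\<lambda>n. \<phi> n t) \<longlonglongrightarrow> t" for t
  proof -
    have "(\<lambda>n. \<phi> n t - t) \<longlonglongrightarrow> 0"
    proof (rule Lim_null_comparison[OF _ LIMSEQ_inverse_real_of_nat])
      show "\<forall>\<^sub>F n in sequentially. norm (\<phi> n t - t) \<le> inverse (real (Suc n))"
        unfolding real_norm_def inverse_eq_divide by (intro always_eventually allI \<phi>_le)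
    qed
    then show ?thesis using LIM_zero_iff[of "\<lambda>n. \<phi> n t" t sequentially] by simp
  qed
  have \<phi>_bound: "\<bar>\<phi> n t\<bar> \<le> R' + 1" if "t \<in> B" for n t
  proof -
    have "1 / real (Suc n) \<le> 1" by simp
    moreover have "\<bar>t\<bar> \<le> R'" using subsetD[OF R'(1) that] by auto
    ultimately show ?thesis using \<phi>_le[of n t] by linarith
  qed
  have fin: "(LINT t|M. indicator B t * \<phi> n t) - (LINT t|N. indicator B t * \<phi> n t) =
      (LINT t|\<rho>. indicator B t * (\<phi> n t * h t))" for n
  proof -
    define m :: int where "m = \<lceil>real (Suc n) * (R' + 1)\<rceil>"
    define S where "S k = {t \<in> B. \<lfloor>real (Suc n) * t\<rfloor> = k}" for k :: int
    have S_meas [measurable]: "S k \<in> sets borel" for k unfolding S_def by measurable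
    have S_sub: "S k \<subseteq> B" for k by (auto simp: S_def)
    have expand: "indicator B t * \<phi> n t = (\<Sum>k\<in>{-m..m}. real_of_int k / real (Suc n) * indicator (S k) t)" for t
    proof (cases "t \<in> B")
      case True
      let ?k = "\<lfloor>real (Suc n) * t\<rfloor>"
      have "\<bar>real_of_int ?k\<bar> = real (Suc n) * \<bar>\<phi> n t\<bar>" by (simp add: \<phi>_def abs_mult)
      also have "\<dots> \<le> real (Suc n) * (R' + 1)" using \<phi>_bound[OF True] by (intro mult_left_mono) auto
      also have "\<dots> \<le> real_of_int m" unfolding m_def by linarith
      finally have k: "?k \<in> {-m..m}" by auto
      have "(\<Sum>k\<in>{-m..m}. real_of_int k / real (Suc n) * indicator (S k) t) =
          (\<Sum>k\<in>{-m..m}. if k = ?k then \<phi> n t else 0)"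
        using True by (intro sum.cong) (auto simp: S_def \<phi>_def)
      then show ?thesis using True k by simp
    qed (auto simp: S_def)
    have intM: "(LINT t|M. indicator B t * \<phi> n t) =
        (\<Sum>k\<in>{-m..m}. real_of_int k / real (Suc n) * measure M (S k))"
      unfolding expand by (subst Bochner_Integration.integral_sum) (auto simp: M.emeasure_eq_measure)
    have intN: "(LINT t|N. indicator B t * \<phi> n t) =
        (\<Sum>k\<in>{-m..m}. real_of_int k / real (Suc n) * measure N (S k))"
      unfolding expand by (subst Bochner_Integration.integral_sum) (auto simp: N.emeasure_eq_measure)
    have int: "integrable \<rho> (\<lambda>t. indicator (S k) t * h t)" for k
    proof -
      have "integrable \<rho> (\<lambda>t. indicator (S k) t *\<^sub>R (indicator B t * h t))"
        by (intro integrable_mult_indicator \<rho>) (simp add: \<rho>)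
      moreover have "(\<lambda>t. indicator (S k) t *\<^sub>R (indicator B t * h t)) = (\<lambda>t. indicator (S k) t * h t)"
        by (auto simp: indicator_def S_def)
      ultimately show ?thesis by (simp only:)
    qed
    have "(LINT t|\<rho>. indicator B t * (\<phi> n t * h t)) =
        (LINT t|\<rho>. (\<Sum>k\<in>{-m..m}. real_of_int k / real (Suc n) * (indicator (S k) t * h t)))"
      by (intro Bochner_Integration.integral_cong) (simp_all add: mult.assoc[symmetric] expand sum_distrib_right)
    also have "\<dots> = (\<Sum>k\<in>{-m..m}. real_of_int k / real (Suc n) * (LINT t|\<rho>. indicator (S k) t * h t))"
      by (subst Bochner_Integration.integral_sum) (use int in \<open>simp_all del: of_nat_Suc\<close>)
    also have "\<dots> = (\<Sum>k\<in>{-m..m}. real_of_int k / real (Suc n) * (measure M (S k) - measure N (S k)))"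
      by (simp add: eq S_sub)
    finally show ?thesis unfolding intM intN by (simp add: sum_subtractf right_diff_distrib)
  qed
  have limM: "(\<lambda>n. LINT t|M. indicator B t * \<phi> n t) \<longlonglongrightarrow> (LINT t|M. indicator B t * t)"
    by (rule integral_dominated_convergence[where w = "\<lambda>_. R' + 1"])
       (use \<phi>_bound R' in \<open>auto intro!: tendsto_intros \<phi>_lim split: split_indicator\<close>)
  have limN: "(\<lambda>n. LINT t|N. indicator B t * \<phi> n t) \<longlonglongrightarrow> (LINT t|N. indicator B t * t)"
    by (rule integral_dominated_convergence[where w = "\<lambda>_. R' + 1"])
       (use \<phi>_bound R' in \<open>auto intro!: tendsto_intros \<phi>_lim split: split_indicator\<close>)
  have limR: "(\<lambda>n. LINT t|\<rho>. indicator B t * (\<phi> n t * h t)) \<longlonglongrightarrow> (LINT t|\<rho>. indicator B t * (t * h t))"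
  proof (rule integral_dominated_convergence[where w = "\<lambda>t. (R' + 1) * norm (indicator B t * h t)"])
    show "integrable \<rho> (\<lambda>t. (R' + 1) * norm (indicator B t * h t))"
      by (intro integrable_mult_right integrable_norm \<rho>)
    show "AE t in \<rho>. norm (indicator B t * (\<phi> n t * h t)) \<le> (R' + 1) * norm (indicator B t * h t)" for n
      using \<phi>_bound by (auto intro!: AE_I2 mult_right_mono simp: abs_mult split: split_indicator)
  qed (auto intro!: tendsto_intros \<phi>_lim)
  show ?thesis
    using LIMSEQ_unique[OF tendsto_diff[OF limM limN] limR[folded fin]] .
qed

lemma jacobi_op_add: "jacobi_op b (\<lambda>n. x n + y n) = (\<lambda>n. jacobi_op b x n + jacobi_op b y n)"
  and jacobi_op_diff: "jacobi_op b (\<lambda>n. x n - y n) = (\<lambda>n. jacobi_op b x n - jacobi_op b y n)"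
  by (auto simp: jacobi_op_def algebra_simps)

lemma jacobi_op_unit_seq:
  "jacobi_op b (unit_seq 0) = (\<lambda>n. of_real (b 0) * unit_seq 1 n)"
  "jacobi_op b (unit_seq (Suc j)) =
     (\<lambda>n. of_real (b (Suc j)) * unit_seq (Suc (Suc j)) n + of_real (b j) * unit_seq j n)"
  by (auto simp: jacobi_op_def unit_seq_def fun_eq_iff)

locale jacobi_pvm = pvm +
  fixes b :: "nat \<Rightarrow> real"
  assumes b_pos: "\<And>n. b n > 0" and carleman: "\<not> summable (\<lambda>n. 1 / b n)"
    and spectral: "is_spectral_measure_of E (jacobi_domain b) (jacobi_op b)"
begin

abbreviation "\<D> \<equiv> jacobi_domain b"
abbreviation "T \<equiv> jacobi_op b"

lemma D_iff: "x \<in> \<D> \<longleftrightarrow> x \<in> ell2 \<and> integrable (\<sigma> x) (\<lambda>t. t\<^sup>2)"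
  using spectral by (auto simp: is_spectral_measure_of_def)

lemma rip_T_self: "x \<in> \<D> \<Longrightarrow> rip (T x) x = (LINT t|\<sigma> x. t)"
  using spectral by (auto simp: is_spectral_measure_of_def)

lemma D_ell2: "x \<in> \<D> \<Longrightarrow> x \<in> ell2" "x \<in> \<D> \<Longrightarrow> T x \<in> ell2"
  by (auto simp: jacobi_domain_def)

lemma D_add: "x \<in> \<D> \<Longrightarrow> y \<in> \<D> \<Longrightarrow> (\<lambda>n. x n + y n) \<in> \<D>"
  and D_diff: "x \<in> \<D> \<Longrightarrow> y \<in> \<D> \<Longrightarrow> (\<lambda>n. x n - y n) \<in> \<D>"
  by (auto simp: jacobi_domain_def jacobi_op_add jacobi_op_diff ell2_add ell2_diff)

lemma T_sym: "x \<in> \<D> \<Longrightarrow> y \<in> \<D> \<Longrightarrow> rip (T x) y = rip x (T y)"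
  using jacobi_symmetric[OF b_pos carleman] by simp

lemma T_polar:
  assumes "x \<in> \<D>" "y \<in> \<D>"
  shows "4 * rip (T x) y = (LINT t|\<sigma> (\<lambda>n. x n + y n). t) - (LINT t|\<sigma> (\<lambda>n. x n - y n). t)"
proof -
  have "rip (T y) x = rip (T x) y"
    using T_sym[OF assms] rip_commute[of "T y" x] D_ell2 assms by simp
  then show ?thesis
    using assms
    by (simp add: rip_T_self[symmetric] D_add D_diff jacobi_op_add jacobi_op_diff D_ell2 ell2_add ell2_diff
        rip_add_left rip_add_right rip_diff_left rip_diff_right)
qed

lemma E_D:
  assumes "B \<in> sets borel" "x \<in> \<D>"
  shows "E B x \<in> \<D>"
proof -
  have x: "x \<in> ell2" "integrable (\<sigma> x) (\<lambda>t. t\<^sup>2)" using assms D_iff by auto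
  have "integrable (\<sigma> x) (\<lambda>t. indicator B t *\<^sub>R t\<^sup>2)"
    by (intro integrable_mult_indicator x) (simp add: assms)
  then have "integrable (\<sigma> (E B x)) (\<lambda>t. t\<^sup>2)"
    using integral_\<sigma>_E(2)[OF x(1) assms(1), of "\<lambda>t. t\<^sup>2"] by simp
  then show ?thesis using x assms E_ell2 D_iff by blast
qed

lemma E_D_bounded:
  assumes B: "B \<in> sets borel" "B \<subseteq> {-R..R}" and x: "x \<in> ell2"
  shows "E B x \<in> \<D>"
proof -
  interpret finite_measure "\<sigma> x" by (rule finite_measure_\<sigma>[OF x])
  have "integrable (\<sigma> x) (\<lambda>t. indicator B t * t\<^sup>2)"
  proof (rule integrable_const_bound[where B = "R\<^sup>2"])
    have "\<bar>t\<bar> \<le> \<bar>R\<bar>" if "t \<in> B" for t using B that by (auto simp: subset_iff)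
    then show "AE t in \<sigma> x. norm (indicator B t * t\<^sup>2) \<le> R\<^sup>2"
      by (intro AE_I2) (auto simp: indicator_def abs_le_square_iff)
  qed (use B in measurable)
  then have "integrable (\<sigma> (E B x)) (\<lambda>t. t\<^sup>2)"
    using integral_\<sigma>_E(2)[OF x(1) B(1), of "\<lambda>t. t\<^sup>2"] by simp
  then show ?thesis using x B E_ell2 D_iff by blast
qed

text \<open>
  The operator maps the range of \<open>E B\<close> to itself. Indeed, with \<open>z = y - E B y\<close>, the vectors \<open>E B
  x\<close> and \<open>z\<close> have orthogonal spectral projections, so that \<open>E B x + z\<close> and \<open>E B x - z\<close> have the
  same scalar spectral measure; by polarization the quadratic form does not couple them.
\<close>

lemma T_E_orthogonal:
  assumes B: "B \<in> sets borel" "B \<subseteq> {-R..R}" and x: "x \<in> ell2" and y: "y \<in> \<D>"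
  shows "rip (T (E B x)) y = rip (T (E B x)) (E B y)"
proof -
  define z where "z n = y n - E B y n" for n
  have y2: "y \<in> ell2" using y by (rule D_ell2)
  have z: "z \<in> \<D>" unfolding z_def using y E_D[OF B(1) y] by (rule D_diff)
  have z2: "z \<in> ell2" using z by (rule D_ell2)
  have Ex: "E B x \<in> \<D>" by (rule E_D_bounded[OF B x])
  have Ex2: "E B x \<in> ell2" using Ex by (rule D_ell2)
  have "rip (E C (E B x)) z = 0" if C: "C \<in> sets borel" for C
  proof -
    have CB: "E C (E B x) \<in> ell2" using C B x by (intro E_ell2)
    have "rip (E C (E B x)) (E B y) = rip (E B (E C (E B x))) y"
      using E_sym[OF B(1) CB y2] by simp
    also have "E B (E C (E B x)) = E C (E B x)"
      using B C x by (simp add: E_Int[symmetric] Int_ac)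
    finally have "rip (E C (E B x)) (E B y) = rip (E C (E B x)) y" .
    then show ?thesis unfolding z_def using CB y2 E_ell2[OF B(1) y2] by (simp add: rip_diff_right)
  qed
  then have m: "measure (\<sigma> (\<lambda>n. E B x n + z n)) C = measure (\<sigma> (\<lambda>n. E B x n - z n)) C" if "C \<in> sets borel" for C
    using measure_\<sigma>_polar[OF Ex2 z2 that] that by simp
  have "\<sigma> (\<lambda>n. E B x n + z n) = \<sigma> (\<lambda>n. E B x n - z n)"
  proof (rule measure_eqI)
    interpret f1: finite_measure "\<sigma> (\<lambda>n. E B x n + z n)" by (intro finite_measure_\<sigma> ell2_add Ex2 z2)
    interpret f2: finite_measure "\<sigma> (\<lambda>n. E B x n - z n)" by (intro finite_measure_\<sigma> ell2_diff Ex2 z2)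
    fix A assume "A \<in> sets (\<sigma> (\<lambda>n. E B x n + z n))"
    then show "emeasure (\<sigma> (\<lambda>n. E B x n + z n)) A = emeasure (\<sigma> (\<lambda>n. E B x n - z n)) A"
      using m by (simp add: f1.emeasure_eq_measure f2.emeasure_eq_measure)
  qed simp
  then have "rip (T (E B x)) z = 0" using T_polar[OF Ex z] by simp
  then show ?thesis
    unfolding z_def using D_ell2[OF Ex] y2 E_ell2[OF B(1) y2] by (simp add: rip_diff_right)
qed

text \<open>
  Multiplication by \<open>t\<close> in the spectral representation, in polarized form.
\<close>

lemma rip_E_T:
  assumes B: "B \<in> sets borel" "B \<subseteq> {-R..R}" and x: "x \<in> ell2" and y: "y \<in> \<D>"
  shows "4 * rip (E B x) (T y) =
    (LINT t|\<sigma> (\<lambda>n. x n + y n). indicator B t * t) - (LINT t|\<sigma> (\<lambda>n. x n - y n). indicator B t * t)"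
proof -
  have y2: "y \<in> ell2" using y by (rule D_ell2)
  have Ex: "E B x \<in> \<D>" and Ey: "E B y \<in> \<D>" by (rule E_D_bounded[OF B x] E_D[OF B(1) y])+
  have "rip (E B x) (T y) = rip (T (E B x)) (E B y)"
    using T_sym[OF Ex y] T_E_orthogonal[OF B x y] by simp
  also have "4 * \<dots> = (LINT t|\<sigma> (E B (\<lambda>n. x n + y n)). t) - (LINT t|\<sigma> (E B (\<lambda>n. x n - y n)). t)"
    unfolding T_polar[OF Ex Ey] E_add[OF B(1) x y2] E_diff[OF B(1) x y2] ..
  finally show ?thesis
    using x y2 B by (simp add: integral_\<sigma>_E ell2_add ell2_diff)
qed

abbreviation "\<mu> \<equiv> \<sigma> e0"

lemma e0_ell2: "e0 \<in> ell2" using unit_seq_ell2[of 0] by (simp only: unit_seq_0)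

lemma integrable_bounded_support:
  fixes h :: "real \<Rightarrow> real"
  assumes "B \<in> sets borel" "B \<subseteq> {-R..R}" "continuous_on UNIV h"
  shows "integrable \<mu> (\<lambda>t. indicator B t * h t)"
proof -
  interpret finite_measure \<mu> by (rule finite_measure_\<sigma>[OF e0_ell2])
  have "bounded (h ` {-R..R})"
    using assms(3) by (intro compact_imp_bounded compact_continuous_image) (auto intro: continuous_on_subset)
  then obtain K where K: "\<forall>y\<in>h ` {-R..R}. norm y \<le> K" unfolding bounded_iff by blast
  have [measurable]: "h \<in> borel_measurable borel" using assms(3) by (rule borel_measurable_continuous_onI)
  show ?thesis
  proof (rule integrable_const_bound[where B = "\<bar>K\<bar>"])
    show "AE t in \<mu>. norm (indicator B t * h t) \<le> \<bar>K\<bar>"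
      using K assms(2) by (intro AE_I2) (force simp: indicator_def)
  qed (use assms(1) in measurable)
qed

lemma b_nz: "b n \<noteq> 0" using b_pos[of n] by simp

text \<open>
  The operator acts as multiplication by \<open>t\<close> under the spectral measure, and it sends the unit
  vectors to combinations of their neighbours. So the density \<open>h\<close> for \<open>e0\<close> propagates to \<open>h * p\<^sub>j\<close>
  for the \<open>j\<close>-th unit vector by the three-term recurrence. The induction is restricted to bounded
  sets, where all integrals exist.
\<close>

lemma rip_E_unit_seq_step:
  assumes x: "x \<in> ell2" and h: "continuous_on UNIV h"
    and 0: "\<And>B R. B \<in> sets borel \<Longrightarrow> B \<subseteq> {-R..R} \<Longrightarrow>
      rip (E B x) e0 = (LINT t|\<mu>. indicator B t * h t)"
    and B: "B \<in> sets borel" "B \<subseteq> {-R..R}"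
  shows "rip (E B x) (unit_seq j) = (LINT t|\<mu>. indicator B t * (h t * orthopoly b t j))"
  using B
proof (induction j arbitrary: B R rule: less_induct)
  case (less j B R)
  have cont: "continuous_on UNIV (\<lambda>t. h t * orthopoly b t i)" for i
    using b_nz by (intro continuous_intros h)
  have step: "rip (E B x) (T (unit_seq i)) = (LINT t|\<mu>. indicator B t * (t * (h t * orthopoly b t i)))"
    if i: "i < j" for i
  proof -
    have "(LINT t|\<sigma> (\<lambda>n. x n + unit_seq i n). indicator B t * t) -
        (LINT t|\<sigma> (\<lambda>n. x n - unit_seq i n). indicator B t * t) =
        (LINT t|\<mu>. indicator B t * (t * (4 * (h t * orthopoly b t i))))"
    proof (rule integral_signed_identity[where R = R])
      show "finite_measure (\<sigma> (\<lambda>n. x n + unit_seq i n))" "finite_measure (\<sigma> (\<lambda>n. x n - unit_seq i n))"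
        by (intro finite_measure_\<sigma> ell2_add ell2_diff x unit_seq_ell2)+
      show "integrable \<mu> (\<lambda>t. indicator B t * (4 * (h t * orthopoly b t i)))"
        by (intro integrable_bounded_support[OF less.prems] continuous_intros h) (rule b_nz)
      show "(\<lambda>t. 4 * (h t * orthopoly b t i)) \<in> borel_measurable borel"
        by (intro borel_measurable_continuous_onI continuous_intros h) (rule b_nz)
      fix C :: "real set" assume C: "C \<in> sets borel" "C \<subseteq> B"
      have "rip (E C x) (unit_seq i) = (LINT t|\<mu>. indicator C t * (h t * orthopoly b t i))"
        using C less.prems by (intro less.IH[OF i, of C R]) auto
      then show "measure (\<sigma> (\<lambda>n. x n + unit_seq i n)) C - measure (\<sigma> (\<lambda>n. x n - unit_seq i n)) C =
          (LINT t|\<mu>. indicator C t * (4 * (h t * orthopoly b t i)))"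
        unfolding measure_\<sigma>_polar[OF x unit_seq_ell2 C(1)]
        by (simp only: mult.left_commute[of _ 4] integral_mult_right_zero)
    qed (use less.prems in auto)
    then show ?thesis
      using rip_E_T[OF less.prems x unit_seq_domain, of i]
      by (simp only: mult.left_commute[of _ 4] integral_mult_right_zero)
  qed
  have Ex: "E B x \<in> ell2" using x less.prems by (intro E_ell2)
  consider "j = 0" | "j = 1" | i where "j = Suc (Suc i)"
    by (metis One_nat_def not0_implies_Suc)
  then show ?case
  proof cases
    case 1
    then show ?thesis using 0[OF less.prems] by (simp add: unit_seq_0)
  next
    case 2
    have "b 0 * rip (E B x) (unit_seq 1) = (LINT t|\<mu>. indicator B t * (t * h t))"
      using step[of 0] Ex unfolding jacobi_op_unit_seq by (simp add: 2 rip_scale_right)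
    also have "\<dots> = (LINT t|\<mu>. b 0 * (indicator B t * (h t * orthopoly b t 1)))"
      using b_nz by (intro Bochner_Integration.integral_cong) auto
    finally show ?thesis
      unfolding integral_mult_right_zero mult_left_cancel[OF b_nz] 2 .
  next
    case 3
    have int: "integrable \<mu> (\<lambda>t. indicator B t * (h t * orthopoly b t k))" for k
      by (intro integrable_bounded_support[OF less.prems] cont)
    have int': "integrable \<mu> (\<lambda>t. indicator B t * (t * (h t * orthopoly b t k)))" for k
      by (intro integrable_bounded_support[OF less.prems] continuous_intros cont)
    have "rip (E B x) (T (unit_seq (Suc i))) =
        b (Suc i) * rip (E B x) (unit_seq j) + b i * rip (E B x) (unit_seq i)"
      unfolding jacobi_op_unit_seq 3 using Ex ell2_lincomb[of "unit_seq _" "unit_seq _" _ 0]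
      by (subst rip_add_right) (auto simp: rip_scale_right)
    then have "b (Suc i) * rip (E B x) (unit_seq j) =
        (LINT t|\<mu>. indicator B t * (t * (h t * orthopoly b t (Suc i)))) -
        b i * (LINT t|\<mu>. indicator B t * (h t * orthopoly b t i))"
      using step[of "Suc i"] less.IH[of i B R] less.prems by (simp add: 3)
    also have "\<dots> = (LINT t|\<mu>. indicator B t * (t * (h t * orthopoly b t (Suc i))) -
        b i * (indicator B t * (h t * orthopoly b t i)))"
      using int int' by simp
    also have "\<dots> = (LINT t|\<mu>. b (Suc i) * (indicator B t * (h t * orthopoly b t j)))"
    proof (rule Bochner_Integration.integral_cong[OF refl])
      fix t
      have "b (Suc i) * orthopoly b t j = t * orthopoly b t (Suc i) - b i * orthopoly b t i"
        using orthopoly_rec[where b = b and n = i and z = t, OF b_nz] by (simp add: 3)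
      then have "indicator B t * h t * (b (Suc i) * orthopoly b t j) =
          indicator B t * h t * (t * orthopoly b t (Suc i) - b i * orthopoly b t i)" by simp
      then show "indicator B t * (t * (h t * orthopoly b t (Suc i))) -
          b i * (indicator B t * (h t * orthopoly b t i)) =
          b (Suc i) * (indicator B t * (h t * orthopoly b t j))" by (simp add: algebra_simps)
    qed
    finally show ?thesis
      unfolding integral_mult_right_zero mult_left_cancel[OF b_nz] .
  qed
qed

lemma rip_E_unit_seq:
  assumes B: "B \<in> sets borel" "B \<subseteq> {-R..R}"
  shows "rip (E B (unit_seq i)) (unit_seq j) =
    (LINT t|\<mu>. indicator B t * (orthopoly b t i * orthopoly b t j))"
proof -
  have e0: "rip (E B e0) (unit_seq j) = (LINT t|\<mu>. indicator B t * orthopoly b t j)"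
    if "B \<in> sets borel" "B \<subseteq> {-R..R}" for B R j
    using rip_E_unit_seq_step[OF e0_ell2, of "\<lambda>_. 1" B R j] that
    by (auto simp: measure_\<sigma>[symmetric] e0_ell2)
  show ?thesis
  proof (rule rip_E_unit_seq_step[OF _ _ _ B])
    fix C :: "real set" and R :: real assume C: "C \<in> sets borel" "C \<subseteq> {-R..R}"
    have "rip (E C (unit_seq i)) e0 = rip (E C e0) (unit_seq i)"
      using C E_sym[of C "unit_seq i" e0] rip_commute[of "unit_seq i" "E C e0"] by (simp add: e0_ell2 E_ell2)
    then show "rip (E C (unit_seq i)) e0 = (LINT t|\<mu>. indicator C t * orthopoly b t i)"
      using e0[OF C] by simp
  qed (use b_nz in \<open>auto intro: continuous_intros\<close>)
qed

text \<open>
  Exhausting the line by bounded intervals yields first the square integrability of each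
  polynomial, by monotone convergence, and then the orthogonality relations.
\<close>

lemma orthonormal: "orthonormal_for b \<mu>"
proof -
  interpret finite_measure \<mu> by (rule finite_measure_\<sigma>[OF e0_ell2])
  have [measurable]: "(\<lambda>t. orthopoly b t i) \<in> borel_measurable borel" for i :: nat
    using b_nz by (intro borel_measurable_continuous_onI continuous_intros)
  define B :: "nat \<Rightarrow> real set" where "B n = {- real n..real n}" for n
  have B: "B n \<in> sets borel" "B n \<subseteq> {- real n..real n}" for n by (auto simp: B_def)
  have B_UN: "(\<Union>n. B n) = UNIV"
    by (auto simp: B_def) (metis abs_le_D1 abs_le_D2 minus_le_iff real_nat_ceiling_ge)
  have B_mono: "incseq B" by (auto simp: B_def incseq_def)
  have ind_lim: "(\<lambda>n. indicator (B n) t :: real) \<longlonglongrightarrow> 1" for t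
    using LIMSEQ_indicator_incseq[OF B_mono, of t] unfolding B_UN by simp
  have lim: "(\<lambda>n. rip (E (B n) (unit_seq i)) (unit_seq j)) \<longlonglongrightarrow> (if i = j then 1 else 0)" for i j
  proof -
    have m: "(\<lambda>n. measure (\<sigma> x) (B n)) \<longlonglongrightarrow> rip x x" if x: "x \<in> ell2" for x
    proof -
      interpret f: finite_measure "\<sigma> x" by (rule finite_measure_\<sigma>[OF x])
      have "(\<lambda>n. measure (\<sigma> x) (B n)) \<longlonglongrightarrow> measure (\<sigma> x) (\<Union>n. B n)"
        by (rule f.finite_Lim_measure_incseq[OF _ B_mono]) (use B in auto)
      then show ?thesis unfolding B_UN using x by (simp add: measure_\<sigma> E_UNIV)
    qed
    let ?p = "\<lambda>n. unit_seq i n + unit_seq j n" and ?m = "\<lambda>n. unit_seq i n - unit_seq j n"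
    have "(\<lambda>n. (measure (\<sigma> ?p) (B n) - measure (\<sigma> ?m) (B n)) / 4) \<longlonglongrightarrow> (rip ?p ?p - rip ?m ?m) / 4"
      by (intro tendsto_intros m ell2_add ell2_diff unit_seq_ell2) auto
    also have "(rip ?p ?p - rip ?m ?m) / 4 = (if i = j then 1 else 0)"
      by (simp add: rip_add_left rip_add_right rip_diff_left rip_diff_right ell2_add ell2_diff rip_unit_seq)
    finally show ?thesis by (simp add: measure_\<sigma>_polar B)
  qed
  have sq: "integrable \<mu> (\<lambda>t. (orthopoly b t i)\<^sup>2)" for i
  proof (rule integrable_monotone_convergence[where f = "\<lambda>n t. indicator (B n) t * (orthopoly b t i)\<^sup>2" and x = 1])
    show "integrable \<mu> (\<lambda>t. indicator (B n) t * (orthopoly b t i)\<^sup>2)" for n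
      using b_nz by (intro integrable_bounded_support[OF B] continuous_intros)
    show "AE t in \<mu>. mono (\<lambda>n. indicator (B n) t * (orthopoly b t i)\<^sup>2)"
      using B_mono by (intro AE_I2 monoI mult_right_mono) (auto simp: indicator_def incseq_def)
    show "AE t in \<mu>. (\<lambda>n. indicator (B n) t * (orthopoly b t i)\<^sup>2) \<longlonglongrightarrow> (orthopoly b t i)\<^sup>2"
      using tendsto_mult_right[OF ind_lim] by (intro AE_I2) force
    show "(\<lambda>n. LINT t|\<mu>. indicator (B n) t * (orthopoly b t i)\<^sup>2) \<longlonglongrightarrow> 1"
      using lim[of i i] by (simp add: rip_E_unit_seq[OF B] power2_eq_square)
  qed measurable
  show ?thesis unfolding orthonormal_for_def
  proof (intro allI conjI)
    fix i j
    show int: "integrable \<mu> (\<lambda>t. orthopoly b t i * orthopoly b t j)"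
    proof (rule Bochner_Integration.integrable_bound)
      show "integrable \<mu> (\<lambda>t. (orthopoly b t i)\<^sup>2 + (orthopoly b t j)\<^sup>2)"
        by (intro Bochner_Integration.integrable_add sq)
      have "\<bar>u * v\<bar> \<le> u\<^sup>2 + v\<^sup>2" for u v :: real
        using sum_squares_bound[of "\<bar>u\<bar>" "\<bar>v\<bar>"] abs_ge_zero[of "u * v"] unfolding abs_mult by (simp; linarith)
      then show "AE t in \<mu>. norm (orthopoly b t i * orthopoly b t j) \<le> norm ((orthopoly b t i)\<^sup>2 + (orthopoly b t j)\<^sup>2)"
        by (intro AE_I2) simp
    qed measurable
    have "(\<lambda>n. LINT t|\<mu>. indicator (B n) t * (orthopoly b t i * orthopoly b t j)) \<longlonglongrightarrow>
        (LINT t|\<mu>. orthopoly b t i * orthopoly b t j)"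
    proof (rule integral_dominated_convergence[where w = "\<lambda>t. norm (orthopoly b t i * orthopoly b t j)"])
      show "AE t in \<mu>. (\<lambda>n. indicator (B n) t * (orthopoly b t i * orthopoly b t j)) \<longlonglongrightarrow> orthopoly b t i * orthopoly b t j"
        using tendsto_mult_right[OF ind_lim] by (intro AE_I2) force
      show "AE t in \<mu>. norm (indicator (B n) t * (orthopoly b t i * orthopoly b t j)) \<le>
          norm (orthopoly b t i * orthopoly b t j)" for n
        by (intro AE_I2) (auto simp: indicator_def)
    qed (use int in \<open>auto simp: B_def\<close>)
    then show "(LINT t|\<mu>. orthopoly b t i * orthopoly b t j) = (if i = j then 1 else 0)"
      using lim[of i j] LIMSEQ_unique by (fastforce simp: rip_E_unit_seq[OF B])
  qed
qed

end

section \<open>The Poisson formula for the upper half-plane\<close>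

text \<open>
  The Poisson kernel of the upper half-plane at the point \<open>x + \<i> * y\<close>, multiplied by \<open>\<pi>\<close>.
\<close>

abbreviation poisson :: "real \<Rightarrow> real \<Rightarrow> real \<Rightarrow> real" where
  "poisson x y t \<equiv> y / ((t - x)\<^sup>2 + y\<^sup>2)"

lemma has_integral_poisson_kernel:
  fixes x y :: real
  assumes "y > 0" "a \<le> c"
  shows "((\<lambda>t. poisson x y t) has_integral
    (arctan ((c - x) / y) - arctan ((a - x) / y))) {a..c}"
proof (rule fundamental_theorem_of_calculus[OF assms(2)])
  fix t assume "t \<in> {a..c}"
  have "((\<lambda>t. arctan ((t - x) / y)) has_real_derivative (1 / y) * inverse (1 + ((t - x) / y)\<^sup>2)) (at t within {a..c})"
    using assms by (auto intro!: derivative_eq_intros simp: field_simps)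
  also have "(1 / y) * inverse (1 + ((t - x) / y)\<^sup>2) = poisson x y t"
  proof -
    have "y\<^sup>2 + (t - x)\<^sup>2 \<noteq> 0" using assms by (simp add: sum_power2_eq_zero_iff)
    then show ?thesis using assms by (simp add: field_simps power2_eq_square)
  qed
  finally show "((\<lambda>t. arctan ((t - x) / y)) has_vector_derivative poisson x y t) (at t within {a..c})"
    by (simp add: has_real_derivative_iff_has_vector_derivative)
qed

text \<open>
  Cauchy's theorem on a half-disc for the function \<open>(h z - h a) / ((z - a) * (z - cnj a))\<close>: the
  numerator removes the pole at \<open>a\<close>, the other pole lies in the lower half-plane, and the decay is
  quadratic because \<open>h\<close> is bounded near infinity, so that the arc contributes \<open>O(1 / R)\<close>. On the
  real axis the denominator is \<open>\<bar>t - a\<bar>\<^sup>2\<close>, which is the Poisson kernel up to the factor \<open>Im a\<close>.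
\<close>

lemma half_plane_contour:
  fixes h :: "complex \<Rightarrow> complex" and a :: complex
  assumes h: "h holomorphic_on {z. Im z \<ge> 0}"
    and C: "\<And>z. Im z \<ge> 0 \<Longrightarrow> cmod z \<ge> R0 \<Longrightarrow> cmod (h z) \<le> C"
    and a: "Im a > 0" and R: "R \<ge> R0" "R > 2 * cmod a" "R > 0"
  obtains I where "((\<lambda>t. (h (of_real t) - h a) / of_real ((cmod (of_real t - a))\<^sup>2)) has_integral I) {-R..R}"
    and "cmod I \<le> 4 * pi * (C + cmod (h a)) / R"
proof -
  define H where "H = {z :: complex. Im z \<ge> 0}"
  have H: "convex H" "interior H = {z. Im z > 0}"
    using convex_halfspace_Im_ge[of 0] interior_halfspace_ge[of \<i> 0]
    by (simp_all add: H_def inner_complex_def)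
  define F where "F z = (if z = a then deriv h a else (h z - h a) / (z - a)) / (z - cnj a)" for z
  have F: "F holomorphic_on H"
  proof -
    have "(\<lambda>z. if z = a then deriv h a else (h z - h a) / (z - a)) holomorphic_on H"
      using h a H by (intro pole_lemma) (auto simp: H_def)
    then show ?thesis unfolding F_def using a by (intro holomorphic_intros) (auto simp: H_def)
  qed
  define L where "L = linepath (of_real (-R) :: complex) (of_real R)"
  define P where "P = part_circlepath 0 R 0 pi"
  have R0: "R \<ge> 0" using R by simp
  have pathL: "path_image L \<subseteq> H" unfolding L_def
    using H(1) by (intro path_image_linepath[THEN equalityD1, THEN order_trans] closed_segment_subset) (auto simp: H_def)
  have pathP: "Im z \<ge> 0" "cmod z = R" if "z \<in> path_image P" for z
  proof -
    from that R0 obtain t where t: "0 \<le> t" "t \<le> pi" "z = of_real R * exp (\<i> * of_real t)"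
      unfolding P_def by (auto simp: path_image_part_circlepath)
    have "Im z = R * sin t" by (simp add: t Im_exp)
    moreover have "sin t \<ge> 0" using t by (intro sin_ge_zero)
    ultimately show "Im z \<ge> 0" using R0 by (metis mult_nonneg_nonneg)
    show "cmod z = R" using R0 by (simp add: t norm_mult)
  qed
  have pathP': "path_image P \<subseteq> H" using pathP(1) unfolding H_def by blast
  have ends: "pathfinish L = pathstart P" "pathfinish P = pathstart L"
    by (simp_all add: L_def P_def exp_Euler)
  have vL: "valid_path L" and vP: "valid_path P" by (simp_all add: L_def P_def)
  have "(F has_contour_integral 0) (L +++ P)"
  proof (rule Cauchy_theorem_convex[of H F "{}"])
    show "continuous_on H F" using F by (rule holomorphic_on_imp_continuous_on)
    show "F field_differentiable at x" if "x \<in> interior H - {}" for x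
      using F that by (metis DiffD1 holomorphic_on_imp_differentiable_at holomorphic_on_subset interior_subset open_interior)
    show "path_image (L +++ P) \<subseteq> H"
      using pathL pathP by (auto simp: path_image_join[OF ends(1)] H_def)
  qed (use H vL vP ends in auto)
  moreover have cL: "F contour_integrable_on L"
    unfolding L_def
    by (rule contour_integrable_continuous_linepath)
       (rule continuous_on_subset[OF holomorphic_on_imp_continuous_on[OF F] pathL[unfolded L_def path_image_linepath]])
  moreover have cP: "F contour_integrable_on P"
    unfolding P_def
    by (rule contour_integrable_continuous_part_circlepath)
       (rule continuous_on_subset[OF holomorphic_on_imp_continuous_on[OF F] pathP'[unfolded P_def]])
  ultimately have sum0: "contour_integral L F + contour_integral P F = 0"
    using has_contour_integral_join[OF has_contour_integral_integral[OF cL] has_contour_integral_integral[OF cP] vL vP]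
      has_contour_integral_unique by blast
  have "cmod (contour_integral P F) \<le> (4 * (C + cmod (h a)) / R\<^sup>2) * R * \<bar>pi - 0\<bar>"
    unfolding P_def
  proof (rule contour_integral_bound_part_circlepath)
    show "F contour_integrable_on part_circlepath 0 R 0 pi" using cP by (simp add: P_def)
    show "0 \<le> R" by (rule R0)
    have "0 \<le> cmod (h (of_real R))" by simp
    also have "\<dots> \<le> C" using R by (intro C) auto
    finally have C0: "C \<ge> 0" .
    then show "0 \<le> 4 * (C + cmod (h a)) / R\<^sup>2" by simp
    fix z assume "z \<in> path_image (part_circlepath 0 R 0 pi)"
    then have z: "Im z \<ge> 0" "cmod z = R" using pathP by (auto simp: P_def)
    have za: "cmod (z - a) \<ge> R / 2" "cmod (z - cnj a) \<ge> R / 2"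
      using norm_triangle_ineq2[of z a] norm_triangle_ineq2[of z "cnj a"] z R by auto
    have "z \<noteq> a" using za R by auto
    then have "cmod (F z) = cmod (h z - h a) / (cmod (z - a) * cmod (z - cnj a))"
      by (simp add: F_def norm_divide norm_mult)
    also have "\<dots> \<le> (C + cmod (h a)) / (R / 2 * (R / 2))"
    proof (intro frac_le mult_mono za)
      show "cmod (h z - h a) \<le> C + cmod (h a)"
        using norm_triangle_ineq4[of "h z" "h a"] C[OF z(1)] z R by simp
    qed (use R C0 in auto)
    also have "\<dots> = 4 * (C + cmod (h a)) / R\<^sup>2" by (simp add: power2_eq_square)
    finally show "cmod (F z) \<le> 4 * (C + cmod (h a)) / R\<^sup>2" .
  qed
  also have "\<dots> = 4 * pi * (C + cmod (h a)) / R" using R by (simp add: field_simps power2_eq_square)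
  finally have b: "cmod (contour_integral L F) \<le> 4 * pi * (C + cmod (h a)) / R"
    using sum0 by (metis add_eq_0_iff norm_minus_cancel)
  have "(F has_contour_integral contour_integral L F) (linepath (of_real (-R)) (of_real R))"
    using cL has_contour_integral_integral unfolding L_def by blast
  then have "((\<lambda>t. F (of_real t)) has_integral contour_integral L F) {-R..R}"
    using R by (subst (asm) has_contour_integral_linepath_Reals_iff) auto
  moreover have "F (of_real t) = (h (of_real t) - h a) / of_real ((cmod (of_real t - a))\<^sup>2)" for t
  proof -
    have "of_real t \<noteq> a" using a by auto
    moreover have "(of_real t - a) * (of_real t - cnj a) = of_real ((cmod (of_real t - a))\<^sup>2)"
      by (metis complex_cnj_complex_of_real complex_cnj_diff complex_norm_square of_real_power)
    ultimately show ?thesis by (simp add: F_def)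
  qed
  ultimately show ?thesis using b by (intro that) auto
qed

lemma tendsto_arctan_affine_at_top:
  fixes x y :: real
  assumes "y > 0"
  shows "((\<lambda>R. arctan ((R - x) / y)) \<longlongrightarrow> pi / 2) at_top"
proof (rule filterlim_compose[OF tendsto_arctan_at_top])
  have "filterlim (\<lambda>R. (1 / y) * (- x + R)) at_top at_top"
    using assms by (intro filterlim_tendsto_pos_mult_at_top[OF tendsto_const]
        filterlim_tendsto_add_at_top[OF tendsto_const] filterlim_ident) auto
  moreover have "(\<lambda>R. (1 / y) * (- x + R)) = (\<lambda>R. (R - x) / y)" by (auto simp: field_simps)
  ultimately show "filterlim (\<lambda>R. (R - x) / y) at_top at_top" by simp
qed

text \<open>
  Nonnegativity of the boundary values replaces an integrability assumption: the symmetric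
  integrals over \<open>{-n..n}\<close> increase and converge by \<open>half_plane_contour\<close>.
\<close>

lemma poisson_half_plane:
  fixes h :: "complex \<Rightarrow> complex" and x y :: real
  assumes h: "h holomorphic_on {z. Im z \<ge> 0}"
    and C: "\<And>z. Im z \<ge> 0 \<Longrightarrow> cmod z \<ge> R0 \<Longrightarrow> cmod (h z) \<le> C"
    and pos: "\<And>t. Im (h (of_real t)) \<ge> 0" and y: "y > 0"
  shows "integrable lborel (\<lambda>t. Im (h (of_real t)) * poisson x y t)"
    and "(LINT t|lborel. Im (h (of_real t)) * poisson x y t) = pi * Im (h (Complex x y))"
proof -
  define a where "a = Complex x y"
  define g where "g t = Im (h (of_real t)) * poisson x y t" for t :: real
  have den: "(t - x)\<^sup>2 + y\<^sup>2 > 0" for t using y by (simp add: sum_power2_gt_zero_iff)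
  have g0: "g t \<ge> 0" for t using pos[of t] y den[of t] by (simp add: g_def)
  have norm: "(cmod (of_real t - a))\<^sup>2 = (t - x)\<^sup>2 + y\<^sup>2" for t
    by (simp add: a_def cmod_power2)
  have cont_h: "continuous_on UNIV (\<lambda>t::real. h (of_real t))"
    by (rule continuous_on_compose2[OF holomorphic_on_imp_continuous_on[OF h]]) (auto intro!: continuous_intros)
  have cont: "continuous_on UNIV g"
    unfolding g_def using den by (intro continuous_intros cont_h) (metis less_irrefl)+
  have [measurable]: "g \<in> borel_measurable borel" by (rule borel_measurable_continuous_onI[OF cont])
  define A where "A n = Im (h a) * (arctan ((real n - x) / y) - arctan ((- real n - x) / y))" for n :: nat
  have "\<exists>R1. \<forall>n\<ge>R1. \<exists>J. (g has_integral J) {-real n..real n} \<and>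
      \<bar>J - A n\<bar> \<le> y * (4 * pi * (C + cmod (h a)) / real n)"
  proof -
    define R1 where "R1 = nat \<lceil>max R0 (2 * cmod a)\<rceil> + 1"
    show ?thesis
    proof (intro exI[of _ R1] allI impI)
      fix n assume n: "n \<ge> R1"
      have "real n > max R0 (2 * cmod a)" using n unfolding R1_def by linarith
      then have nR: "real n \<ge> R0" "real n > 2 * cmod a" by auto
      have "real n > 0" using nR(2) norm_ge_zero[of a] by linarith
      obtain I where I: "((\<lambda>t. (h (of_real t) - h a) / of_real ((cmod (of_real t - a))\<^sup>2)) has_integral I) {-real n..real n}"
        "cmod I \<le> 4 * pi * (C + cmod (h a)) / real n"
        using half_plane_contour[OF h C _ nR \<open>real n > 0\<close>] y by (auto simp: a_def)
      have 1: "((\<lambda>t. Im ((h (of_real t) - h a) / of_real ((cmod (of_real t - a))\<^sup>2))) has_integral Im I) {-real n..real n}"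
        using has_integral_linear[OF I(1) bounded_linear_Im] by (simp add: o_def)
      have 2: "((\<lambda>t. y * Im ((h (of_real t) - h a) / of_real ((cmod (of_real t - a))\<^sup>2)) + Im (h a) * poisson x y t)
          has_integral (y * Im I + A n)) {-real n..real n}"
        unfolding A_def using y by (intro has_integral_add has_integral_mult_right 1 has_integral_poisson_kernel) auto
      have "y * Im ((h (of_real t) - h a) / of_real ((cmod (of_real t - a))\<^sup>2)) + Im (h a) * poisson x y t = g t" for t
        unfolding norm Im_divide_of_real g_def
        by (simp add: add_divide_distrib diff_divide_distrib algebra_simps)
      with 2 have "(g has_integral (y * Im I + A n)) {-real n..real n}"
        by simp
      moreover have "\<bar>y * Im I\<bar> \<le> y * (4 * pi * (C + cmod (h a)) / real n)"
        unfolding abs_mult using y I(2) abs_Im_le_cmod[of I] by (intro mult_mono) auto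
      ultimately show "\<exists>J. (g has_integral J) {-real n..real n} \<and>
        \<bar>J - A n\<bar> \<le> y * (4 * pi * (C + cmod (h a)) / real n)"
        by (intro exI conjI) auto
    qed
  qed
  then obtain R1 where R1: "\<And>n. n \<ge> R1 \<Longrightarrow> \<exists>J. (g has_integral J) {-real n..real n} \<and>
      \<bar>J - A n\<bar> \<le> y * (4 * pi * (C + cmod (h a)) / real n)"
    by blast
  have int_n: "integrable lborel (\<lambda>t. indicator {-real n..real n} t * g t)"
    and eq_n: "(LINT t|lborel. indicator {-real n..real n} t * g t) = integral {-real n..real n} g" for n
  proof -
    have s: "set_integrable lborel {-real n..real n} g"
      by (rule borel_integrable_atLeastAtMost') (rule continuous_on_subset[OF cont], simp)
    then show "integrable lborel (\<lambda>t. indicator {-real n..real n} t * g t)" by (simp add: set_integrable_def)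
    show "(LINT t|lborel. indicator {-real n..real n} t * g t) = integral {-real n..real n} g"
      using set_borel_integral_eq_integral(2)[OF s] by (simp add: set_lebesgue_integral_def)
  qed
  have A_lim: "A \<longlonglongrightarrow> pi * Im (h a)"
  proof -
    have "(\<lambda>n. arctan ((real n - x) / y)) \<longlonglongrightarrow> pi / 2" "(\<lambda>n. arctan ((real n - (- x)) / y)) \<longlonglongrightarrow> pi / 2"
      by (rule filterlim_compose[OF tendsto_arctan_affine_at_top[OF y] filterlim_real_sequentially])+
    moreover have "arctan ((- real n - x) / y) = - arctan ((real n - (- x)) / y)" for n
      by (simp add: arctan_minus[symmetric] minus_divide_left)
    ultimately have "A \<longlonglongrightarrow> Im (h a) * (pi / 2 - (- (pi / 2)))"
      unfolding A_def by (intro tendsto_intros) (simp_all add: tendsto_minus)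
    then show ?thesis by (simp add: mult.commute)
  qed
  have lim: "(\<lambda>n. integral {-real n..real n} g) \<longlonglongrightarrow> pi * Im (h a)"
  proof -
    have "(\<lambda>n. integral {-real n..real n} g - A n) \<longlonglongrightarrow> 0"
    proof (rule Lim_null_comparison)
      show "\<forall>\<^sub>F n in sequentially. norm (integral {-real n..real n} g - A n) \<le> y * (4 * pi * (C + cmod (h a)) / real n)"
        using eventually_ge_at_top[of R1]
      proof eventually_elim
        case (elim n)
        then obtain J where "(g has_integral J) {-real n..real n}" "\<bar>J - A n\<bar> \<le> y * (4 * pi * (C + cmod (h a)) / real n)"
          using R1[of n] unfolding A_def by blast
        then show ?case by (simp add: integral_unique)
      qed
      show "(\<lambda>n. y * (4 * pi * (C + cmod (h a)) / real n)) \<longlonglongrightarrow> 0"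
        using tendsto_mult_right_zero[OF lim_const_over_n[of "4 * pi * (C + cmod (h a))"], of y] by simp
    qed
    from tendsto_add[OF this A_lim] show ?thesis by simp
  qed
  have mono: "AE t in lborel. mono (\<lambda>n::nat. indicator {-real n..real n} t * g t)"
    using g0 by (intro AE_I2 monoI mult_right_mono) (auto simp: indicator_def)
  have ptw: "AE t in lborel. (\<lambda>n::nat. indicator {-real n..real n} t * g t) \<longlonglongrightarrow> g t"
  proof (rule AE_I2)
    fix t
    have "\<forall>\<^sub>F n in sequentially. indicator {-real n..real n} t * g t = g t"
      using eventually_ge_at_top[of "nat \<lceil>\<bar>t\<bar>\<rceil>"] 
    proof eventually_elim
      case (elim n)
      then have "\<bar>t\<bar> \<le> real n" by linarith
      then show ?case by (simp add: indicator_def abs_le_iff)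
    qed
    then show "(\<lambda>n::nat. indicator {-real n..real n} t * g t) \<longlonglongrightarrow> g t" by (rule tendsto_eventually)
  qed
  have lim': "(\<lambda>n::nat. LINT t|lborel. indicator {-real n..real n} t * g t) \<longlonglongrightarrow> pi * Im (h a)"
    unfolding eq_n by (rule lim)
  have "integrable lborel g"
    by (rule integrable_monotone_convergence[OF int_n mono ptw lim']) simp
  then show "integrable lborel (\<lambda>t. Im (h (of_real t)) * poisson x y t)"
    by (simp only: g_def[abs_def])
  have "(LINT t|lborel. g t) = pi * Im (h a)"
    by (rule integral_monotone_convergence[OF int_n mono ptw lim']) simp
  then show "(LINT t|lborel. Im (h (of_real t)) * poisson x y t) = pi * Im (h (Complex x y))"
    by (simp only: g_def a_def)
qed

section \<open>Weyl solutions and the shrinking of the Weyl disc\<close>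

lemma holomorphic_on_jacobi_solution [holomorphic_intros]:
  assumes "\<And>n. b n \<noteq> 0" "u holomorphic_on S" "v holomorphic_on S"
  shows "(\<lambda>z. jacobi_solution b z (u z) (v z) n) holomorphic_on S"
proof (induction n rule: induct_nat_012)
  case (ge2 n)
  then show ?case
    using assms by (auto intro!: holomorphic_intros)
qed (use assms in simp_all)

text \<open>
  A formal solution of \<open>(J - z) w = c * e\<^sub>0\<close> for the Jacobi matrix \<open>J\<close>. With \<open>c = 1\<close> and \<open>w\<close>
  square summable this is the resolvent applied to \<open>e\<^sub>0\<close>, and \<open>w 0\<close> is the Weyl function; \<open>c = 0\<close>
  covers the orthogonal polynomials.
\<close>

definition weyl_solution :: "(nat \<Rightarrow> real) \<Rightarrow> real \<Rightarrow> complex \<Rightarrow> (nat \<Rightarrow> complex) \<Rightarrow> bool" where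
  "weyl_solution b c z w \<longleftrightarrow> of_real (b 0) * w 1 = z * w 0 + of_real c \<and>
     (\<forall>n. of_real (b (Suc n)) * w (Suc (Suc n)) = z * w (Suc n) - of_real (b n) * w n)"

lemma weyl_solution_orthopoly: "(\<And>n. b n \<noteq> 0) \<Longrightarrow> weyl_solution b 0 z (orthopoly b z)"
  by (auto simp: weyl_solution_def orthopoly_rec)

lemma weyl_solution_second: "(\<And>n. b n \<noteq> 0) \<Longrightarrow>
    weyl_solution b 1 z (\<lambda>n. secondpoly b z n + m * orthopoly b z n)"
  unfolding weyl_solution_def
proof (intro conjI allI)
  assume b: "\<And>n. b n \<noteq> 0"
  show "of_real (b 0) * (secondpoly b z 1 + m * orthopoly b z 1) =
      z * (secondpoly b z 0 + m * orthopoly b z 0) + of_real 1"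
    using b[of 0] by (simp add: field_simps)
  fix n
  have P: "of_real (b (Suc n)) * orthopoly b z (Suc (Suc n)) = z * orthopoly b z (Suc n) - of_real (b n) * orthopoly b z n"
    and Q: "of_real (b (Suc n)) * secondpoly b z (Suc (Suc n)) = z * secondpoly b z (Suc n) - of_real (b n) * secondpoly b z n"
    by (rule orthopoly_rec secondpoly_rec, rule b)+
  have "of_real (b (Suc n)) * (secondpoly b z (Suc (Suc n)) + m * orthopoly b z (Suc (Suc n))) =
     of_real (b (Suc n)) * secondpoly b z (Suc (Suc n)) + m * (of_real (b (Suc n)) * orthopoly b z (Suc (Suc n)))"
    by (simp only: algebra_simps)
  also have "\<dots> = z * (secondpoly b z (Suc n) + m * orthopoly b z (Suc n)) -
      of_real (b n) * (secondpoly b z n + m * orthopoly b z n)"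
    unfolding P Q by (simp add: algebra_simps)
  finally show "of_real (b (Suc n)) * (secondpoly b z (Suc (Suc n)) + m * orthopoly b z (Suc (Suc n))) = \<dots>" .
qed

lemma weyl_solution_unique:
  assumes b: "\<And>n. b n \<noteq> 0" and "weyl_solution b c z w" "weyl_solution b c z w'" "w 0 = w' 0"
  shows "w n = w' n"
proof (induction n rule: induct_nat_012)
  case 1
  have "of_real (b 0) * w 1 = of_real (b 0) * w' 1"
    using assms by (simp add: weyl_solution_def)
  then show ?case using b[of 0] by simp
next
  case (ge2 n)
  have "of_real (b (Suc n)) * w (Suc (Suc n)) = of_real (b (Suc n)) * w' (Suc (Suc n))"
    using assms ge2 by (simp add: weyl_solution_def)
  then show ?case using b[of "Suc n"] by simp
qed (use assms in simp)

lemma weyl_solution_eq: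
  assumes b: "\<And>n. b n \<noteq> 0" and "weyl_solution b 1 z w"
  shows "w n = secondpoly b z n + w 0 * orthopoly b z n"
  by (rule weyl_solution_unique[OF b assms(2) weyl_solution_second[OF b]]) simp

lemma weyl_wronskian:
  assumes b: "\<And>n. b n \<noteq> 0" and w: "weyl_solution b 1 z w"
  shows "of_real (b n) * (orthopoly b z n * w (Suc n) - orthopoly b z (Suc n) * w n) = 1"
proof -
  have "of_real (b n) * (orthopoly b z n * w (Suc n) - orthopoly b z (Suc n) * w n) =
    of_real (b n) * (orthopoly b z n * secondpoly b z (Suc n) - orthopoly b z (Suc n) * secondpoly b z n)"
    unfolding weyl_solution_eq[OF b w, of n] weyl_solution_eq[OF b w, of "Suc n"]
    by (simp add: algebra_simps)
  also have "\<dots> = 1" by (rule wronskian) (rule b)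
  finally show ?thesis .
qed

abbreviation square_sum :: "(nat \<Rightarrow> complex) \<Rightarrow> nat \<Rightarrow> real" where
  "square_sum w N \<equiv> \<Sum>n\<le>N. (cmod (w n))\<^sup>2"

text \<open>
  Green's formula for \<open>w\<close> and its complex conjugate.
\<close>

lemma weyl_green:
  assumes "weyl_solution b c z w"
  shows "Im z * square_sum w N = c * Im (w 0) + b N * Im (w (Suc N) * cnj (w N))"
proof (induction N)
  case 0
  have e: "of_real (b 0) * w 1 = z * w 0 + of_real c" using assms by (simp add: weyl_solution_def)
  have "b 0 * Im (w 1 * cnj (w 0)) = Im ((of_real (b 0) * w 1) * cnj (w 0))" by (simp add: algebra_simps)
  also have "\<dots> = Im z * (cmod (w 0))\<^sup>2 - c * Im (w 0)"
    unfolding e cmod_power2 by (simp add: algebra_simps power2_eq_square)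
  finally show ?case by simp
next
  case (Suc N)
  have e: "of_real (b (Suc N)) * w (Suc (Suc N)) = z * w (Suc N) - of_real (b N) * w N"
    using assms by (simp add: weyl_solution_def)
  have "b (Suc N) * Im (w (Suc (Suc N)) * cnj (w (Suc N))) =
     Im ((of_real (b (Suc N)) * w (Suc (Suc N))) * cnj (w (Suc N)))" by (simp add: algebra_simps)
  also have "\<dots> = Im z * (cmod (w (Suc N)))\<^sup>2 + b N * Im (w (Suc N) * cnj (w N))"
    unfolding e cmod_power2 by (simp add: algebra_simps power2_eq_square)
  finally show ?case using Suc by (simp add: algebra_simps)
qed

text \<open>
  The radius of the Weyl disc is controlled by the sum of \<open>1 / b\<^sub>n\<close>. The difference \<open>d\<close> of two
  solutions is \<open>d 0\<close> times the orthogonal polynomials, so the Wronskian of \<open>d\<close> and \<open>w\<close> is \<open>d 0 / b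
  n\<close> at every site \<open>n\<close>; summed over the sites, it is bounded by the square sums of \<open>d\<close> and \<open>w\<close>.
\<close>

lemma weyl_contraction:
  assumes b: "\<And>n. b n > 0" and w: "weyl_solution b 1 z w" and w': "weyl_solution b 1 z w'"
    and C: "square_sum w N \<le> C" "square_sum w' N \<le> C"
  shows "cmod (w 0 - w' 0) * (\<Sum>n<N. 1 / b n) \<le> 5 * C"
proof -
  have b0: "b n \<noteq> 0" for n using b[of n] by simp
  define d where "d n = w n - w' n" for n
  have d: "d n = d 0 * orthopoly b z n" for n
    unfolding d_def weyl_solution_eq[OF b0 w, of n] weyl_solution_eq[OF b0 w', of n] by (simp add: algebra_simps)
  have step: "cmod (d 0) / b n \<le> ((cmod (d n))\<^sup>2 + (cmod (w (Suc n)))\<^sup>2) / 2 + ((cmod (d (Suc n)))\<^sup>2 + (cmod (w n))\<^sup>2) / 2" for n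
  proof -
    have "of_real (b n) * (d n * w (Suc n) - d (Suc n) * w n) =
      d 0 * (of_real (b n) * (orthopoly b z n * w (Suc n) - orthopoly b z (Suc n) * w n))"
      unfolding d[of n] d[of "Suc n"] by (simp only: algebra_simps)
    also have "\<dots> = d 0" unfolding weyl_wronskian[OF b0 w] by simp
    finally have "cmod (d 0) = b n * cmod (d n * w (Suc n) - d (Suc n) * w n)"
      using b[of n] by (metis abs_of_pos norm_mult norm_of_real)
    then have "cmod (d 0) / b n = cmod (d n * w (Suc n) - d (Suc n) * w n)" using b0[of n] by simp
    also have "\<dots> \<le> cmod (d n) * cmod (w (Suc n)) + cmod (d (Suc n)) * cmod (w n)"
      by (metis norm_mult norm_triangle_ineq4)
    finally show ?thesis
      using sum_squares_bound[of "cmod (d n)" "cmod (w (Suc n))"] sum_squares_bound[of "cmod (d (Suc n))" "cmod (w n)"]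
      unfolding mult.assoc by argo
  qed
  have dC: "square_sum d N \<le> 4 * C"
  proof -
    have "(cmod (d n))\<^sup>2 \<le> 2 * (cmod (w n))\<^sup>2 + 2 * (cmod (w' n))\<^sup>2" for n
    proof -
      have "(cmod (d n))\<^sup>2 \<le> (cmod (w n) + cmod (w' n))\<^sup>2"
        unfolding d_def by (intro power_mono norm_triangle_ineq4) simp
      also have "\<dots> \<le> 2 * (cmod (w n))\<^sup>2 + 2 * (cmod (w' n))\<^sup>2"
        using zero_le_power2[of "cmod (w n) - cmod (w' n)"] by (simp add: power2_sum power2_diff)
      finally show ?thesis .
    qed
    then have "square_sum d N \<le> (\<Sum>n\<le>N. 2 * (cmod (w n))\<^sup>2 + 2 * (cmod (w' n))\<^sup>2)"
      by (intro sum_mono)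
    also have "\<dots> = 2 * square_sum w N + 2 * square_sum w' N"
      by (simp add: sum.distrib sum_distrib_left)
    finally show ?thesis using C by linarith
  qed
  have sub: "(\<Sum>n<N. f n) \<le> (\<Sum>n\<le>N. f n)" "(\<Sum>n<N. f (Suc n)) \<le> (\<Sum>n\<le>N. f n)" if "\<And>n. f n \<ge> 0" for f :: "nat \<Rightarrow> real"
  proof -
    show "(\<Sum>n<N. f n) \<le> (\<Sum>n\<le>N. f n)" using that by (intro sum_mono2) auto
    have "(\<Sum>n<N. f (Suc n)) = (\<Sum>n\<in>Suc ` {..<N}. f n)" by (simp add: sum.reindex)
    also have "\<dots> \<le> (\<Sum>n\<le>N. f n)" using that by (intro sum_mono2) auto
    finally show "(\<Sum>n<N. f (Suc n)) \<le> (\<Sum>n\<le>N. f n)" .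
  qed
  have "cmod (d 0) * (\<Sum>n<N. 1 / b n) = (\<Sum>n<N. cmod (d 0) / b n)" by (simp add: sum_distrib_left)
  also have "\<dots> \<le> (\<Sum>n<N. ((cmod (d n))\<^sup>2 + (cmod (w (Suc n)))\<^sup>2) / 2 + ((cmod (d (Suc n)))\<^sup>2 + (cmod (w n))\<^sup>2) / 2)"
    by (intro sum_mono step)
  also have "\<dots> = (\<Sum>n<N. (cmod (d n))\<^sup>2) / 2 + (\<Sum>n<N. (cmod (w (Suc n)))\<^sup>2) / 2 +
      (\<Sum>n<N. (cmod (d (Suc n)))\<^sup>2) / 2 + (\<Sum>n<N. (cmod (w n))\<^sup>2) / 2"
    by (simp add: sum.distrib sum_divide_distrib add_divide_distrib)
  also have "\<dots> \<le> 5 * C"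
    using sub[of "\<lambda>n. (cmod (d n))\<^sup>2"] sub[of "\<lambda>n. (cmod (w n))\<^sup>2"] dC C by simp
  finally show ?thesis by (simp add: d_def)
qed

section \<open>The Weyl solution of an orthonormalizing measure\<close>

lemma orthonormal_for_mean:
  assumes "orthonormal_for b \<mu>"
  shows "integrable \<mu> (\<lambda>t. orthopoly b t n)" "(LINT t|\<mu>. orthopoly b t n) = (if n = 0 then 1 else 0)"
  using assms[unfolded orthonormal_for_def, rule_format, of n 0] by simp_all

lemma bessel_orthopoly:
  fixes g :: "real \<Rightarrow> real"
  assumes \<mu>: "finite_measure \<mu>" "sets \<mu> = sets borel" and o: "orthonormal_for b \<mu>"
    and g: "g \<in> borel_measurable borel" "\<And>t. \<bar>g t\<bar> \<le> K"
  shows "(\<Sum>n\<le>N. (LINT t|\<mu>. orthopoly b t n * g t)\<^sup>2) \<le> (LINT t|\<mu>. (g t)\<^sup>2)"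
proof -
  interpret finite_measure \<mu> by (rule \<mu>)
  note [measurable_cong] = \<mu>(2)
  note [measurable] = g(1)
  have int: "integrable \<mu> (\<lambda>t. orthopoly b t i * orthopoly b t j)"
    and orth: "(LINT t|\<mu>. orthopoly b t i * orthopoly b t j) = (if i = j then 1 else 0)" for i j
    using o by (auto simp: orthonormal_for_def)
  have intp: "integrable \<mu> (\<lambda>t. orthopoly b t i)" for i
    using int[of i 0] by simp
  have intpg: "integrable \<mu> (\<lambda>t. orthopoly b t i * g t)" for i
  proof (rule Bochner_Integration.integrable_bound[OF integrable_mult_left[OF intp[of i], of "\<bar>K\<bar>"]])
    show "(\<lambda>t. orthopoly b t i * g t) \<in> borel_measurable \<mu>"
      using borel_measurable_integrable[OF intp[of i]] by measurable
    show "AE t in \<mu>. norm (orthopoly b t i * g t) \<le> norm (orthopoly b t i * \<bar>K\<bar>)"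
      using g(2) by (intro AE_I2) (auto simp: abs_mult intro!: mult_left_mono order_trans[OF g(2) abs_ge_self])
  qed
  have intg: "integrable \<mu> (\<lambda>t. (g t)\<^sup>2)"
  proof (rule integrable_const_bound[where B = "K\<^sup>2"])
    show "AE t in \<mu>. norm ((g t)\<^sup>2) \<le> K\<^sup>2"
      using g(2) by (intro AE_I2) (simp add: abs_le_square_iff[symmetric] order_trans[OF g(2) abs_ge_self])
  qed measurable
  define c where "c n = (LINT t|\<mu>. orthopoly b t n * g t)" for n
  define S where "S t = (\<Sum>n\<le>N. c n * orthopoly b t n)" for t
  have Sg: "integrable \<mu> (\<lambda>t. S t * g t)" "(LINT t|\<mu>. S t * g t) = (\<Sum>n\<le>N. (c n)\<^sup>2)"
    unfolding S_def sum_distrib_right mult.assoc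
    using intpg by (simp_all add: c_def[symmetric] power2_eq_square)
  have SS: "integrable \<mu> (\<lambda>t. S t * S t)" "(LINT t|\<mu>. S t * S t) = (\<Sum>n\<le>N. (c n)\<^sup>2)"
  proof -
    have eq: "S t * S t = (\<Sum>i\<le>N. \<Sum>j\<le>N. c i * c j * (orthopoly b t i * orthopoly b t j))" for t
      unfolding S_def sum_product by (intro sum.cong refl) (simp add: algebra_simps)
    show "integrable \<mu> (\<lambda>t. S t * S t)" unfolding eq
      by (intro Bochner_Integration.integrable_sum integrable_mult_right int)
    have "(LINT t|\<mu>. S t * S t) = (\<Sum>i\<le>N. \<Sum>j\<le>N. c i * c j * (if i = j then 1 else 0))"
      unfolding eq by (simp add: int orth)
    also have "\<dots> = (\<Sum>n\<le>N. (c n)\<^sup>2)" by (simp add: power2_eq_square if_distrib cong: if_cong)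
    finally show "(LINT t|\<mu>. S t * S t) = (\<Sum>n\<le>N. (c n)\<^sup>2)" .
  qed
  have "0 \<le> (LINT t|\<mu>. (g t - S t)\<^sup>2)" by simp
  also have "(LINT t|\<mu>. (g t - S t)\<^sup>2) = (LINT t|\<mu>. (g t)\<^sup>2 - 2 * (S t * g t) + S t * S t)"
    by (intro Bochner_Integration.integral_cong) (auto simp: power2_diff power2_eq_square algebra_simps)
  also have "\<dots> = (LINT t|\<mu>. (g t)\<^sup>2) - 2 * (\<Sum>n\<le>N. (c n)\<^sup>2) + (\<Sum>n\<le>N. (c n)\<^sup>2)"
    using intg Sg SS by simp
  finally show ?thesis by (simp add: c_def)
qed

abbreviation cauchy_kernel :: "complex \<Rightarrow> real \<Rightarrow> complex" where
  "cauchy_kernel z t \<equiv> 1 / (of_real t - z)"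

text \<open>
  For \<open>n = 0\<close> this is the Stieltjes transform of \<open>\<mu>\<close>; for all \<open>n\<close> these are the Fourier
  coefficients of the Cauchy kernel with respect to the orthonormal polynomials.
\<close>

definition stieltjes :: "(nat \<Rightarrow> real) \<Rightarrow> real measure \<Rightarrow> complex \<Rightarrow> nat \<Rightarrow> complex" where
  "stieltjes b \<mu> z n = (LINT t|\<mu>. of_real (orthopoly b t n) * cauchy_kernel z t)"

context
  fixes b :: "nat \<Rightarrow> real" and \<mu> :: "real measure" and z :: complex
  assumes b: "\<And>n. b n > 0" and \<mu>: "finite_measure \<mu>" "sets \<mu> = sets borel"
    and o: "orthonormal_for b \<mu>" and z: "Im z > 0"
begin

lemma
  shows stieltjes_integrable: "integrable \<mu> (\<lambda>t. of_real (orthopoly b t n) * cauchy_kernel z t)" (is ?A)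
    and cauchy_kernel_bound: "cmod (cauchy_kernel z t) \<le> 1 / Im z" (is ?B)
    and cauchy_kernel_meas: "cauchy_kernel z \<in> borel_measurable borel" (is ?C)
proof -
  have bd: "cmod (cauchy_kernel z t) \<le> 1 / Im z" for t :: real
  proof -
    have "Im z \<le> cmod (of_real t - z)" using abs_Im_le_cmod[of "of_real t - z"] by simp
    then show ?thesis using z by (simp add: norm_divide frac_le)
  qed
  then show ?B .
  have nz: "of_real t - z \<noteq> 0" for t :: real using z by (auto simp: complex_eq_iff)
  show m: ?C by (intro borel_measurable_continuous_onI continuous_intros) (use nz in auto)
  have intp: "integrable \<mu> (\<lambda>t. orthopoly b t n)" by (rule orthonormal_for_mean[OF o])
  show ?A
  proof (rule Bochner_Integration.integrable_bound[OF integrable_mult_left[OF intp, of "1 / Im z"]])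
    have "(\<lambda>t. of_real (orthopoly b t n) :: complex) \<in> borel_measurable \<mu>"
      using borel_measurable_integrable[OF intp] by measurable
    moreover have "cauchy_kernel z \<in> borel_measurable \<mu>"
      using m measurable_cong_sets[OF \<mu>(2) refl] by blast
    ultimately show "(\<lambda>t. of_real (orthopoly b t n) * cauchy_kernel z t) \<in> borel_measurable \<mu>"
      by (rule borel_measurable_times)
    show "AE t in \<mu>. norm (of_real (orthopoly b t n) * cauchy_kernel z t) \<le> norm (orthopoly b t n * (1 / Im z))"
    proof (intro AE_I2)
      fix t
      show "norm (of_real (orthopoly b t n) * cauchy_kernel z t) \<le> norm (orthopoly b t n * (1 / Im z))"
        unfolding norm_mult using bd[of t] z by (intro mult_mono) auto
    qed
  qed
qed

lemma weyl_solution_stieltjes: "weyl_solution b 1 z (stieltjes b \<mu> z)"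
proof -
  have b0: "b n \<noteq> 0" for n using b[of n] by simp
  have nz: "of_real t - z \<noteq> 0" for t :: real using z by (auto simp: complex_eq_iff)
  have intp: "integrable \<mu> (\<lambda>t. orthopoly b t n)" and ip: "(LINT t|\<mu>. orthopoly b t n) = (if n = 0 then 1 else 0)" for n
    by (rule orthonormal_for_mean[OF o])+
  have *: "(LINT t|\<mu>. of_real (t * orthopoly b t n) * cauchy_kernel z t) =
      of_real (if n = 0 then 1 else 0) + z * stieltjes b \<mu> z n" for n
  proof -
    have "of_real (t * orthopoly b t n) * cauchy_kernel z t =
        of_real (orthopoly b t n) + z * (of_real (orthopoly b t n) * cauchy_kernel z t)" for t :: real
      using nz[of t] by (simp add: field_simps)
    then have "(LINT t|\<mu>. of_real (t * orthopoly b t n) * cauchy_kernel z t) =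
        (LINT t|\<mu>. complex_of_real (orthopoly b t n) + z * (of_real (orthopoly b t n) * cauchy_kernel z t))"
      by (simp only:)
    also have "\<dots> = (LINT t|\<mu>. complex_of_real (orthopoly b t n)) +
        (LINT t|\<mu>. z * (of_real (orthopoly b t n) * cauchy_kernel z t))"
      by (intro Bochner_Integration.integral_add integrable_of_real intp integrable_mult_right stieltjes_integrable)
    finally show ?thesis
      unfolding integral_mult_right_zero integral_complex_of_real stieltjes_def[symmetric] ip .
  qed
  show ?thesis unfolding weyl_solution_def
  proof (intro conjI allI)
    have "of_real (b 0) * stieltjes b \<mu> z 1 = (LINT t|\<mu>. of_real (t * orthopoly b t 0) * cauchy_kernel z t)"
      using b0 unfolding stieltjes_def by (simp flip: integral_mult_right_zero)
    then show "of_real (b 0) * stieltjes b \<mu> z 1 = z * stieltjes b \<mu> z 0 + of_real 1"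
      unfolding * by simp
    fix n
    have "of_real (b (Suc n)) * stieltjes b \<mu> z (Suc (Suc n)) + of_real (b n) * stieltjes b \<mu> z n =
       (LINT t|\<mu>. of_real (b (Suc n)) * (of_real (orthopoly b t (Suc (Suc n))) * cauchy_kernel z t) +
        of_real (b n) * (of_real (orthopoly b t n) * cauchy_kernel z t))"
      unfolding stieltjes_def integral_mult_right_zero[symmetric]
      by (intro Bochner_Integration.integral_add[symmetric] integrable_mult_right stieltjes_integrable)
    also have "\<dots> = (LINT t|\<mu>. of_real (t * orthopoly b t (Suc n)) * cauchy_kernel z t)"
    proof (rule Bochner_Integration.integral_cong[OF refl])
      fix t
      have "t * orthopoly b t (Suc n) = b (Suc n) * orthopoly b t (Suc (Suc n)) + b n * orthopoly b t n"
        using orthopoly_rec[where b = b and n = n and z = t, OF b0] by simp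
      then show "of_real (b (Suc n)) * (of_real (orthopoly b t (Suc (Suc n))) * cauchy_kernel z t) +
        of_real (b n) * (of_real (orthopoly b t n) * cauchy_kernel z t) =
        of_real (t * orthopoly b t (Suc n)) * cauchy_kernel z t"
        by (simp only: of_real_add of_real_mult algebra_simps)
    qed
    finally show "of_real (b (Suc n)) * stieltjes b \<mu> z (Suc (Suc n)) = z * stieltjes b \<mu> z (Suc n) - of_real (b n) * stieltjes b \<mu> z n"
      unfolding * by (simp add: algebra_simps)
  qed
qed

text \<open>
  Bessel's inequality for the Cauchy kernel, whose modulus is at most \<open>1 / Im z\<close>.
\<close>

lemma stieltjes_square_sum: "square_sum (stieltjes b \<mu> z) N \<le> 1 / (Im z)\<^sup>2"
proof -
  interpret finite_measure \<mu> by (rule \<mu>)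
  let ?k = "\<lambda>t. cauchy_kernel z t"
  have m: "?k \<in> borel_measurable borel" by (rule cauchy_kernel_meas)
  note [measurable] = m and [measurable_cong] = \<mu>(2)
  have ReM: "Re (of_real r * c) = r * Re c" and ImM: "Im (of_real r * c) = r * Im c" for r c
    by simp_all
  have re: "Re (stieltjes b \<mu> z n) = (LINT t|\<mu>. orthopoly b t n * Re (?k t))"
    and im: "Im (stieltjes b \<mu> z n) = (LINT t|\<mu>. orthopoly b t n * Im (?k t))" for n
    unfolding stieltjes_def ReM[symmetric] ImM[symmetric]
    by (rule integral_Re[OF stieltjes_integrable, symmetric] integral_Im[OF stieltjes_integrable, symmetric])+
  have mass: "measure \<mu> UNIV = 1"
    using orthonormal_for_mean(2)[OF o, of 0] sets_eq_imp_space_eq[OF \<mu>(2)] by simp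
  have B1: "\<bar>Re (?k t)\<bar> \<le> 1 / Im z" and B2: "\<bar>Im (?k t)\<bar> \<le> 1 / Im z" for t
    using abs_Re_le_cmod[of "?k t"] abs_Im_le_cmod[of "?k t"] cauchy_kernel_bound[of t] by linarith+
  have sq: "(Re (?k t))\<^sup>2 + (Im (?k t))\<^sup>2 \<le> 1 / (Im z)\<^sup>2" for t
    using power_mono[OF cauchy_kernel_bound[of t], of 2] by (simp add: cmod_power2 power_divide)
  have i1: "integrable \<mu> (\<lambda>t. (Re (?k t))\<^sup>2)" and i2: "integrable \<mu> (\<lambda>t. (Im (?k t))\<^sup>2)"
  proof -
    have sq': "(Re (?k t))\<^sup>2 \<le> 1 / (Im z)\<^sup>2" "(Im (?k t))\<^sup>2 \<le> 1 / (Im z)\<^sup>2" for t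
      using sq[of t] zero_le_power2[of "Re (?k t)"] zero_le_power2[of "Im (?k t)"] by linarith+
    show "integrable \<mu> (\<lambda>t. (Re (?k t))\<^sup>2)"
    proof (rule integrable_const_bound[where B = "1 / (Im z)\<^sup>2"])
      show "AE t in \<mu>. norm ((Re (?k t))\<^sup>2) \<le> 1 / (Im z)\<^sup>2"
        unfolding real_norm_def abs_of_nonneg[OF zero_le_power2] by (intro AE_I2 sq')
    qed measurable
    show "integrable \<mu> (\<lambda>t. (Im (?k t))\<^sup>2)"
    proof (rule integrable_const_bound[where B = "1 / (Im z)\<^sup>2"])
      show "AE t in \<mu>. norm ((Im (?k t))\<^sup>2) \<le> 1 / (Im z)\<^sup>2"
        unfolding real_norm_def abs_of_nonneg[OF zero_le_power2] by (intro AE_I2 sq')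
    qed measurable
  qed
  have "square_sum (stieltjes b \<mu> z) N =
      (\<Sum>n\<le>N. (LINT t|\<mu>. orthopoly b t n * Re (?k t))\<^sup>2) + (\<Sum>n\<le>N. (LINT t|\<mu>. orthopoly b t n * Im (?k t))\<^sup>2)"
    unfolding cmod_power2 re im sum.distrib ..
  also have "\<dots> \<le> (LINT t|\<mu>. (Re (?k t))\<^sup>2) + (LINT t|\<mu>. (Im (?k t))\<^sup>2)"
    by (intro add_mono bessel_orthopoly[OF \<mu> o _ B1] bessel_orthopoly[OF \<mu> o _ B2]) measurable
  also have "\<dots> = (LINT t|\<mu>. (Re (?k t))\<^sup>2 + (Im (?k t))\<^sup>2)" using i1 i2 by simp
  also have "\<dots> \<le> (LINT t|\<mu>. 1 / (Im z)\<^sup>2)"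
    using i1 i2 sq by (intro integral_mono) auto
  also have "\<dots> = 1 / (Im z)\<^sup>2" using mass sets_eq_imp_space_eq[OF \<mu>(2)] by simp
  finally show ?thesis .
qed

lemma Im_stieltjes_0: "Im (stieltjes b \<mu> z 0) = (LINT t|\<mu>. Im z / ((t - Re z)\<^sup>2 + (Im z)\<^sup>2))"
proof -
  have "Im (stieltjes b \<mu> z 0) = (LINT t|\<mu>. Im (of_real (orthopoly b t 0) * cauchy_kernel z t))"
    unfolding stieltjes_def by (rule integral_Im[OF stieltjes_integrable, symmetric])
  also have "\<dots> = (LINT t|\<mu>. Im z / ((t - Re z)\<^sup>2 + (Im z)\<^sup>2))"
    by (intro Bochner_Integration.integral_cong) (auto simp: Im_divide)
  finally show ?thesis .
qed

end

section \<open>The outgoing boundary condition\<close>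

text \<open>
  The value of \<open>m\<close> for which the solution \<open>w n = q\<^sub>n + m * p\<^sub>n\<close> satisfies \<open>w (Suc N) = - \<i> * w N\<close>.
  This boundary condition matches a wave that travels to infinity.
\<close>

definition outgoing :: "(nat \<Rightarrow> real) \<Rightarrow> nat \<Rightarrow> complex \<Rightarrow> complex" where
  "outgoing b N z = - (secondpoly b z (Suc N) + \<i> * secondpoly b z N) /
     (orthopoly b z (Suc N) + \<i> * orthopoly b z N)"

definition outgoing_solution :: "(nat \<Rightarrow> real) \<Rightarrow> nat \<Rightarrow> complex \<Rightarrow> nat \<Rightarrow> complex" where
  "outgoing_solution b N z n = secondpoly b z n + outgoing b N z * orthopoly b z n"

context
  fixes b :: "nat \<Rightarrow> real" and N :: nat
  assumes b: "\<And>n. b n > 0"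
begin

private lemma b0: "b n \<noteq> 0" using b[of n] by simp

text \<open>
  A zero would be an eigenvalue in the closed upper half-plane of a dissipative truncation.
  Green's formula gives the boundary term the wrong sign when \<open>Im z > 0\<close>; for real \<open>z\<close> two
  consecutive polynomials would vanish.
\<close>

lemma outgoing_denominator_nonzero:
  assumes "Im z \<ge> 0"
  shows "orthopoly b z (Suc N) + \<i> * orthopoly b z N \<noteq> 0"
proof
  assume "orthopoly b z (Suc N) + \<i> * orthopoly b z N = 0"
  then have e: "orthopoly b z (Suc N) = - \<i> * orthopoly b z N" by (simp add: eq_neg_iff_add_eq_0)
  show False
  proof (cases "Im z = 0")
    case True
    then have z: "z = of_real (Re z)" by (simp add: complex_eq_iff)
    have "complex_of_real (orthopoly b (Re z) (Suc N)) = - \<i> * of_real (orthopoly b (Re z) N)"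
      using e z by (metis orthopoly_of_real)
    then have "orthopoly b (Re z) (Suc N) = 0" "orthopoly b (Re z) N = 0"
      by (auto simp: complex_eq_iff)
    then show False using orthopoly_not_both_zero[where b = b and n = N and z = "Re z", OF b0] by simp
  next
    case False
    have "Im z * square_sum (orthopoly b z) N = b N * Im (orthopoly b z (Suc N) * cnj (orthopoly b z N))"
      using weyl_green[OF weyl_solution_orthopoly[where b = b and z = z, OF b0], where N = N] by simp
    also have "\<dots> = - b N * (cmod (orthopoly b z N))\<^sup>2"
      unfolding e cmod_power2 by (simp add: power2_eq_square algebra_simps)
    also have "\<dots> \<le> 0" using b[of N] by simp
    finally have "square_sum (orthopoly b z) N \<le> 0"
      using False assms by (simp add: mult_le_0_iff)
    moreover have "(cmod (orthopoly b z 0))\<^sup>2 \<le> square_sum (orthopoly b z) N"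
      by (rule member_le_sum) auto
    ultimately show False by simp
  qed
qed

lemma weyl_outgoing: "weyl_solution b 1 z (outgoing_solution b N z)"
  unfolding outgoing_solution_def[abs_def] by (rule weyl_solution_second) (rule b0)

lemma outgoing_solution_0: "outgoing_solution b N z 0 = outgoing b N z"
  by (simp add: outgoing_solution_def)

lemma outgoing_boundary:
  assumes "Im z \<ge> 0"
  shows "outgoing_solution b N z (Suc N) = - \<i> * outgoing_solution b N z N"
  using outgoing_denominator_nonzero[OF assms]
  unfolding outgoing_solution_def outgoing_def by (simp add: field_simps)

lemma outgoing_green:
  assumes "Im z \<ge> 0"
  shows "Im (outgoing b N z) = Im z * square_sum (outgoing_solution b N z) N +
    b N * (cmod (outgoing_solution b N z N))\<^sup>2"
  using weyl_green[OF weyl_outgoing[of z], where N = N]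
  unfolding outgoing_boundary[OF assms] outgoing_solution_0 cmod_power2[of "outgoing_solution b N z N"]
  by (simp add: power2_eq_square algebra_simps)

text \<open>
  Green's formula bounds \<open>Im z\<close> times the sum by \<open>\<bar>w 0\<bar>\<close>, which is at most the square root of the
  sum.
\<close>

lemma outgoing_square_sum:
  assumes "Im z > 0"
  shows "square_sum (outgoing_solution b N z) N \<le> 1 / (Im z)\<^sup>2"
proof -
  let ?S = "square_sum (outgoing_solution b N z) N"
  have S0: "?S \<ge> 0" by (intro sum_nonneg) auto
  have "Im z * ?S \<le> Im (outgoing b N z)"
    using outgoing_green[of z] assms b[of N] by simp
  also have "\<dots> \<le> cmod (outgoing b N z)" by (rule order_trans[OF abs_ge_self abs_Im_le_cmod])
  finally have "(Im z * ?S)\<^sup>2 \<le> (cmod (outgoing b N z))\<^sup>2"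
    using S0 assms by (intro power_mono) auto
  also have "\<dots> = (cmod (outgoing_solution b N z 0))\<^sup>2" by (simp add: outgoing_solution_0)
  also have "\<dots> \<le> ?S" by (rule member_le_sum) auto
  finally have *: "((Im z)\<^sup>2 * ?S) * ?S \<le> 1 * ?S" by (simp add: power2_eq_square mult_ac)
  show ?thesis
  proof (cases "?S = 0")
    case False
    with S0 have "?S > 0" by linarith
    with * have "(Im z)\<^sup>2 * ?S \<le> 1" by (rule mult_right_le_imp_le)
    then show ?thesis using assms by (simp add: field_simps)
  qed simp
qed

lemma cmod_outgoing_le:
  assumes "Im z > 0"
  shows "cmod (outgoing b N z) \<le> 1 / Im z"
proof (rule power2_le_imp_le)
  have "(cmod (outgoing b N z))\<^sup>2 = (cmod (outgoing_solution b N z 0))\<^sup>2" by (simp add: outgoing_solution_0)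
  also have "\<dots> \<le> square_sum (outgoing_solution b N z) N" by (rule member_le_sum) auto
  also have "\<dots> \<le> (1 / Im z)\<^sup>2" using outgoing_square_sum[OF assms] by (simp add: power_divide)
  finally show "(cmod (outgoing b N z))\<^sup>2 \<le> (1 / Im z)\<^sup>2" .
qed (use assms in simp)

text \<open>
  On the real line only the boundary term of Green's formula survives, and the boundary value of
  the solution is determined by its Wronskian with the orthogonal polynomials.
\<close>

lemma Im_outgoing_real: "Im (outgoing b N (of_real t)) = 1 / amplitude b N t"
proof -
  let ?z = "complex_of_real t" and ?w = "outgoing_solution b N (of_real t) N"
  have "1 = of_real (b N) * (orthopoly b ?z N * outgoing_solution b N ?z (Suc N) - orthopoly b ?z (Suc N) * ?w)"
    using weyl_wronskian[where b = b and n = N, OF b0 weyl_outgoing[of ?z]] by simp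
  also have "\<dots> = - (of_real (b N) * (orthopoly b ?z (Suc N) + \<i> * orthopoly b ?z N) * ?w)"
    by (subst outgoing_boundary) (simp_all add: algebra_simps)
  finally have "cmod (of_real (b N) * (orthopoly b ?z (Suc N) + \<i> * orthopoly b ?z N) * ?w) = 1"
    by (metis norm_minus_cancel norm_one)
  then have "(b N)\<^sup>2 * (cmod (orthopoly b ?z (Suc N) + \<i> * orthopoly b ?z N))\<^sup>2 * (cmod ?w)\<^sup>2 = 1"
    unfolding power_mult_distrib[symmetric] using b[of N] by (simp add: norm_mult)
  moreover have "(cmod (orthopoly b ?z (Suc N) + \<i> * orthopoly b ?z N))\<^sup>2 = (orthopoly b t N)\<^sup>2 + (orthopoly b t (Suc N))\<^sup>2"
    unfolding orthopoly_of_real by (simp add: cmod_power2)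
  ultimately have "amplitude b N t * (b N * (cmod ?w)\<^sup>2) = 1"
    by (simp add: amplitude_def power2_eq_square mult_ac)
  moreover have "Im (outgoing b N ?z) = b N * (cmod ?w)\<^sup>2" using outgoing_green[of ?z] by simp
  ultimately show ?thesis using amplitude_pos[of b N t] b by (simp add: field_simps)
qed

lemma holomorphic_outgoing: "outgoing b N holomorphic_on {z. Im z \<ge> 0}"
  unfolding outgoing_def[abs_def]
  using outgoing_denominator_nonzero b0 unfolding orthopoly_def secondpoly_def
  by (intro holomorphic_intros) auto

text \<open>
  A maximum principle: at the site where \<open>\<bar>w n\<bar>\<close> is largest, the recurrence gives \<open>\<bar>z\<bar> * \<bar>w n\<bar> \<le> s
  * \<bar>w n\<bar> + 1\<close>, where \<open>s\<close> bounds the sums of the weights in the rows of the matrix.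
\<close>

lemma outgoing_bounded_at_infinity:
  assumes "Im z \<ge> 0" "cmod z \<ge> 2 * (\<Sum>n\<le>N. b n) + 1"
  shows "cmod (outgoing b N z) \<le> 1"
proof -
  let ?w = "outgoing_solution b N z"
  define M where "M = Max ((\<lambda>n. cmod (?w n)) ` {..N})"
  have M: "cmod (?w n) \<le> M" if "n \<le> N" for n unfolding M_def using that by (intro Max_ge) auto
  have MS: "cmod (?w n) \<le> M" if "n \<le> Suc N" for n
    using M[of n] M[of N] that outgoing_boundary[OF assms(1)] by (cases "n = Suc N") (auto simp: norm_mult)
  have M0: "M \<ge> 0" using M[of 0] norm_ge_zero[of "?w 0"] by linarith
  have bS: "b n \<le> (\<Sum>n\<le>N. b n)" if "n \<le> N" for n using b that by (intro member_le_sum) (auto intro: less_imp_le)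
  have S0: "(\<Sum>n\<le>N. b n) \<ge> 0" using b by (intro sum_nonneg) (auto intro: less_imp_le)
  obtain n where n: "n \<le> N" "M = cmod (?w n)"
  proof -
    have "M \<in> (\<lambda>n. cmod (?w n)) ` {..N}" unfolding M_def by (rule Max_in) auto
    then show ?thesis using that by auto
  qed
  have "cmod (z * ?w n) \<le> 2 * (\<Sum>n\<le>N. b n) * M + 1"
  proof (cases n)
    case 0
    have "z * ?w n = of_real (b 0) * ?w 1 - 1"
      using weyl_outgoing[of z] by (simp add: weyl_solution_def 0)
    then have "cmod (z * ?w n) \<le> b 0 * cmod (?w 1) + 1"
      using norm_triangle_ineq4[of "of_real (b 0) * ?w 1" 1] b[of 0] by (simp add: norm_mult)
    also have "b 0 * cmod (?w 1) \<le> (\<Sum>n\<le>N. b n) * M" using MS bS b S0 by (intro mult_mono) auto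
    also have "\<dots> \<le> 2 * (\<Sum>n\<le>N. b n) * M" using S0 M0 by (intro mult_right_mono) auto
    finally show ?thesis by simp
  next
    case (Suc k)
    have "z * ?w n = of_real (b (Suc k)) * ?w (Suc (Suc k)) + of_real (b k) * ?w k"
      using weyl_outgoing[of z] by (simp add: weyl_solution_def Suc)
    then have "cmod (z * ?w n) \<le> b (Suc k) * cmod (?w (Suc (Suc k))) + b k * cmod (?w k)"
      using norm_triangle_ineq[of "of_real (b (Suc k)) * ?w (Suc (Suc k))" "of_real (b k) * ?w k"] b[of k] b[of "Suc k"]
      by (simp add: norm_mult)
    also have "\<dots> \<le> (\<Sum>n\<le>N. b n) * M + (\<Sum>n\<le>N. b n) * M"
      using MS bS b S0 n Suc by (intro add_mono mult_mono) auto
    also have "\<dots> = 2 * (\<Sum>n\<le>N. b n) * M" by simp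
    finally show ?thesis by linarith
  qed
  moreover have "(2 * (\<Sum>n\<le>N. b n) + 1) * M \<le> cmod (z * ?w n)"
    unfolding norm_mult n(2)[symmetric] using assms(2) M0 by (intro mult_right_mono)
  ultimately have "M \<le> 1" by (simp add: algebra_simps)
  then show ?thesis using M[of 0] by (simp add: outgoing_solution_0)
qed

lemma poisson_amplitude:
  assumes "y > 0"
  shows "integrable lborel (\<lambda>t. 1 / amplitude b N t * poisson x y t)"
    and "(LINT t|lborel. 1 / amplitude b N t * poisson x y t) = pi * Im (outgoing b N (Complex x y))"
proof -
  have "Im (outgoing b N (of_real t)) \<ge> 0" for t
    using amplitude_pos[of b N t] b by (simp add: Im_outgoing_real)
  from poisson_half_plane[OF holomorphic_outgoing outgoing_bounded_at_infinity this assms]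
  show "integrable lborel (\<lambda>t. 1 / amplitude b N t * poisson x y t)"
    and "(LINT t|lborel. 1 / amplitude b N t * poisson x y t) = pi * Im (outgoing b N (Complex x y))"
    unfolding Im_outgoing_real by simp_all
qed

end

text \<open>
  Both solutions have square sums at most \<open>1 / (Im z)\<^sup>2\<close>, so they lie in the same shrinking disc.
\<close>

lemma outgoing_tendsto_stieltjes:
  assumes b: "\<And>n. b n > 0" and carleman: "\<not> summable (\<lambda>n. 1 / b n)"
    and \<mu>: "finite_measure \<mu>" "sets \<mu> = sets borel" and o: "orthonormal_for b \<mu>" and z: "Im z > 0"
  shows "(\<lambda>N. outgoing b N z) \<longlonglongrightarrow> stieltjes b \<mu> z 0"
proof -
  define s where "s N = (\<Sum>n<N. 1 / b n)" for N
  have s_top: "filterlim s at_top sequentially"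
  proof -
    have "incseq s" unfolding s_def using b by (intro monoI sum_mono2) (auto intro: less_imp_le)
    moreover have "\<not> (\<exists>C. \<forall>N. s N \<le> C)"
    proof
      assume "\<exists>C. \<forall>N. s N \<le> C"
      then obtain C where C: "\<And>N. s N \<le> C" by blast
      have "summable (\<lambda>n. 1 / b n)"
      proof (rule bounded_imp_summable)
        show "0 \<le> 1 / b n" for n using b[of n] by simp
        show "(\<Sum>k\<le>n. 1 / b k) \<le> C" for n
          using C[of "Suc n"] unfolding s_def lessThan_Suc_atMost .
      qed
      with carleman show False ..
    qed
    ultimately show ?thesis
      unfolding filterlim_at_top eventually_sequentially incseq_def by (metis linear order_trans)
  qed
  have "(\<lambda>N. outgoing b N z - stieltjes b \<mu> z 0) \<longlonglongrightarrow> 0"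
  proof (rule Lim_null_comparison)
    have "(\<lambda>N. (5 * (1 / (Im z)\<^sup>2)) / s N) \<longlonglongrightarrow> 0"
      by (rule tendsto_divide_0[OF tendsto_const filterlim_at_top_imp_at_infinity[OF s_top]])
    then show "(\<lambda>N. (5 * (1 / (Im z)\<^sup>2)) / s N) \<longlonglongrightarrow> 0" .
    have "\<forall>\<^sub>F N in sequentially. s N \<ge> 1" using s_top by (simp add: filterlim_at_top)
    then show "\<forall>\<^sub>F N in sequentially. norm (outgoing b N z - stieltjes b \<mu> z 0) \<le> (5 * (1 / (Im z)\<^sup>2)) / s N"
    proof eventually_elim
      case (elim N)
      have "cmod (outgoing_solution b N z 0 - stieltjes b \<mu> z 0) * s N \<le> 5 * (1 / (Im z)\<^sup>2)"
        unfolding s_def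
        by (rule weyl_contraction[OF b weyl_outgoing[OF b] weyl_solution_stieltjes[OF b \<mu> o z]
              outgoing_square_sum[OF b z] stieltjes_square_sum[OF b \<mu> o z]])
      then show ?case using elim by (simp only: outgoing_solution_0[OF b] pos_le_divide_eq)
    qed
  qed
  then show ?thesis by (simp add: LIM_zero_iff)
qed

lemma poisson_amplitude_tendsto:
  assumes b: "\<And>n. b n > 0" and carleman: "\<not> summable (\<lambda>n. 1 / b n)"
    and \<mu>: "finite_measure \<mu>" "sets \<mu> = sets borel" and o: "orthonormal_for b \<mu>" and y: "y > 0"
  shows "(\<lambda>N. LINT t|lborel. 1 / amplitude b N t * poisson x y t) \<longlonglongrightarrow>
    pi * (LINT t|\<mu>. poisson x y t)"
proof -
  have z: "Im (Complex x y) > 0" using y by simp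
  have "(\<lambda>N. pi * Im (outgoing b N (Complex x y))) \<longlonglongrightarrow> pi * Im (stieltjes b \<mu> (Complex x y) 0)"
    by (intro tendsto_intros outgoing_tendsto_stieltjes[OF b carleman \<mu> o z])
  then show ?thesis
    unfolding poisson_amplitude(2)[OF b y] Im_stieltjes_0[OF b \<mu> o z] by simp
qed

section \<open>Stieltjes inversion\<close>

text \<open>
  The integral of the Poisson kernel over the interval from \<open>a\<close> to \<open>b\<close>, a smooth approximation of
  \<open>\<pi>\<close> times its indicator function as \<open>y\<close> tends to \<open>0\<close>.
\<close>

definition window :: "real \<Rightarrow> real \<Rightarrow> real \<Rightarrow> real \<Rightarrow> real" where
  "window a b y t = arctan ((b - t) / y) - arctan ((a - t) / y)"

lemma window_has_integral:
  assumes "y > 0" "a \<le> b"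
  shows "((\<lambda>x. poisson x y t) has_integral window a b y t) {a..b}"
  using has_integral_poisson_kernel[OF assms, of t] by (simp add: window_def power2_commute)

lemma window_nn_integral:
  assumes "y > 0" "a \<le> b"
  shows "(\<integral>\<^sup>+x. ennreal (indicator {a..b} x * poisson x y t) \<partial>lborel) = ennreal (window a b y t)"
  by (rule nn_integral_has_integral_lebesgue[OF _ window_has_integral[OF assms]]) (use assms in simp)

lemma window_nonneg: "y > 0 \<Longrightarrow> a \<le> b \<Longrightarrow> 0 \<le> window a b y t"
  by (rule has_integral_nonneg[OF window_has_integral]) auto

lemma window_le_pi: "window a b y t \<le> pi"
  using arctan_ubound[of "(b - t) / y"] arctan_lbound[of "(a - t) / y"] unfolding window_def by linarith

lemma window_measurable [measurable]: "window a b y \<in> borel_measurable borel"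
  unfolding window_def[abs_def] by measurable

lemma continuous_on_window [continuous_intros]: "y > 0 \<Longrightarrow> continuous_on S (window a b y)"
  unfolding window_def[abs_def] by (intro continuous_intros) auto

text \<open>
  By Tonelli's theorem, averaging the Poisson integrals of \<open>M\<close> over an interval is the same as
  integrating the window function against \<open>M\<close>.
\<close>

lemma window_integral:
  fixes M :: "real measure"
  assumes M: "sigma_finite_measure M" "sets M = sets borel" and y: "y > 0" and ab: "a \<le> b"
    and int: "\<And>x. integrable M (\<lambda>t. poisson x y t)"
    and C: "\<And>x. (LINT t|M. poisson x y t) \<le> C"
  shows "(\<lambda>x. LINT t|M. poisson x y t) \<in> borel_measurable borel"
    and "integrable M (window a b y)"
    and "(LINT t|M. window a b y t) = (LINT x|lborel. indicator {a..b} x * (LINT t|M. poisson x y t))"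
proof -
  interpret M: sigma_finite_measure M by (rule M)
  interpret pair_sigma_finite M lborel ..
  note [measurable_cong] = M(2)
  define \<phi> where "\<phi> x = (LINT t|M. poisson x y t)" for x
  have meas [measurable]: "\<phi> \<in> borel_measurable borel"
    unfolding \<phi>_def[abs_def] by measurable
  then show "(\<lambda>x. LINT t|M. poisson x y t) \<in> borel_measurable borel" by (simp add: \<phi>_def[abs_def])
  have \<phi>0: "\<phi> x \<ge> 0" for x unfolding \<phi>_def using y by (intro Bochner_Integration.integral_nonneg) simp
  have \<phi>C: "\<phi> x \<le> C" for x using C by (simp add: \<phi>_def)
  have "(\<integral>\<^sup>+t. ennreal (window a b y t) \<partial>M) =
      (\<integral>\<^sup>+t. (\<integral>\<^sup>+x. ennreal (indicator {a..b} x * poisson x y t) \<partial>lborel) \<partial>M)"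
    unfolding window_nn_integral[OF y ab] ..
  also have "\<dots> = (\<integral>\<^sup>+x. (\<integral>\<^sup>+t. ennreal (indicator {a..b} x * poisson x y t) \<partial>M) \<partial>lborel)"
    by (rule Fubini'[symmetric]) measurable
  also have "\<dots> = (\<integral>\<^sup>+x. ennreal (indicator {a..b} x * \<phi> x) \<partial>lborel)"
  proof (rule nn_integral_cong)
    fix x :: real
    have "(\<integral>\<^sup>+t. ennreal (indicator {a..b} x * poisson x y t) \<partial>M) =
        ennreal (LINT t|M. indicator {a..b} x * poisson x y t)"
      using y int by (intro nn_integral_eq_integral integrable_mult_right) auto
    then show "(\<integral>\<^sup>+t. ennreal (indicator {a..b} x * poisson x y t) \<partial>M) = ennreal (indicator {a..b} x * \<phi> x)"
      unfolding \<phi>_def integral_mult_right_zero .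
  qed
  also have "\<dots> = ennreal (LINT x|lborel. indicator {a..b} x * \<phi> x)"
  proof (rule nn_integral_eq_integral)
    show "integrable lborel (\<lambda>x. indicator {a..b} x * \<phi> x)"
    proof (rule Bochner_Integration.integrable_bound)
      show "integrable lborel (\<lambda>x. indicator {a..b} x * C)"
        using ab by (intro integrable_mult_left integrable_real_indicator) auto
      show "AE x in lborel. norm (indicator {a..b} x * \<phi> x) \<le> norm (indicator {a..b} x * C)"
        using \<phi>0 by (intro AE_I2) (auto simp: indicator_def intro: order_trans[OF \<phi>C abs_ge_self])
    qed measurable
  qed (use \<phi>0 in auto)
  finally have nn: "(\<integral>\<^sup>+t. ennreal (window a b y t) \<partial>M) = ennreal (LINT x|lborel. indicator {a..b} x * \<phi> x)" .
  have "has_bochner_integral M (window a b y) (LINT x|lborel. indicator {a..b} x * \<phi> x)"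
    using window_nonneg[OF y ab] \<phi>0 nn
    by (intro has_bochner_integral_nn_integral) (auto intro!: Bochner_Integration.integral_nonneg)
  then show "integrable M (window a b y)"
    and "(LINT t|M. window a b y t) = (LINT x|lborel. indicator {a..b} x * (LINT t|M. poisson x y t))"
    unfolding \<phi>_def by (auto simp: has_bochner_integral_iff)
qed

lemma window_tendsto_limit:
  assumes "a < b" "filterlim y (at_right 0) F"
  shows "((\<lambda>j. window a b (y j) t) \<longlongrightarrow> pi * indicator {a<..<b} t + pi / 2 * indicator {a, b} t) F"
proof -
  have inv: "filterlim (\<lambda>j. inverse (y j)) at_top F"
    by (rule filterlim_compose[OF filterlim_inverse_at_top_right assms(2)])
  have *: "((\<lambda>j. arctan (s / y j)) \<longlongrightarrow> (if s > 0 then pi / 2 else if s < 0 then - (pi / 2) else 0)) F" for s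
  proof -
    consider "s > 0" | "s < 0" | "s = 0" by linarith
    then show ?thesis
    proof cases
      case 1
      have "filterlim (\<lambda>j. s * inverse (y j)) at_top F"
        by (rule filterlim_tendsto_pos_mult_at_top[OF tendsto_const 1 inv])
      then have "((\<lambda>j. arctan (s * inverse (y j))) \<longlongrightarrow> pi / 2) F"
        by (rule filterlim_compose[OF tendsto_arctan_at_top])
      then show ?thesis using 1 unfolding divide_inverse by simp
    next
      case 2
      have "filterlim (\<lambda>j. s * inverse (y j)) at_bot F"
        by (rule filterlim_tendsto_neg_mult_at_bot[OF tendsto_const 2 inv])
      then have "((\<lambda>j. arctan (s * inverse (y j))) \<longlongrightarrow> - (pi / 2)) F"
        by (rule filterlim_compose[OF tendsto_arctan_at_bot])
      then show ?thesis using 2 unfolding divide_inverse by simp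
    qed simp
  qed
  have "((\<lambda>j. window a b (y j) t) \<longlongrightarrow> (if b - t > 0 then pi / 2 else if b - t < 0 then - (pi / 2) else 0) -
      (if a - t > 0 then pi / 2 else if a - t < 0 then - (pi / 2) else 0)) F"
    unfolding window_def by (intro tendsto_diff *)
  also have "(if b - t > 0 then pi / 2 else if b - t < 0 then - (pi / 2) else 0) -
      (if a - t > 0 then pi / 2 else if a - t < 0 then - (pi / 2) else 0) =
      pi * indicator {a<..<b} t + pi / 2 * indicator {a, b} t"
    using assms(1) by (auto simp: indicator_def)
  finally show ?thesis .
qed

text \<open>
  Away from the interval the window function is dominated by a Poisson kernel with a fixed
  parameter. Hence mass outside of \<open>{c..d}\<close>, on whose distribution nothing is known, contributes
  only \<open>O(y)\<close>.
\<close>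

lemma window_far:
  assumes "c < a" "a \<le> b" "b < d"
  obtains \<kappa> where "\<And>y t. y > 0 \<Longrightarrow> t \<notin> {c..d} \<Longrightarrow> window a b y t \<le> \<kappa> * y * poisson 0 1 t"
    and "\<kappa> \<ge> 0"
proof -
  define \<eta> where "\<eta> = min (a - c) (d - b)"
  define X where "X = max \<bar>a\<bar> \<bar>b\<bar>"
  define K where "K = (1 + 2 * X\<^sup>2) / \<eta>\<^sup>2 + 2"
  have \<eta>: "\<eta> > 0" using assms by (simp add: \<eta>_def)
  have K: "K > 0" using \<eta> by (simp add: K_def add_nonneg_pos)
  have "window a b y t \<le> (b - a) * K * y * poisson 0 1 t" if y: "y > 0" and t: "t \<notin> {c..d}" for y t
  proof -
    have den: "t\<^sup>2 + 1 > 0" by (simp add: add_nonneg_pos)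
    have "poisson x y t \<le> K * y / (t\<^sup>2 + 1)" if x: "x \<in> {a..b}" for x
    proof -
      have "\<bar>t - x\<bar> \<ge> \<eta>" using t x by (auto simp: \<eta>_def)
      then have 1: "\<eta>\<^sup>2 \<le> (t - x)\<^sup>2" using \<eta> by (metis abs_le_square_iff abs_of_pos)
      have "\<bar>x\<bar> \<le> X" using x by (auto simp: X_def)
      then have 2: "x\<^sup>2 \<le> X\<^sup>2" by (metis abs_ge_self abs_le_square_iff order_trans)
      have "t\<^sup>2 \<le> 2 * (t - x)\<^sup>2 + 2 * x\<^sup>2"
        using zero_le_power2[of "t - 2 * x"] by (simp add: power2_diff power_mult_distrib)
      then have "t\<^sup>2 + 1 \<le> (1 + 2 * X\<^sup>2) * 1 + 2 * (t - x)\<^sup>2" using 2 by simp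
      also have "(1 + 2 * X\<^sup>2) * 1 \<le> (1 + 2 * X\<^sup>2) * ((t - x)\<^sup>2 / \<eta>\<^sup>2)"
        using 1 \<eta> by (intro mult_left_mono) (auto simp: add_nonneg_nonneg)
      also have "(1 + 2 * X\<^sup>2) * ((t - x)\<^sup>2 / \<eta>\<^sup>2) + 2 * (t - x)\<^sup>2 = K * (t - x)\<^sup>2"
        by (simp add: K_def algebra_simps)
      finally have 3: "t\<^sup>2 + 1 \<le> K * (t - x)\<^sup>2" by simp
      also have "\<dots> \<le> K * ((t - x)\<^sup>2 + y\<^sup>2)" using K by simp
      finally have "y * (t\<^sup>2 + 1) \<le> y * (K * ((t - x)\<^sup>2 + y\<^sup>2))" using y by simp
      moreover have "(t - x)\<^sup>2 + y\<^sup>2 > 0" using y by (simp add: add_nonneg_pos)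
      ultimately show ?thesis using den by (simp add: field_simps)
    qed
    then have "window a b y t \<le> (b - a) * (K * y / (t\<^sup>2 + 1))"
      using has_integral_le[OF window_has_integral[OF y assms(2), of t] has_integral_const_real[of "K * y / (t\<^sup>2 + 1)" a b]]
        assms(2) by simp
    then show ?thesis by simp
  qed
  moreover have "(b - a) * K \<ge> 0" using K assms by simp
  ultimately show ?thesis by (intro that)
qed

text \<open>
  For fixed \<open>y\<close> the window integrals of \<open>G N\<close> converge to those of \<open>\<mu>\<close>. Their part over \<open>{c..d}\<close>
  converges by uniformity, and the rest is \<open>O(y)\<close>; then \<open>y\<close> tends to \<open>0\<close>. The limit of the windows
  has the value \<open>\<pi> / 2\<close> at the end points, which explains the two inequalities in place of an
  equation.
\<close>

lemma stieltjes_inversion_interval: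
  fixes G :: "nat \<Rightarrow> real \<Rightarrow> real" and g :: "real \<Rightarrow> real" and \<mu> :: "real measure"
  assumes \<mu>: "finite_measure \<mu>" "sets \<mu> = sets borel"
    and G: "\<And>N t. G N t \<ge> 0" "\<And>N. continuous_on UNIV (G N)"
    and int: "\<And>N x y. y > 0 \<Longrightarrow> integrable lborel (\<lambda>t. G N t * poisson x y t)"
    and bound: "\<And>N x y. y > 0 \<Longrightarrow> (LINT t|lborel. G N t * poisson x y t) \<le> pi / y"
    and lim: "\<And>x y. y > 0 \<Longrightarrow> (\<lambda>N. LINT t|lborel. G N t * poisson x y t) \<longlonglongrightarrow>
      pi * (LINT t|\<mu>. poisson x y t)"
    and unif: "uniform_limit {c..d} G g sequentially"
    and order: "c < a" "a < b" "b < d"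
  shows "pi * measure \<mu> {a<..<b} \<le> integral {a..b} g"
    and "integral {a..b} g \<le> pi * measure \<mu> {a..b}"
proof -
  interpret finite_measure \<mu> by (rule \<mu>)
  note [measurable_cong] = \<mu>(2)
  have [measurable]: "G N \<in> borel_measurable borel" for N by (rule borel_measurable_continuous_onI[OF G(2)])
  have ab: "a \<le> b" using order by simp
  have g_cont: "continuous_on {c..d} g"
    by (rule uniform_limit_theorem[OF _ unif]) (auto intro!: always_eventually continuous_on_subset[OF G(2)])
  \<comment> \<open>First the limit of \<open>N\<close> for a fixed \<open>y\<close>.\<close>
  have windowG: "integrable lborel (\<lambda>t. G N t * window a b y t)"
      "(LINT t|lborel. G N t * window a b y t) =
        (LINT x|lborel. indicator {a..b} x * (LINT t|lborel. G N t * poisson x y t))"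
      "(\<lambda>x. LINT t|lborel. G N t * poisson x y t) \<in> borel_measurable borel"
    if y: "y > 0" for N y
  proof -
    let ?M = "density lborel (\<lambda>t. ennreal (G N t))"
    have sf: "sigma_finite_measure ?M" by (subst sigma_finite_measure.sigma_finite_iff_density_finite[OF sigma_finite_lborel]) auto
    have i: "(LINT t|?M. h t) = (LINT t|lborel. G N t * h t)"
      "integrable ?M h \<longleftrightarrow> integrable lborel (\<lambda>t. G N t * h t)"
      if [measurable]: "h \<in> borel_measurable borel" for h :: "real \<Rightarrow> real"
      using G by (subst integral_density integrable_density; simp)+
    have m: "(\<lambda>t. poisson x y t) \<in> borel_measurable borel" for x by measurable
    have intM: "\<And>x. integrable ?M (\<lambda>t. poisson x y t)" using int[OF y] by (simp only: i[OF m])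
    have boundM: "\<And>x. (LINT t|?M. poisson x y t) \<le> pi / y" using bound[OF y] by (simp only: i[OF m])
    have s: "sets ?M = sets borel" by simp
    note W = window_integral[OF sf s y ab intM boundM]
    show "integrable lborel (\<lambda>t. G N t * window a b y t)" using W(2) by (simp only: i[OF window_measurable])
    show "(LINT t|lborel. G N t * window a b y t) =
        (LINT x|lborel. indicator {a..b} x * (LINT t|lborel. G N t * poisson x y t))"
      using W(3) by (simp only: i[OF window_measurable] i[OF m])
    show "(\<lambda>x. LINT t|lborel. G N t * poisson x y t) \<in> borel_measurable borel"
      using W(1) by (simp only: i[OF m])
  qed
  have window\<mu>: "(LINT t|\<mu>. window a b y t) = (LINT x|lborel. indicator {a..b} x * (LINT t|\<mu>. poisson x y t))"
      "(\<lambda>x. LINT t|\<mu>. poisson x y t) \<in> borel_measurable borel"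
    if y: "y > 0" for y
  proof -
    have P: "poisson x y t \<le> 1 / y" for t x
    proof -
      have "y * y \<le> (t - x)\<^sup>2 + y\<^sup>2" by (simp add: power2_eq_square)
      moreover have "(t - x)\<^sup>2 + y\<^sup>2 > 0" using y by (simp add: add_nonneg_pos)
      ultimately show ?thesis using y by (simp add: field_simps)
    qed
    have i: "integrable \<mu> (\<lambda>t. poisson x y t)" for x
      by (rule integrable_const_bound[where B = "1 / y"]) (use P y in \<open>auto intro!: AE_I2\<close>)
    have b: "(LINT t|\<mu>. poisson x y t) \<le> (LINT t|\<mu>. 1 / y)" for x
      by (intro integral_mono i P) simp
    note W = window_integral[OF sigma_finite_measure_axioms \<mu>(2) y ab i b]
    show "(LINT t|\<mu>. window a b y t) = (LINT x|lborel. indicator {a..b} x * (LINT t|\<mu>. poisson x y t))"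
      "(\<lambda>x. LINT t|\<mu>. poisson x y t) \<in> borel_measurable borel"
      by (rule W)+
  qed
  have limA: "(\<lambda>N. LINT t|lborel. G N t * window a b y t) \<longlonglongrightarrow> pi * (LINT t|\<mu>. window a b y t)"
    if y: "y > 0" for y
  proof -
    note m = windowG(3)[OF y] window\<mu>(2)[OF y]
    have "(\<lambda>N. LINT x|lborel. indicator {a..b} x * (LINT t|lborel. G N t * poisson x y t)) \<longlonglongrightarrow>
        (LINT x|lborel. indicator {a..b} x * (pi * (LINT t|\<mu>. poisson x y t)))"
    proof (rule integral_dominated_convergence[where w = "\<lambda>x. indicator {a..b} x * (pi / y)"])
      show "AE x in lborel. (\<lambda>N. indicator {a..b} x * (LINT t|lborel. G N t * poisson x y t)) \<longlonglongrightarrow>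
          indicator {a..b} x * (pi * (LINT t|\<mu>. poisson x y t))"
        by (intro AE_I2 tendsto_mult_left lim y)
      have nonneg: "0 \<le> (LINT t|lborel. G N t * poisson x y t)" for N x
        using G(1) y by (intro Bochner_Integration.integral_nonneg) simp
      show "AE x in lborel. norm (indicator {a..b} x * (LINT t|lborel. G N t * poisson x y t)) \<le>
          indicator {a..b} x * (pi / y)" for N
        unfolding real_norm_def abs_mult abs_of_nonneg[OF nonneg] abs_indicator
        by (intro AE_I2 mult_left_mono bound[OF y]) simp
      have [simp, measurable]: "indicator {a..b} \<in> borel_measurable borel" by simp
      show "(\<lambda>x. indicator {a..b} x * (LINT t|lborel. G N t * poisson x y t)) \<in> borel_measurable lborel" for N
        using m(1)[of N] by (intro borel_measurable_times) simp_all
      show "(\<lambda>x. indicator {a..b} x * (pi * (LINT t|\<mu>. poisson x y t))) \<in> borel_measurable lborel"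
        using m(2) by (intro borel_measurable_times) simp_all
      show "integrable lborel (\<lambda>x. indicator {a..b} x * (pi / y))"
        using ab by (intro integrable_mult_left integrable_real_indicator) auto
    qed
    also have "(LINT x|lborel. indicator {a..b} x * (pi * (LINT t|\<mu>. poisson x y t))) =
        pi * (LINT t|\<mu>. window a b y t)"
      unfolding window\<mu>(1)[OF y] mult.left_commute[of _ pi] integral_mult_right_zero ..
    finally show ?thesis unfolding windowG(2)[OF y] .
  qed
  have set_int: "integrable lborel (\<lambda>t. indicator {c..d} t * h t)"
    "(LINT t|lborel. indicator {c..d} t * h t) = integral {c..d} h" if "continuous_on {c..d} h" for h :: "real \<Rightarrow> real"
  proof -
    have s: "set_integrable lborel {c..d} h" by (rule borel_integrable_atLeastAtMost'[OF that])
    then show "integrable lborel (\<lambda>t. indicator {c..d} t * h t)" by (simp add: set_integrable_def)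
    show "(LINT t|lborel. indicator {c..d} t * h t) = integral {c..d} h"
      using set_borel_integral_eq_integral(2)[OF s] by (simp add: set_lebesgue_integral_def)
  qed
  have limI: "(\<lambda>N. integral {c..d} (\<lambda>t. G N t * window a b y t)) \<longlonglongrightarrow> integral {c..d} (\<lambda>t. g t * window a b y t)"
    if y: "y > 0" for y
  proof -
    have "uniform_limit {c..d} (\<lambda>N t. G N t * window a b y t) (\<lambda>t. g t * window a b y t) sequentially"
    proof (rule uniform_lim_mult[OF unif uniform_limit_const])
      show "bounded (g ` {c..d})"
        by (intro compact_imp_bounded compact_continuous_image g_cont) simp
      show "bounded (window a b y ` {c..d})"
        by (intro compact_imp_bounded compact_continuous_image continuous_on_window y) simp
    qed
    then obtain I J where IJ: "\<And>N. ((\<lambda>t. G N t * window a b y t) has_integral I N) {c..d}"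
        "((\<lambda>t. g t * window a b y t) has_integral J) {c..d}" "I \<longlonglongrightarrow> J"
      by (rule uniform_limit_integral)
        (auto intro!: continuous_intros y continuous_on_subset[OF G(2)])
    show ?thesis unfolding IJ(1)[THEN integral_unique] IJ(2)[THEN integral_unique] by (rule IJ(3))
  qed
  obtain \<kappa> where \<kappa>: "\<And>y t. y > 0 \<Longrightarrow> t \<notin> {c..d} \<Longrightarrow> window a b y t \<le> \<kappa> * y * poisson 0 1 t" "\<kappa> \<ge> 0"
    using window_far[OF order(1) ab order(3)] by blast
  have close: "\<bar>pi * (LINT t|\<mu>. window a b y t) - integral {c..d} (\<lambda>t. g t * window a b y t)\<bar> \<le> \<kappa> * pi * y"
    if y: "y > 0" for y
  proof (rule LIMSEQ_le_const2[OF tendsto_rabs[OF tendsto_diff[OF limA[OF y] limI[OF y]]]], intro exI allI impI)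
    fix N :: nat
    have c: "continuous_on {c..d} (\<lambda>t. G N t * window a b y t)"
      by (intro continuous_intros y continuous_on_subset[OF G(2)]) auto
    have "(LINT t|lborel. G N t * window a b y t) - integral {c..d} (\<lambda>t. G N t * window a b y t) =
        (LINT t|lborel. G N t * window a b y t - indicator {c..d} t * (G N t * window a b y t))"
      using windowG(1)[OF y] set_int[OF c] by simp
    moreover have "0 \<le> \<dots>"
      using G(1) window_nonneg[OF y ab] by (intro Bochner_Integration.integral_nonneg) (auto simp: indicator_def)
    moreover have "\<dots> \<le> (LINT t|lborel. \<kappa> * y * (G N t * poisson 0 1 t))"
    proof (rule integral_mono)
      show "integrable lborel (\<lambda>t. G N t * window a b y t - indicator {c..d} t * (G N t * window a b y t))"
        by (intro Bochner_Integration.integrable_diff windowG(1) y set_int c)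
      show "integrable lborel (\<lambda>t. \<kappa> * y * (G N t * poisson 0 1 t))"
        by (intro integrable_mult_right int) simp
      fix t
      show "G N t * window a b y t - indicator {c..d} t * (G N t * window a b y t) \<le>
          \<kappa> * y * (G N t * poisson 0 1 t)"
      proof (cases "t \<in> {c..d}")
        case True
        then show ?thesis using \<kappa>(2) y G(1)[of N t] by simp
      next
        case False
        then show ?thesis using mult_left_mono[OF \<kappa>(1)[OF y False] G(1)[of N t]]
          by (simp add: mult_ac)
      qed
    qed
    moreover have "\<dots> \<le> \<kappa> * y * (pi / 1)"
      unfolding integral_mult_right_zero using bound[of 1 N 0] \<kappa>(2) y by (intro mult_left_mono) auto
    ultimately show "\<bar>(LINT t|lborel. G N t * window a b y t) - integral {c..d} (\<lambda>t. G N t * window a b y t)\<bar> \<le> \<kappa> * pi * y"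
      by (simp add: mult_ac)
  qed
  \<comment> \<open>Now \<open>y\<close> tends to \<open>0\<close> along the sequence \<open>1 / (j + 1)\<close>.\<close>
  define y where "y j = 1 / real (Suc j)" for j
  have ypos: "y j > 0" for j by (simp add: y_def)
  have y0: "y \<longlonglongrightarrow> 0" unfolding y_def using LIMSEQ_inverse_real_of_nat by (simp add: inverse_eq_divide)
  have y_right: "filterlim y (at_right 0) sequentially"
    unfolding filterlim_at using y0 ypos less_imp_neq[OF ypos]
    by (auto intro!: always_eventually)
  define L where "L t = pi * indicator {a<..<b} t + pi / 2 * indicator {a, b} t" for t
  have L_meas [measurable]: "L \<in> borel_measurable borel" unfolding L_def by measurable
  have wL: "(\<lambda>j. window a b (y j) t) \<longlonglongrightarrow> L t" for t
    unfolding L_def by (rule window_tendsto_limit[OF order(2) y_right])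
  have wb: "\<bar>window a b (y j) t\<bar> \<le> pi" for j t
    using window_nonneg[OF ypos ab] window_le_pi by (simp add: abs_of_nonneg)
  have lim\<mu>: "(\<lambda>j. LINT t|\<mu>. window a b (y j) t) \<longlonglongrightarrow> (LINT t|\<mu>. L t)"
    by (rule integral_dominated_convergence[where w = "\<lambda>_. pi"]) (use wL wb in auto)
  have limg: "(\<lambda>j. LINT t|lborel. indicator {c..d} t * (g t * window a b (y j) t)) \<longlonglongrightarrow>
      (LINT t|lborel. indicator {c..d} t * g t * L t)"
  proof (rule integral_dominated_convergence[where w = "\<lambda>t. pi * norm (indicator {c..d} t * g t)"])
    show "integrable lborel (\<lambda>t. pi * norm (indicator {c..d} t * g t))"
      by (intro integrable_mult_right integrable_norm set_int g_cont)
    have m: "(\<lambda>t. indicator {c..d} t * g t) \<in> borel_measurable lborel"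
      using set_int(1)[OF g_cont] by (rule borel_measurable_integrable)
    then show "(\<lambda>t. indicator {c..d} t * g t * L t) \<in> borel_measurable lborel" by measurable
    show "(\<lambda>t. indicator {c..d} t * (g t * window a b (y j) t)) \<in> borel_measurable lborel" for j
      unfolding mult.assoc[symmetric] using m by measurable
    show "AE t in lborel. (\<lambda>j. indicator {c..d} t * (g t * window a b (y j) t)) \<longlonglongrightarrow> indicator {c..d} t * g t * L t"
      unfolding mult.assoc by (intro AE_I2 tendsto_mult_left wL)
    show "AE t in lborel. norm (indicator {c..d} t * (g t * window a b (y j) t)) \<le> pi * norm (indicator {c..d} t * g t)" for j
    proof (rule AE_I2)
      fix t
      have "norm (indicator {c..d} t * g t) * \<bar>window a b (y j) t\<bar> \<le> norm (indicator {c..d} t * g t) * pi"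
        using wb by (rule mult_left_mono) simp
      then show "norm (indicator {c..d} t * (g t * window a b (y j) t)) \<le> pi * norm (indicator {c..d} t * g t)"
        by (simp add: abs_mult mult_ac)
    qed
  qed
  have "(\<lambda>j. pi * (LINT t|\<mu>. window a b (y j) t) - (LINT t|lborel. indicator {c..d} t * (g t * window a b (y j) t))) \<longlonglongrightarrow> 0"
  proof (rule Lim_null_comparison)
    show "\<forall>\<^sub>F j in sequentially. norm (pi * (LINT t|\<mu>. window a b (y j) t) -
        (LINT t|lborel. indicator {c..d} t * (g t * window a b (y j) t))) \<le> \<kappa> * pi * y j"
    proof (intro always_eventually allI)
      fix j
      have "continuous_on {c..d} (\<lambda>t. g t * window a b (y j) t)" by (intro continuous_intros g_cont ypos)
      from set_int(2)[OF this] close[OF ypos[of j]]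
      show "norm (pi * (LINT t|\<mu>. window a b (y j) t) -
        (LINT t|lborel. indicator {c..d} t * (g t * window a b (y j) t))) \<le> \<kappa> * pi * y j" by simp
    qed
    show "(\<lambda>j. \<kappa> * pi * y j) \<longlonglongrightarrow> 0" using tendsto_mult_right_zero[OF y0] by simp
  qed
  moreover have "(\<lambda>j. pi * (LINT t|\<mu>. window a b (y j) t) - (LINT t|lborel. indicator {c..d} t * (g t * window a b (y j) t)))
      \<longlonglongrightarrow> pi * (LINT t|\<mu>. L t) - (LINT t|lborel. indicator {c..d} t * g t * L t)"
    by (intro tendsto_intros lim\<mu> limg)
  ultimately have eq: "pi * (LINT t|\<mu>. L t) = (LINT t|lborel. indicator {c..d} t * g t * L t)"
    using LIMSEQ_unique by fastforce
  have sub: "{a..b} \<subseteq> {c..d}" using order by auto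
  have sab: "set_integrable lborel {a..b} g"
    by (rule borel_integrable_atLeastAtMost'[OF continuous_on_subset[OF g_cont sub]])
  have "(LINT t|lborel. indicator {c..d} t * g t * L t) = (LINT t|lborel. pi * (indicator {a..b} t * g t))"
  proof (rule integral_cong_AE)
    show "(\<lambda>t. indicator {c..d} t * g t * L t) \<in> borel_measurable lborel"
      using borel_measurable_integrable[OF set_int(1)[OF g_cont]] by measurable
    show "(\<lambda>t. pi * (indicator {a..b} t * g t)) \<in> borel_measurable lborel"
      using borel_measurable_integrable[OF sab[unfolded set_integrable_def]] by simp
    show "AE t in lborel. indicator {c..d} t * g t * L t = pi * (indicator {a..b} t * g t)"
      using AE_lborel_singleton[of a] AE_lborel_singleton[of b]
      by eventually_elim (use order in \<open>auto simp: L_def indicator_def\<close>)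
  qed
  also have "\<dots> = pi * integral {a..b} g"
    using set_borel_integral_eq_integral(2)[OF sab] by (simp add: set_lebesgue_integral_def)
  finally have eqL: "(LINT t|\<mu>. L t) = integral {a..b} g" using eq by simp
  have Lint: "integrable \<mu> L"
    by (rule integrable_const_bound[where B = pi]) (auto simp: L_def indicator_def)
  have ind: "integrable \<mu> (\<lambda>t. pi * indicator S t)" if "S \<in> sets borel" for S
    by (intro integrable_mult_right integrable_real_indicator) (auto simp: \<mu>(2) emeasure_eq_measure that)
  have "pi * measure \<mu> {a<..<b} = (LINT t|\<mu>. pi * indicator {a<..<b} t)"
    by (simp add: sets_eq_imp_space_eq[OF \<mu>(2)])
  also have "\<dots> \<le> (LINT t|\<mu>. L t)"
    by (intro integral_mono Lint ind) (auto simp: L_def indicator_def)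
  finally show "pi * measure \<mu> {a<..<b} \<le> integral {a..b} g" unfolding eqL .
  have "(LINT t|\<mu>. L t) \<le> (LINT t|\<mu>. pi * indicator {a..b} t)"
    using order by (intro integral_mono Lint ind) (auto simp: L_def indicator_def)
  also have "\<dots> = pi * measure \<mu> {a..b}"
    by (simp add: sets_eq_imp_space_eq[OF \<mu>(2)])
  finally show "integral {a..b} g \<le> pi * measure \<mu> {a..b}" unfolding eqL .
qed

section \<open>From intervals to the density\<close>

text \<open>
  The two inequalities differ by the mass of the end points, and the upper one excludes atoms.
\<close>

lemma measure_open_interval_eq:
  fixes \<mu> :: "real measure" and g :: "real \<Rightarrow> real"
  assumes \<mu>: "finite_measure \<mu>" "sets \<mu> = sets borel" and g: "continuous_on {c..d} g"
    and upper: "\<And>a b. c < a \<Longrightarrow> a < b \<Longrightarrow> b < d \<Longrightarrow> measure \<mu> {a<..<b} \<le> integral {a..b} g"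
    and lower: "\<And>a b. c < a \<Longrightarrow> a < b \<Longrightarrow> b < d \<Longrightarrow> integral {a..b} g \<le> measure \<mu> {a..b}"
    and order: "c < a" "a < b" "b < d"
  shows "measure \<mu> {a<..<b} = integral {a..b} g"
proof -
  interpret finite_measure \<mu> by (rule \<mu>)
  obtain K where K: "\<And>t. t \<in> {c..d} \<Longrightarrow> g t \<le> K" "K > 0"
  proof -
    have "bounded (g ` {c..d})" by (intro compact_imp_bounded compact_continuous_image g) simp
    then obtain K where "K > 0" "\<forall>y\<in>g ` {c..d}. norm y \<le> K" unfolding bounded_pos by blast
    then show ?thesis by (intro that[of K]) (auto dest!: bspec)
  qed
  have no_atom: "measure \<mu> {s} = 0" if s: "c < s" "s < d" for s
  proof (rule ccontr)
    assume "measure \<mu> {s} \<noteq> 0"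
    then have m: "measure \<mu> {s} > 0" by (simp add: zero_less_measure_iff)
    define h where "h = min (min ((s - c) / 2) ((d - s) / 2)) (measure \<mu> {s} / (4 * K))"
    have h: "h \<le> (s - c) / 2" "h \<le> (d - s) / 2" "h \<le> measure \<mu> {s} / (4 * K)"
      unfolding h_def by linarith+
    have h0: "h > 0" using s m K(2) by (simp add: h_def)
    have hcd: "c < s - h" "s + h < d" using h h0 s by (auto simp: field_simps)
    have "measure \<mu> {s} \<le> measure \<mu> {s - h<..<s + h}"
      using h0 by (intro finite_measure_mono) (auto simp: \<mu>(2))
    also have "\<dots> \<le> integral {s - h..s + h} g" using h0 hcd by (intro upper) auto
    also have "\<dots> \<le> integral {s - h..s + h} (\<lambda>_. K)"
      using hcd K by (intro integral_le integrable_continuous_interval continuous_on_subset[OF g]) auto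
    also have "\<dots> = 2 * h * K" using h0 by simp
    also have "\<dots> \<le> measure \<mu> {s} / 2" using h(3) K(2) by (simp add: field_simps)
    finally show False using m by simp
  qed
  have "measure \<mu> {a..b} = measure \<mu> ({a<..<b} \<union> {a} \<union> {b})"
    using order by (intro arg_cong[where f = "measure \<mu>"]) auto
  also have "\<dots> \<le> measure \<mu> {a<..<b} + measure \<mu> {a} + measure \<mu> {b}"
    by (intro order_trans[OF measure_Un_le] add_mono measure_Un_le order_refl) (auto simp: \<mu>(2))
  also have "\<dots> = measure \<mu> {a<..<b}" using no_atom order by simp
  finally show ?thesis using upper lower order by (meson order.antisym order_trans)
qed

lemma density_on_interval:
  fixes \<mu> :: "real measure" and g :: "real \<Rightarrow> real"
  assumes \<mu>: "finite_measure \<mu>" "sets \<mu> = sets borel"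
    and g: "continuous_on {c..d} g" "g \<in> borel_measurable borel" "\<And>t. g t \<ge> 0"
    and eq: "\<And>a b. c < a \<Longrightarrow> a < b \<Longrightarrow> b < d \<Longrightarrow> measure \<mu> {a<..<b} = integral {a..b} g"
    and order: "c < c'" "c' < d'" "d' < d"
  shows "density \<mu> (indicator {c'<..<d'}) = density lborel (\<lambda>t. indicator {c'<..<d'} t * ennreal (g t))"
proof (rule measure_eqI_lessThan)
  interpret finite_measure \<mu> by (rule \<mu>)
  note [measurable_cong] = \<mu>(2) and [measurable] = g(2)
  let ?I = "{c'<..<d'}"
  show "sets (density \<mu> (indicator ?I)) = sets borel" "sets (density lborel (\<lambda>t. indicator ?I t * ennreal (g t))) = sets borel"
    by (simp_all add: \<mu>(2))
  have em: "emeasure (density \<mu> (indicator ?I)) {x<..} = emeasure \<mu> (?I \<inter> {x<..})" for x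
    by (rule emeasure_restricted) (auto simp: \<mu>(2))
  show "emeasure (density \<mu> (indicator ?I)) {x<..} < \<infinity>" for x
    unfolding em by (simp add: emeasure_eq_measure)
  show "emeasure (density \<mu> (indicator ?I)) {x<..} =
      emeasure (density lborel (\<lambda>t. indicator ?I t * ennreal (g t))) {x<..}" for x
  proof -
    have Ix: "?I \<inter> {x<..} = {max c' x<..<d'}" by auto
    have "emeasure (density lborel (\<lambda>t. indicator ?I t * ennreal (g t))) {x<..} =
        (\<integral>\<^sup>+t. indicator {max c' x<..<d'} t * ennreal (g t) \<partial>lborel)"
      by (subst emeasure_density) (auto intro!: nn_integral_cong simp: indicator_def)
    also have "\<dots> = emeasure \<mu> {max c' x<..<d'}"
    proof (cases "max c' x < d'")
      case True
      let ?a = "max c' x"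
      have sub: "{?a..d'} \<subseteq> {c..d}" using order by auto
      have "(g has_integral integral {?a..d'} g) {?a..d'}"
        by (intro integrable_integral integrable_continuous_interval continuous_on_subset[OF g(1) sub])
      then have "(\<integral>\<^sup>+t. ennreal (indicator {?a..d'} t * g t) \<partial>lborel) = ennreal (integral {?a..d'} g)"
        by (intro nn_integral_has_integral_lebesgue g(3))
      moreover have "(\<integral>\<^sup>+t. indicator {?a<..<d'} t * ennreal (g t) \<partial>lborel) =
          (\<integral>\<^sup>+t. ennreal (indicator {?a..d'} t * g t) \<partial>lborel)"
        using AE_lborel_singleton[of ?a] AE_lborel_singleton[of d']
        by (intro nn_integral_cong_AE, eventually_elim) (auto simp: indicator_def)
      ultimately show ?thesis
        using eq[of ?a d'] True order by (simp add: emeasure_eq_measure)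
    next
      case False
      then have "{max c' x<..<d'} = {}" by auto
      then show ?thesis by simp
    qed
    finally show ?thesis unfolding em Ix ..
  qed
qed

text \<open>
  Off the null set that carries the singular part, the measure has the densities \<open>f\<close> and \<open>g\<close>, so
  these agree almost everywhere.
\<close>

lemma ac_density_eq_on_interval:
  fixes \<mu> :: "real measure" and f g :: "real \<Rightarrow> real"
  assumes \<mu>: "sets \<mu> = sets borel" and f: "is_ac_density f \<mu>"
    and g: "g \<in> borel_measurable borel" "\<And>t. g t \<ge> 0" and I: "I \<in> sets borel"
    and eq: "density \<mu> (indicator I) = density lborel (\<lambda>t. indicator I t * ennreal (g t))"
  shows "AE t in lborel. t \<in> I \<longrightarrow> f t = g t"
proof -
  from f obtain \<nu> N where f_meas [measurable]: "f \<in> borel_measurable borel" and f0: "AE t in lborel. 0 \<le> f t"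
    and \<nu>: "sets \<nu> = sets borel" and N: "N \<in> null_sets lborel" "emeasure \<nu> (UNIV - N) = 0"
    and dec: "\<And>B. B \<in> sets borel \<Longrightarrow> emeasure \<mu> B = emeasure (density lborel (\<lambda>t. ennreal (f t))) B + emeasure \<nu> B"
    unfolding is_ac_density_def lebesgue_singular_def by blast
  note [measurable] = g(1) I
  have N_sets [measurable]: "N \<in> sets borel" using N(1) by (auto simp: null_sets_def)
  have "density lborel (\<lambda>t. indicator (I - N) t * ennreal (f t)) = density lborel (\<lambda>t. indicator (I - N) t * ennreal (g t))"
  proof (rule measure_eqI)
    fix B assume "B \<in> sets (density lborel (\<lambda>t. indicator (I - N) t * ennreal (f t)))"
    then have B [measurable]: "B \<in> sets borel" by simp
    have "emeasure \<nu> (B \<inter> (I - N)) \<le> emeasure \<nu> (UNIV - N)"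
      by (intro emeasure_mono) (auto simp: \<nu>)
    then have \<nu>0: "emeasure \<nu> (B \<inter> (I - N)) = 0" using N(2) by simp
    have "emeasure (density lborel (\<lambda>t. indicator (I - N) t * ennreal (f t))) B =
        emeasure (density lborel (\<lambda>t. ennreal (f t))) (B \<inter> (I - N))"
      by (subst (1 2) emeasure_density) (auto intro!: nn_integral_cong simp: indicator_def)
    also have "\<dots> = emeasure \<mu> (B \<inter> (I - N))" using dec[of "B \<inter> (I - N)"] \<nu>0 by simp
    also have "\<dots> = emeasure \<mu> (I \<inter> (B \<inter> (I - N)))" by (intro arg_cong[where f = "emeasure \<mu>"]) auto
    also have "\<dots> = emeasure (density \<mu> (indicator I)) (B \<inter> (I - N))"
      by (subst emeasure_restricted) (auto simp: \<mu>)
    also have "\<dots> = emeasure (density lborel (\<lambda>t. indicator (I - N) t * ennreal (g t))) B"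
      unfolding eq by (subst (1 2) emeasure_density) (auto intro!: nn_integral_cong simp: indicator_def)
    finally show "emeasure (density lborel (\<lambda>t. indicator (I - N) t * ennreal (f t))) B =
        emeasure (density lborel (\<lambda>t. indicator (I - N) t * ennreal (g t))) B" .
  qed simp
  then have "AE t in lborel. indicator (I - N) t * ennreal (f t) = indicator (I - N) t * ennreal (g t)"
    by (intro sigma_finite_measure.density_unique[OF sigma_finite_lborel]) measurable
  then show ?thesis
    using f0 AE_not_in[OF N(1)]
  proof eventually_elim
    case (elim t)
    then show ?case using g(2)[of t] by (auto simp: indicator_def)
  qed
qed

section \<open>Assembly\<close>

text \<open>
  By the mean value theorem the increments are values of \<open>\<alpha> * s powr (\<alpha> - 1)\<close>, a function that
  decreases to \<open>0\<close>.
\<close>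

lemma powr_weights:
  fixes \<alpha> :: real
  assumes "0 < \<alpha>" "\<alpha> < 1"
  defines "\<beta> \<equiv> \<lambda>k::nat. real k powr \<alpha>"
  shows "\<And>k. k \<ge> 1 \<Longrightarrow> \<beta> k \<ge> 1"
    and "\<And>k. \<beta> k \<le> \<beta> (Suc k)"
    and "\<And>k. k \<ge> 1 \<Longrightarrow> \<beta> (Suc (Suc k)) - \<beta> (Suc k) \<le> \<beta> (Suc k) - \<beta> k"
    and "filterlim \<beta> at_top sequentially"
    and "(\<lambda>k. \<beta> (Suc k) - \<beta> k) \<longlonglongrightarrow> 0"
proof -
  show "\<And>k. k \<ge> 1 \<Longrightarrow> \<beta> k \<ge> 1" using assms by (simp add: ge_one_powr_ge_zero)
  show "\<And>k. \<beta> k \<le> \<beta> (Suc k)" using assms by (simp add: powr_mono2)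
  have mvt: "\<exists>s. real k < s \<and> s < real (Suc k) \<and> \<beta> (Suc k) - \<beta> k = \<alpha> * s powr (\<alpha> - 1)" if k: "k \<ge> 1" for k
  proof -
    have "\<exists>s>real k. s < real (Suc k) \<and> real (Suc k) powr \<alpha> - real k powr \<alpha> =
        (real (Suc k) - real k) * (\<alpha> * s powr (\<alpha> - 1))"
      using k by (intro MVT2) (auto intro!: derivative_eq_intros)
    then show ?thesis by (auto simp: \<beta>_def)
  qed
  show "\<And>k. k \<ge> 1 \<Longrightarrow> \<beta> (Suc (Suc k)) - \<beta> (Suc k) \<le> \<beta> (Suc k) - \<beta> k"
  proof -
    fix k :: nat assume k: "k \<ge> 1"
    obtain s where s: "real k < s" "s < real (Suc k)" "\<beta> (Suc k) - \<beta> k = \<alpha> * s powr (\<alpha> - 1)"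
      using mvt[OF k] by blast
    obtain s' where s': "real (Suc k) < s'" "\<beta> (Suc (Suc k)) - \<beta> (Suc k) = \<alpha> * s' powr (\<alpha> - 1)"
      using mvt[of "Suc k"] by auto
    have "s' powr (\<alpha> - 1) \<le> s powr (\<alpha> - 1)" using s s' k assms by (intro powr_mono2') auto
    then show "\<beta> (Suc (Suc k)) - \<beta> (Suc k) \<le> \<beta> (Suc k) - \<beta> k"
      unfolding s s' using assms by (intro mult_left_mono) auto
  qed
  show "filterlim \<beta> at_top sequentially"
    unfolding \<beta>_def using assms by (intro filterlim_compose[OF real_powr_at_top filterlim_real_sequentially]) auto
  show "(\<lambda>k. \<beta> (Suc k) - \<beta> k) \<longlonglongrightarrow> 0"
  proof (rule Lim_null_comparison)
    show "\<forall>\<^sub>F k in sequentially. norm (\<beta> (Suc k) - \<beta> k) \<le> \<alpha> * real k powr (\<alpha> - 1)"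
      using eventually_ge_at_top[of 1]
    proof eventually_elim
      case (elim k)
      obtain s where s: "real k < s" "\<beta> (Suc k) - \<beta> k = \<alpha> * s powr (\<alpha> - 1)" using mvt[OF elim] by blast
      have "s powr (\<alpha> - 1) \<le> real k powr (\<alpha> - 1)" using s elim assms by (intro powr_mono2') auto
      then show ?case unfolding s using assms by (simp add: abs_mult)
    qed
    have "(\<lambda>k. real k powr (\<alpha> - 1)) \<longlonglongrightarrow> 0"
      using assms by (intro tendsto_neg_powr filterlim_real_sequentially) auto
    then show "(\<lambda>k. \<alpha> * real k powr (\<alpha> - 1)) \<longlonglongrightarrow> 0" by (rule tendsto_mult_right_zero)
  qed
qed

theorem theorem2p2:
  fixes \<alpha> :: real and b :: "nat \<Rightarrow> real"
    and E :: "real set \<Rightarrow> (nat \<Rightarrow> complex) \<Rightarrow> (nat \<Rightarrow> complex)"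
    and f :: "real \<Rightarrow> real"
  assumes "1 / 2 < \<alpha>" and "\<alpha> < 1"
    and "b 0 > 0"
    and "\<And>k. k \<ge> 1 \<Longrightarrow> b (2 * k - 1) = real k powr \<alpha>"
    and "\<And>k. k \<ge> 1 \<Longrightarrow> b (2 * k) = real k powr \<alpha>"
    and "is_spectral_measure_of E (jacobi_domain b) (jacobi_op b)"
    and "is_ac_density f (scalar_spectral_measure E e0)"
  shows "\<exists>g :: real \<Rightarrow> real. continuous_on (UNIV - {0}) g \<and> (\<forall>x\<in>UNIV - {0}. g x > 0) \<and>
           (AE x in lborel. f x = g x)"
proof -
  have b_pos: "b n > 0" for n
  proof (cases "n = 0")
    case False
    show ?thesis
    proof (cases "even n")
      case True
      then obtain k where "n = 2 * k" by (elim evenE)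
      with False show ?thesis using assms(5)[of k] by simp
    next
      case False
      then obtain k where "n = 2 * k + 1" by (elim oddE)
      then show ?thesis using assms(4)[of "Suc k"] by simp
    qed
  qed (use assms(3) in simp)
  have carleman: "\<not> summable (\<lambda>n. 1 / b n)"
  proof
    assume "summable (\<lambda>n. 1 / b n)"
    then have "summable ((\<lambda>n. 1 / b n) \<circ> (\<lambda>k. 2 * k))"
      using b_pos by (intro summable_reindex) (auto simp: inj_def less_imp_le)
    then have "summable (\<lambda>k. real k powr (- \<alpha>))"
      by (rule summable_comparison_test'[where N = 1]) (simp add: assms(5) powr_minus_divide)
    with \<open>\<alpha> < 1\<close> show False by (simp add: summable_real_powr_iff)
  qed
  interpret jacobi_pvm E b
    using assms(6) b_pos carleman by unfold_locales (auto simp: is_spectral_measure_of_def)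
  define \<mu> where "\<mu> = scalar_spectral_measure E e0"
  have \<mu>: "finite_measure \<mu>" "sets \<mu> = sets borel" and o: "orthonormal_for b \<mu>"
    unfolding \<mu>_def by (rule finite_measure_\<sigma>[OF e0_ell2] sets_\<sigma> orthonormal)+
  define A where "A k = amplitude b (2 * k - 1)" for k
  have A_pos: "A k x > 0" for k x unfolding A_def by (rule amplitude_pos[OF b_pos])
  have A_cont: "continuous_on S (A k)" for S k unfolding A_def by (rule continuous_on_amplitude[OF b_pos])
  define l where "l x = lim (\<lambda>k. ln (A k x))" for x
  have l: "uniform_limit K (\<lambda>k x. ln (A k x)) l sequentially" if "compact K" "0 \<notin> K" for K
    unfolding l_def[abs_def] uniformly_convergent_uniform_limit_iff[symmetric] A_def
    by (rule uniformly_convergent_ln_amplitude[where \<beta> = "\<lambda>k. real k powr \<alpha>"])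
       (use assms(1,2,4,5) b_pos powr_weights[of \<alpha>] that in auto)
  have l_cont: "continuous_on K l" if "compact K" "0 \<notin> K" for K
    by (rule uniform_limit_theorem[OF always_eventually l[OF that]])
       (auto intro!: continuous_on_ln A_cont simp: less_imp_neq[OF A_pos, symmetric])
  \<comment> \<open>The value at \<open>0\<close> is arbitrary; it only makes \<open>g\<close> a nonnegative Borel function on the whole line.\<close>
  define g where "g x = (if x = 0 then 0 else exp (- l x))" for x
  have g0: "g x \<ge> 0" for x by (simp add: g_def)
  have g_unif: "uniform_limit K (\<lambda>k x. 1 / A k x) g sequentially" if K: "compact K" "0 \<notin> K" for K
  proof -
    have "bounded (l ` K)" using K by (intro compact_imp_bounded compact_continuous_image l_cont)
    then obtain M where M: "\<And>x. x \<in> K \<Longrightarrow> \<bar>l x\<bar> \<le> M" by (auto simp: bounded_iff)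
    have "uniform_limit K (\<lambda>k x. exp (- ln (A k x))) ((\<lambda>u. exp (- u)) \<circ> l) sequentially"
    proof (rule uniform_limit_compose[OF l[OF K]])
      show "uniformly_continuous_on {-(M + 1)..M + 1} (\<lambda>u::real. exp (- u))"
        by (intro compact_uniformly_continuous continuous_intros) simp
      show "\<forall>\<^sub>F n in sequentially. (\<lambda>x. ln (A n x)) ` K \<subseteq> {-(M + 1)..M + 1}"
        using uniform_limitD[OF l[OF K], of 1, simplified]
      proof eventually_elim
        case (elim n)
        show ?case
        proof (intro image_subsetI)
          fix x assume x: "x \<in> K"
          have "\<bar>ln (A n x) - l x\<bar> < 1" using elim x by (auto simp: dist_real_def)
          then show "ln (A n x) \<in> {-(M + 1)..M + 1}" using M[OF x] by auto
        qed
      qed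
      show "l ` K \<subseteq> {-(M + 1)..M + 1}" using M by (force simp: abs_le_iff)
    qed
    then show ?thesis
    proof (rule uniform_limit_cong'[THEN iffD1, rotated -1])
      show "exp (- ln (A k x)) = 1 / A k x" for k x
        using A_pos[of k x] by (simp add: exp_minus inverse_eq_divide)
      show "((\<lambda>u. exp (- u)) \<circ> l) x = g x" if "x \<in> K" for x
        using that K by (auto simp: g_def)
    qed
  qed
  have g_cont: "continuous_on (UNIV - {0}) g"
  proof -
    have "continuous (at x) g" if x: "x \<noteq> 0" for x
    proof -
      have K: "compact (cball x (\<bar>x\<bar> / 2))" "0 \<notin> cball x (\<bar>x\<bar> / 2)"
        using x by (auto simp: dist_real_def)
      have "continuous_on (cball x (\<bar>x\<bar> / 2)) g"
        by (rule uniform_limit_theorem[OF always_eventually g_unif[OF K]])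
           (auto intro!: continuous_on_divide A_cont simp: less_imp_neq[OF A_pos, symmetric])
      then have "continuous_on (ball x (\<bar>x\<bar> / 2)) g" by (rule continuous_on_subset) auto
      then show ?thesis using x by (simp add: continuous_on_eq_continuous_at)
    qed
    then show ?thesis by (simp add: continuous_on_eq_continuous_at open_Diff)
  qed
  have g_meas: "g \<in> borel_measurable borel"
  proof -
    have "(\<lambda>x. indicator (UNIV - {0}) x *\<^sub>R g x) \<in> borel_measurable borel"
      by (rule borel_measurable_continuous_on_indicator[OF _ g_cont]) simp
    moreover have "(\<lambda>x. indicator (UNIV - {0}) x *\<^sub>R g x) = g" by (auto simp: g_def indicator_def)
    ultimately show ?thesis by (simp only:)
  qed
  have on_interval: "AE t in lborel. t \<in> {c'<..<d'} \<longrightarrow> f t = g t / pi"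
    if cd: "0 \<notin> {c..d}" "c < c'" "c' < d'" "d' < d" for c c' d' d
  proof -
    have sub: "{c..d} \<subseteq> UNIV - {0}" using cd by auto
    have gc: "continuous_on {c..d} (\<lambda>t. g t / pi)"
      by (intro continuous_intros continuous_on_subset[OF g_cont sub]) simp
    have ineq: "pi * measure \<mu> {a<..<b'} \<le> integral {a..b'} g" "integral {a..b'} g \<le> pi * measure \<mu> {a..b'}"
      if "c < a" "a < b'" "b' < d" for a b'
    proof -
      have 1: "1 / A N t \<ge> 0" for N t using A_pos[of N t] by simp
      have 2: "continuous_on UNIV (\<lambda>t. 1 / A N t)" for N
        by (intro continuous_on_divide A_cont continuous_on_const) (use A_pos in \<open>metis less_irrefl\<close>)
      have 3: "integrable lborel (\<lambda>t. 1 / A N t * poisson x y t)" if "y > 0" for N x y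
        unfolding A_def by (rule poisson_amplitude[OF b_pos that])
      have 4: "(LINT t|lborel. 1 / A N t * poisson x y t) \<le> pi / y" if "y > 0" for N x y
      proof -
        have "Im (outgoing b (2 * N - 1) (Complex x y)) \<le> 1 / y"
          using cmod_outgoing_le[where b = b and N = "2 * N - 1" and z = "Complex x y", OF b_pos]
            abs_Im_le_cmod[of "outgoing b (2 * N - 1) (Complex x y)"] that by simp
        then have "pi * Im (outgoing b (2 * N - 1) (Complex x y)) \<le> pi * (1 / y)" by (intro mult_left_mono) auto
        then show ?thesis unfolding A_def poisson_amplitude(2)[OF b_pos that] by simp
      qed
      have 5: "(\<lambda>N. LINT t|lborel. 1 / A N t * poisson x y t) \<longlonglongrightarrow> pi * (LINT t|\<mu>. poisson x y t)"
        if "y > 0" for x y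
      proof -
        \<comment> \<open>The amplitudes are known to converge along the odd sites only, where both weights of a pair agree.\<close>
        have "strict_mono (\<lambda>k::nat. 2 * k - 1)" by (intro strict_monoI_Suc) auto
        from LIMSEQ_subseq_LIMSEQ[OF poisson_amplitude_tendsto[OF b_pos carleman \<mu> o that] this]
        show ?thesis by (simp add: o_def A_def)
      qed
      have 6: "uniform_limit {c..d} (\<lambda>N t. 1 / A N t) g sequentially" using cd by (intro g_unif) auto
      show "pi * measure \<mu> {a<..<b'} \<le> integral {a..b'} g" "integral {a..b'} g \<le> pi * measure \<mu> {a..b'}"
        by (rule stieltjes_inversion_interval[OF \<mu> 1 2 3 4 5 6 that]; assumption)+
    qed
    have "density \<mu> (indicator {c'<..<d'}) = density lborel (\<lambda>t. indicator {c'<..<d'} t * ennreal (g t / pi))"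
    proof (rule density_on_interval[OF \<mu> gc _ _ _ cd(2-4)])
      fix a b' assume ab: "c < a" "a < b'" "b' < d"
      show "measure \<mu> {a<..<b'} = integral {a..b'} (\<lambda>t. g t / pi)"
        by (rule measure_open_interval_eq[OF \<mu> gc _ _ ab]) (use ineq in \<open>auto simp: field_simps\<close>)
    qed (use g_meas g0 in auto)
    then show ?thesis
      using assms(7) g_meas g0 by (intro ac_density_eq_on_interval[OF \<mu>(2)]) (auto simp: \<mu>_def)
  qed
  have ends: "1 / (real n + 3) < 1 / (real n + 2)" "1 / (real n + 2) < real n + 2" for n
    by (auto simp: field_simps intro!: add_pos_nonneg)
  have "AE t in lborel. \<forall>n::nat. t \<in> {1 / (real n + 2)<..<real n + 2} \<longrightarrow> f t = g t / pi"
    unfolding AE_all_countable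
  proof
    fix n :: nat
    show "AE t in lborel. t \<in> {1 / (real n + 2)<..<real n + 2} \<longrightarrow> f t = g t / pi"
      by (rule on_interval[of "1 / (real n + 3)" "real n + 3"]) (use ends in auto)
  qed
  moreover have "AE t in lborel. \<forall>n::nat. t \<in> {- (real n + 2)<..<- (1 / (real n + 2))} \<longrightarrow> f t = g t / pi"
    unfolding AE_all_countable
  proof
    fix n :: nat
    show "AE t in lborel. t \<in> {- (real n + 2)<..<- (1 / (real n + 2))} \<longrightarrow> f t = g t / pi"
      by (rule on_interval[of "- (real n + 3)" "- (1 / (real n + 3))"])
         (use ends[of n] in \<open>auto simp: neg_less_iff_less simp del: minus_add_distrib\<close>)
  qed
  ultimately have "AE t in lborel. f t = g t / pi"
    using AE_lborel_singleton[of "0::real"]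
  proof eventually_elim
    case (elim t)
    obtain n where n: "max \<bar>t\<bar> (1 / \<bar>t\<bar>) < real n" using reals_Archimedean2 by blast
    have "1 / (real n + 2) < \<bar>t\<bar>" "\<bar>t\<bar> < real n + 2"
      using n elim(3) by (auto simp: field_simps)
    then show ?case using elim(1,2)[rule_format, of n] by (cases "t > 0") (auto simp: abs_if split: if_splits)
  qed
  moreover have "continuous_on (UNIV - {0}) (\<lambda>x. g x / pi)" by (intro continuous_intros g_cont) simp
  moreover have "\<forall>x\<in>UNIV - {0}. g x / pi > 0" by (simp add: g_def)
  ultimately show ?thesis by (intro exI[of _ "\<lambda>x. g x / pi"]) blast
qed

end
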